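(* The map $\langle u,w\rangle\mapsto f_{u,w}$ is an isomorphism of posets from $(\mathcal Q(k,n),\le)$ to the poset of bounded affine permutations $(\mathrm{Bound}(k,n),\le)$. Furthermore, $\ell(f_{u,w})=k(n-k)-\ell(w)+\ell(u)$ for all $\langle u,w\rangle\in\mathcal Q(k,n)$.
   Context: Fix integers $0\le k\le n$. On $S_n$, $\ell$ is the number of inversions, $\le$ is the (strong) Bruhat order with covers $\lessdot$, products are composed right to left, and $\sigma_k(w)=w(\{1,\dots,k\})$. The $k$-Bruhat order $\le_k$ on $S_n$ is the reflexive-transitive closure of the relations $u\lessdot_k w$, where $u\lessdot_k w$ iff $u\lessdot w$ and $\sigma_k(u)\ne\sigma_k(w)$. For $u\le_k w$ let $[u,w]_k$ be the interval in $k$-Bruhat order and $[u,w]$ the interval in Bruhat order. $S_k\times S_{n-k}\subset S_n$ is the subgroup preserving $\{1,\dots,k\}$. A factorization $w=ab$ is length-additive if $\ell(w)=\ell(a)+\ell(b)$. Let $\sim$ be the equivalence relation on $k$-Bruhat intervals generated by: $[u,w]_k\sim[x,y]_k$ if there is $z\in S_k\times S_{n-k}$ such that $uz=x$ and $wz=y$ are both length-additive factorizations. $\langle u,w\rangle$ denotes the class of $[u,w]_k$ and $\mathcal Q(k,n)$ is the set of classes, partially ordered by: $q'\le q$ iff there are representatives $[u,w]_k\in q$, $[u',w']_k\in q'$ with $[u',w']\supseteq[u,w]$. An affine permutation is a bijection $f:\mathbb Z\to\mathbb Z$ with $f(i+n)=f(i)+n$; $\tilde S_n^k$ is the set of those with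 $\frac1n\sum_{i=1}^n(f(i)-i)=k$. $\tilde S_n^0$ is the affine symmetric group, a Coxeter group of type $\tilde A_{n-1}$ with its Bruhat order; $\tilde S_n^k$ gets a partial order $\le$ by transport along $f\mapsto f\circ(i\mapsto i-k)$, $\tilde S_n^k\to\tilde S_n^0$. $\ell(f)$ is the number of pairs $i<j$ with $f(i)>f(j)$, modulo simultaneous translation of $(i,j)$ by multiples of $n$. $\mathrm{Bound}(k,n)=\{f\in\tilde S_n^k: i\le f(i)\le i+n\ \forall i\}$ with the restricted Bruhat order. For $u\le_k w$, $f_{u,w}=u\,t_{\omega_k}w^{-1}$, where elements of $S_n$ are extended $n$-periodically to $\mathbb Z$ and $t_{\omega_k}(i)=i+n$ for $1\le i\le k$, $t_{\omega_k}(i)=i$ for $k<i\le n$ (extended periodically). It depends only on $\langle u,w\rangle$. *)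

theory Defs
  imports Complex_Main "HOL-Combinatorics.Permutations"
begin

text \<open>
  Elements of \<open>S\<^sub>n\<close> are functions \<open>int \<Rightarrow> int\<close> that permute \<open>{1..n}\<close> and fix every other integer,
  so that they have the same type as affine permutations. The periodic extension of such an
  element is a different function, \<open>periodic_ext n w\<close>. Products are composed right to left, so
  the product of \<open>u\<close> and \<open>w\<close> is \<open>u \<circ> w\<close>.
\<close>

text \<open>
  The common shape of all Bruhat orders: \<open>u \<rightarrow> ut\<close> whenever \<open>t\<close> is a reflection that increases
  the length. The parameters are the length function and the set of reflections.
\<close>

definition bruhat_le ::
    "((int \<Rightarrow> int) \<Rightarrow> nat) \<Rightarrow> (int \<Rightarrow> int) set \<Rightarrow> (int \<Rightarrow> int) \<Rightarrow> (int \<Rightarrow> int) \<Rightarrow> bool" where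
  "bruhat_le len R = (\<lambda>u w. len u < len w \<and> (\<exists>t\<in>R. w = u \<circ> t))\<^sup>*\<^sup>*"

definition poset_iso :: "'a set \<Rightarrow> 'a rel \<Rightarrow> 'b set \<Rightarrow> 'b rel \<Rightarrow> ('a \<Rightarrow> 'b) \<Rightarrow> bool" where
  "poset_iso A r B s F \<longleftrightarrow>
     partial_order_on A r \<and> partial_order_on B s \<and> bij_betw F A B \<and>
     (\<forall>x\<in>A. \<forall>y\<in>A. (x, y) \<in> r \<longleftrightarrow> (F x, F y) \<in> s)"


section \<open>The symmetric group\<close>

definition Sym :: "nat \<Rightarrow> (int \<Rightarrow> int) set" where
  "Sym n = {w. w permutes {1..int n}}"

definition perm_length :: "nat \<Rightarrow> (int \<Rightarrow> int) \<Rightarrow> nat" where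
  "perm_length n w =
     card {(i, j). 1 \<le> i \<and> i < j \<and> j \<le> int n \<and> w i > w j}"

definition transpositions :: "nat \<Rightarrow> (int \<Rightarrow> int) set" where
  "transpositions n = {transpose a b | a b. 1 \<le> a \<and> a < b \<and> b \<le> int n}"

definition bruhat :: "nat \<Rightarrow> (int \<Rightarrow> int) \<Rightarrow> (int \<Rightarrow> int) \<Rightarrow> bool" where
  "bruhat n u w \<longleftrightarrow>
     u \<in> Sym n \<and> w \<in> Sym n \<and> bruhat_le (perm_length n) (transpositions n) u w"

definition bruhat_cover :: "nat \<Rightarrow> (int \<Rightarrow> int) \<Rightarrow> (int \<Rightarrow> int) \<Rightarrow> bool" where
  "bruhat_cover n u w \<longleftrightarrow>
     bruhat n u w \<and> u \<noteq> w \<and> (\<forall>v. bruhat n u v \<and> bruhat n v w \<longrightarrow> v = u \<or> v = w)"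

definition bruhat_interval :: "nat \<Rightarrow> (int \<Rightarrow> int) \<Rightarrow> (int \<Rightarrow> int) \<Rightarrow> (int \<Rightarrow> int) set" where
  "bruhat_interval n u w = {v. bruhat n u v \<and> bruhat n v w}"

definition sigma :: "nat \<Rightarrow> (int \<Rightarrow> int) \<Rightarrow> int set" where
  "sigma k w = w ` {1..int k}"

definition k_bruhat :: "nat \<Rightarrow> nat \<Rightarrow> (int \<Rightarrow> int) \<Rightarrow> (int \<Rightarrow> int) \<Rightarrow> bool" where
  "k_bruhat k n u w \<longleftrightarrow>
     u \<in> Sym n \<and> w \<in> Sym n \<and>
     (\<lambda>x y. bruhat_cover n x y \<and> sigma k x \<noteq> sigma k y)\<^sup>*\<^sup>* u w"

definition young_subgroup :: "nat \<Rightarrow> nat \<Rightarrow> (int \<Rightarrow> int) set" where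
  "young_subgroup k n = {z \<in> Sym n. z ` {1..int k} = {1..int k}}"


section \<open>Equivalence classes of \<open>k\<close>-Bruhat intervals\<close>

text \<open>
  An interval of the \<open>k\<close>-Bruhat order is represented by its pair of endpoints, which are the
  least and the greatest element of the interval and hence determined by it.
\<close>

definition k_intervals :: "nat \<Rightarrow> nat \<Rightarrow> ((int \<Rightarrow> int) \<times> (int \<Rightarrow> int)) set" where
  "k_intervals k n = {(u, w). k_bruhat k n u w}"

definition k_step ::
    "nat \<Rightarrow> nat \<Rightarrow> (int \<Rightarrow> int) \<times> (int \<Rightarrow> int) \<Rightarrow> (int \<Rightarrow> int) \<times> (int \<Rightarrow> int) \<Rightarrow> bool" where
  "k_step k n = (\<lambda>(u, w) (x, y).
     (u, w) \<in> k_intervals k n \<and> (x, y) \<in> k_intervals k n \<and>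
     (\<exists>z\<in>young_subgroup k n.
        u \<circ> z = x \<and> perm_length n x = perm_length n u + perm_length n z \<and>
        w \<circ> z = y \<and> perm_length n y = perm_length n w + perm_length n z))"

definition k_equiv :: "nat \<Rightarrow> nat \<Rightarrow> ((int \<Rightarrow> int) \<times> (int \<Rightarrow> int)) rel" where
  "k_equiv k n =
     {(p, q). p \<in> k_intervals k n \<and> q \<in> k_intervals k n \<and> equivclp (k_step k n) p q}"

definition k_class ::
    "nat \<Rightarrow> nat \<Rightarrow> (int \<Rightarrow> int) \<Rightarrow> (int \<Rightarrow> int) \<Rightarrow> ((int \<Rightarrow> int) \<times> (int \<Rightarrow> int)) set" where
  "k_class k n u w = k_equiv k n `` {(u, w)}"

definition Q :: "nat \<Rightarrow> nat \<Rightarrow> ((int \<Rightarrow> int) \<times> (int \<Rightarrow> int)) set set" where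
  "Q k n = k_intervals k n // k_equiv k n"

text \<open>
  Smaller classes have larger intervals. The intervals compared here are intervals of the
  ordinary Bruhat order, not of the \<open>k\<close>-Bruhat order.
\<close>

definition Q_order :: "nat \<Rightarrow> nat \<Rightarrow> ((int \<Rightarrow> int) \<times> (int \<Rightarrow> int)) set rel" where
  "Q_order k n = {(q', q). q' \<in> Q k n \<and> q \<in> Q k n \<and>
     (\<exists>(u, w)\<in>q. \<exists>(u', w')\<in>q'. bruhat_interval n u' w' \<supseteq> bruhat_interval n u w)}"


section \<open>Affine permutations\<close>

definition affine_perms :: "nat \<Rightarrow> nat \<Rightarrow> (int \<Rightarrow> int) set" where
  "affine_perms k n = {f. bij f \<and> (\<forall>i. f (i + int n) = f i + int n) \<and>
     (\<Sum>i = 1..int n. real_of_int (f i - i)) / real n = real k}"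

text \<open>
  The simple reflection exchanging \<open>i + mn\<close> and \<open>i + 1 + mn\<close> for all \<open>m\<close>. It makes sense only
  for \<open>n \<ge> 2\<close>; for \<open>n = 1\<close> the affine symmetric group is trivial and has no generators.
\<close>

definition affine_simple :: "nat \<Rightarrow> int \<Rightarrow> int \<Rightarrow> int" where
  "affine_simple n i = (\<lambda>j.
     if j mod int n = i mod int n then j + 1
     else if j mod int n = (i + 1) mod int n then j - 1
     else j)"

definition affine_generators :: "nat \<Rightarrow> (int \<Rightarrow> int) set" where
  "affine_generators n = {affine_simple n i | i. 2 \<le> n \<and> 0 \<le> i \<and> i < int n}"

definition coxeter_length :: "(int \<Rightarrow> int) set \<Rightarrow> (int \<Rightarrow> int) \<Rightarrow> nat" where
  "coxeter_length S f = (LEAST m. \<exists>ss. length ss = m \<and> set ss \<subseteq> S \<and> f = foldr (\<circ>) ss id)"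

definition affine_reflections :: "nat \<Rightarrow> (int \<Rightarrow> int) set" where
  "affine_reflections n =
     {g \<circ> s \<circ> inv g | g s. g \<in> affine_perms 0 n \<and> s \<in> affine_generators n}"

definition affine_bruhat0 :: "nat \<Rightarrow> (int \<Rightarrow> int) \<Rightarrow> (int \<Rightarrow> int) \<Rightarrow> bool" where
  "affine_bruhat0 n f g \<longleftrightarrow> f \<in> affine_perms 0 n \<and> g \<in> affine_perms 0 n \<and>
     bruhat_le (coxeter_length (affine_generators n)) (affine_reflections n) f g"

definition affine_bruhat :: "nat \<Rightarrow> nat \<Rightarrow> (int \<Rightarrow> int) \<Rightarrow> (int \<Rightarrow> int) \<Rightarrow> bool" where
  "affine_bruhat k n f g \<longleftrightarrow> f \<in> affine_perms k n \<and> g \<in> affine_perms k n \<and>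
     affine_bruhat0 n (f \<circ> (\<lambda>i. i - int k)) (g \<circ> (\<lambda>i. i - int k))"

definition affine_length :: "nat \<Rightarrow> (int \<Rightarrow> int) \<Rightarrow> nat" where
  "affine_length n f =
     card ({(i, j). i < j \<and> f i > f j} //
           {((i, j), (i', j')). \<exists>m. i' = i + m * int n \<and> j' = j + m * int n})"

definition Bound :: "nat \<Rightarrow> nat \<Rightarrow> (int \<Rightarrow> int) set" where
  "Bound k n = {f \<in> affine_perms k n. \<forall>i. i \<le> f i \<and> f i \<le> i + int n}"

definition Bound_order :: "nat \<Rightarrow> nat \<Rightarrow> (int \<Rightarrow> int) rel" where
  "Bound_order k n = {(f, g). f \<in> Bound k n \<and> g \<in> Bound k n \<and> affine_bruhat k n f g}"


section \<open>The bounded affine permutation of an interval\<close>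

text \<open>For \<open>n \<ge> 1\<close>, the unique \<open>f\<close> with \<open>f (i + n) = f i + n\<close> agreeing with \<open>g\<close> on \<open>{1..n}\<close>.\<close>

definition periodic_ext :: "nat \<Rightarrow> (int \<Rightarrow> int) \<Rightarrow> int \<Rightarrow> int" where
  "periodic_ext n g = (\<lambda>i. g ((i - 1) mod int n + 1) + int n * ((i - 1) div int n))"

definition t_omega :: "nat \<Rightarrow> nat \<Rightarrow> int \<Rightarrow> int" where
  "t_omega k n = periodic_ext n (\<lambda>i. if i \<le> int k then i + int n else i)"

definition f_perm :: "nat \<Rightarrow> nat \<Rightarrow> (int \<Rightarrow> int) \<Rightarrow> (int \<Rightarrow> int) \<Rightarrow> int \<Rightarrow> int" where
  "f_perm k n u w = periodic_ext n u \<circ> t_omega k n \<circ> periodic_ext n (inv w)"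

text \<open>
  The map on classes. The use of \<open>the_elem\<close> is meaningful only if \<open>f_perm\<close> is constant on the
  class.
\<close>

definition class_map ::
    "nat \<Rightarrow> nat \<Rightarrow> ((int \<Rightarrow> int) \<times> (int \<Rightarrow> int)) set \<Rightarrow> int \<Rightarrow> int" where
  "class_map k n q = the_elem ((\<lambda>(u, w). f_perm k n u w) ` q)"

end

theory Submission
  imports Defs
begin

text \<open>
  By the criterion of Bergeron and Sottile, \<open>u \<le>\<^sub>k w\<close> holds iff \<open>f\<close>, defined by \<open>f (w p) = u p + n\<close> for
  \<open>p \<le> k\<close> and \<open>f (w p) = u p\<close> for \<open>p > k\<close>, is bounded and every inversion of \<open>w\<close> inside one of the two
  blocks of positions is an inversion of \<open>u\<close>. The second condition lets one strip length-additive
  factors from \<open>S\<^sub>k \<times> S\<^sub>n\<^sub>-\<^sub>k\<close>, so every class has a representative with \<open>w\<close> increasing on both blocks,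
  and \<open>f\<close> determines it.

  If \<open>w\<close> is increasing on the blocks, a reflection raising \<open>u\<close> raises \<open>f\<close>; if \<open>u\<close> is decreasing on the
  blocks, a reflection raising \<open>w\<close> lowers \<open>f\<close>. For \<open>u' \<le> u \<le> w \<le> w'\<close> the lifting property reduces to
  \<open>w'\<close> increasing; then \<open>f\<close> grows from \<open>(u', w')\<close> to \<open>(u, w')\<close>, and from there to \<open>(u, w)\<close> after \<open>u\<close> has
  been made decreasing. Conversely, bounded affine permutations form a lower set, so a Bruhat chain
  between two of them consists of single reflections, each of which moves one endpoint of a suitable
  representative.
\<close>

section \<open>The Bruhat order of the symmetric group\<close>

text \<open>The comparison of the two Bruhat orders rests on one fact about lengths: multiplying by
  the reflection that exchanges positions \<open>a < b\<close> lengthens a permutation iff its value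
  at \<open>a\<close> is below its value at \<open>b\<close>. For \<open>Sym n\<close> this comes
  from counting inversions; for the affine group, whose length counts letters of words, it comes
  from strong exchange. Both orders become chains of value comparisons, which the formula for
  \<open>f_perm\<close> can match with each other.

  The order on classes chooses representatives on both sides, so two comparisons in a row may
  present the middle class by unrelated pairs. The remedy is to fix the outer pair and let only the
  inner one vary: whether some inner pair fits depends on the class of the outer one alone. This is
  a second use of the lifting property, and it is also what joins the single reflections of a Bruhat
  chain into one nested pair of intervals.\<close>

definition up_step :: "nat \<Rightarrow> (int \<Rightarrow> int) \<Rightarrow> (int \<Rightarrow> int) \<Rightarrow> bool" where
  "up_step n u v \<longleftrightarrow>
     (\<exists>a b. 1 \<le> a \<and> a < b \<and> b \<le> int n \<and> u a < u b \<and> v = u \<circ> transpose a b)"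

text \<open>The relations by length and by values agree only on genuine permutations; the invariant
  \<open>I\<close> carries that restriction along a chain.\<close>

lemma rtranclp_cong_on:
  assumes "\<And>x y. I x \<Longrightarrow> R x y \<longleftrightarrow> S x y" and "\<And>x y. I x \<Longrightarrow> S x y \<Longrightarrow> I y" and "I x"
  shows "R\<^sup>*\<^sup>* x y \<longleftrightarrow> S\<^sup>*\<^sup>* x y"
proof
  assume "R\<^sup>*\<^sup>* x y"
  then have "S\<^sup>*\<^sup>* x y \<and> I y"
    by induction (use assms in \<open>auto intro: rtranclp.rtrancl_into_rtrancl\<close>)
  then show "S\<^sup>*\<^sup>* x y" ..
next
  assume "S\<^sup>*\<^sup>* x y"
  then have "R\<^sup>*\<^sup>* x y \<and> I y"
    by induction (use assms in \<open>auto intro: rtranclp.rtrancl_into_rtrancl\<close>)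
  then show "R\<^sup>*\<^sup>* x y" ..
qed

lemma Sym_inj: "u \<in> Sym n \<Longrightarrow> u a = u b \<longleftrightarrow> a = b"
  by (auto simp: Sym_def dest: permutes_inj injD)

lemma Sym_range: "u \<in> Sym n \<Longrightarrow> u a \<in> {1..int n} \<longleftrightarrow> a \<in> {1..int n}"
  by (auto simp: Sym_def permutes_in_image simp del: atLeastAtMost_iff)

lemma Sym_image: "u \<in> Sym n \<Longrightarrow> u ` {1..int n} = {1..int n}"
  by (simp add: Sym_def permutes_image)

lemma Sym_transpose:
  assumes "u \<in> Sym n" "1 \<le> a" "a \<le> int n" "1 \<le> b" "b \<le> int n"
  shows "u \<circ> transpose a b \<in> Sym n"
  using assms by (auto simp: Sym_def intro!: permutes_compose permutes_swap_id)

lemma Sym_eqI: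
  assumes "u \<in> Sym n" "v \<in> Sym n" "\<And>i. i \<in> {1..int n} \<Longrightarrow> u i = v i"
  shows "u = v"
proof
  fix i show "u i = v i"
    using assms by (cases "i \<in> {1..int n}") (auto simp: Sym_def permutes_def)
qed

lemma comp_transpose_cancel [simp]: "u \<circ> transpose a b \<circ> transpose a b = u"
  by (simp add: comp_assoc)

section \<open>Inversion numbers under multiplication by a transposition\<close>

lemma perm_length_sum:
  "int (perm_length n w) =
     (\<Sum>i\<in>{1..int n}. \<Sum>j\<in>{1..int n}. of_bool (i < j \<and> w j < w i))"
proof -
  have "{(i, j). 1 \<le> i \<and> i < j \<and> j \<le> int n \<and> w i > w j} =
     ({1..int n} \<times> {1..int n}) \<inter> {x. fst x < snd x \<and> w (snd x) < w (fst x)}"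
    by auto
  then have "int (perm_length n w) =
      (\<Sum>x\<in>{1..int n} \<times> {1..int n}. of_bool (fst x < snd x \<and> w (snd x) < w (fst x)))"
    by (simp add: perm_length_def sum_of_bool_eq)
  also have "\<dots> = (\<Sum>(i, j)\<in>{1..int n} \<times> {1..int n}. of_bool (i < j \<and> w j < w i))"
    by (rule sum.cong) auto
  finally show ?thesis by (simp only: sum.cartesian_product)
qed

text \<open>Isolates the rows and columns of \<open>a\<close> and \<open>b\<close>, the only ones in
  which the inversion tables of \<open>u\<close> and \<open>u \<circ> transpose a b\<close> can
  differ.\<close>

lemma double_sum_split:
  fixes h :: "'a \<Rightarrow> 'a \<Rightarrow> int"
  assumes "finite I" "a \<in> I" "b \<in> I" "a \<noteq> b"
  shows "(\<Sum>i\<in>I. \<Sum>j\<in>I. h i j) =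
    (\<Sum>i\<in>I - {a, b}. \<Sum>j\<in>I - {a, b}. h i j)
    + (\<Sum>c\<in>I - {a, b}. h a c + h b c + h c a + h c b) + (h a a + h a b + h b a + h b b)"
proof -
  have split: "(\<Sum>i\<in>I. g i) = g a + g b + (\<Sum>i\<in>I - {a, b}. g i)" for g :: "'a \<Rightarrow> int"
  proof -
    have "I = insert a (insert b (I - {a, b}))" using assms by auto
    moreover have "finite (I - {a, b})" using assms by auto
    ultimately have "(\<Sum>i\<in>I. g i) = (\<Sum>i\<in>insert a (insert b (I - {a, b})). g i)" by simp
    then show ?thesis using \<open>finite (I - {a, b})\<close> \<open>a \<noteq> b\<close> by simp
  qed
  show ?thesis
    by (subst split, subst (1 2 3) split) (simp add: sum.distrib algebra_simps)
qed

lemma perm_length_transpose: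
  assumes u: "u \<in> Sym n" and ab: "1 \<le> a" "a < b" "b \<le> int n" and lt: "u a < u b"
  shows "perm_length n (u \<circ> transpose a b) =
    perm_length n u + 1 + 2 * card {c. a < c \<and> c < b \<and> u a < u c \<and> u c < u b}"
proof -
  let ?I = "{1..int n}" and ?v = "u \<circ> transpose a b"
  let ?C = "?I - {a, b}"
  let ?h = "\<lambda>w i j. of_bool (i < j \<and> w j < w i) :: int"
  let ?g = "\<lambda>w c. ?h w a c + ?h w b c + ?h w c a + ?h w c b"
  let ?M = "{c. a < c \<and> c < b \<and> u a < u c \<and> u c < u b}"
  have vC: "?v c = u c" if "c \<in> ?C" for c using that by (auto simp: transpose_def)
  have va: "?v a = u b" "?v b = u a" by auto
  \<comment> \<open>A third position matters only if it lies between \<open>a\<close> and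
    \<open>b\<close> both in position and in value; then both of its pairs turn into inversions.
    Otherwise their number of inversions is unchanged.\<close>
  have g: "?g ?v c = ?g u c + 2 * of_bool (c \<in> ?M)" if c: "c \<in> ?C" for c
  proof -
    have "c \<noteq> a" "c \<noteq> b" "u c \<noteq> u a" "u c \<noteq> u b" using c Sym_inj[OF u] by auto
    then show ?thesis
      using ab lt unfolding vC[OF c] va by (auto simp: of_bool_def)
  qed
  have M: "?M = ?C \<inter> {c. c \<in> ?M}" using ab by auto
  have "(\<Sum>c\<in>?C. of_bool (c \<in> ?M)) = (int (card ?M) :: int)"
    by (subst sum_of_bool_eq) (use M in \<open>auto intro!: arg_cong[where f = card]\<close>)
  then have s: "(\<Sum>c\<in>?C. ?g ?v c) = (\<Sum>c\<in>?C. ?g u c) + 2 * int (card ?M)"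
    using g by (simp add: sum.distrib sum_distrib_left[symmetric] del: of_bool_eq_iff)
  have d: "(\<Sum>i\<in>?C. \<Sum>j\<in>?C. ?h ?v i j) = (\<Sum>i\<in>?C. \<Sum>j\<in>?C. ?h u i j)"
    by (intro sum.cong refl) (simp only: vC)
  have a: "a \<in> ?I" "b \<in> ?I" "a \<noteq> b" using ab by auto
  have "int (perm_length n ?v) = int (perm_length n u) + 1 + 2 * int (card ?M)"
    unfolding perm_length_sum
    unfolding double_sum_split[OF finite_atLeastAtMost_int a, of "?h ?v"]
      double_sum_split[OF finite_atLeastAtMost_int a, of "?h u"] d va
    using ab lt s by simp
  then show ?thesis by linarith
qed

lemma perm_length_less_iff:
  assumes u: "u \<in> Sym n" and ab: "1 \<le> a" "a < b" "b \<le> int n"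
  shows "perm_length n u < perm_length n (u \<circ> transpose a b) \<longleftrightarrow> u a < u b"
proof (cases "u a < u b")
  case True
  then show ?thesis using perm_length_transpose[OF u ab] by simp
next
  case False
  then have "u b < u a" using Sym_inj[OF u] ab by (metis linorder_less_linear less_irrefl)
  then have "perm_length n (u \<circ> transpose a b) < perm_length n u"
    using perm_length_transpose[OF Sym_transpose[OF u, of a b] ab] ab by simp
  then show ?thesis using False by simp
qed

section \<open>Bruhat chains and covers\<close>

lemma up_step_Sym: "u \<in> Sym n \<Longrightarrow> up_step n u v \<Longrightarrow> v \<in> Sym n"
  unfolding up_step_def using Sym_transpose[of u n] by auto

lemma up_steps_Sym: "(up_step n)\<^sup>*\<^sup>* u v \<Longrightarrow> u \<in> Sym n \<Longrightarrow> v \<in> Sym n"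
  by (induction rule: rtranclp_induct) (auto intro: up_step_Sym)

lemma up_step_length: "u \<in> Sym n \<Longrightarrow> up_step n u v \<Longrightarrow> perm_length n u < perm_length n v"
  unfolding up_step_def using perm_length_less_iff[of u n] by blast

lemma up_steps_length:
  assumes "(up_step n)\<^sup>*\<^sup>* u v" "u \<in> Sym n"
  shows "u = v \<or> perm_length n u < perm_length n v"
  using assms
proof (induction rule: rtranclp_induct)
  case (step y z)
  then show ?case using up_steps_Sym[OF step(1)] up_step_length[of y n z] by fastforce
qed simp

lemma bruhat_iff_up_steps:
  "bruhat n u w \<longleftrightarrow> u \<in> Sym n \<and> w \<in> Sym n \<and> (up_step n)\<^sup>*\<^sup>* u w"
proof -
  have "(perm_length n u < perm_length n w \<and> (\<exists>t\<in>transpositions n. w = u \<circ> t)) = up_step n u w"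
    if "u \<in> Sym n" for u w
    using that perm_length_less_iff[of u n] unfolding up_step_def transpositions_def by blast
  then have "bruhat_le (perm_length n) (transpositions n) u w = (up_step n)\<^sup>*\<^sup>* u w" if "u \<in> Sym n"
    unfolding bruhat_le_def using that
    by (intro rtranclp_cong_on[where I = "\<lambda>u. u \<in> Sym n"]) (auto intro: up_step_Sym)
  then show ?thesis unfolding bruhat_def by blast
qed

lemma bruhat_refl: "u \<in> Sym n \<Longrightarrow> bruhat n u u"
  by (simp add: bruhat_iff_up_steps)

lemma bruhat_trans: "bruhat n u v \<Longrightarrow> bruhat n v w \<Longrightarrow> bruhat n u w"
  by (auto simp: bruhat_iff_up_steps)

lemma bruhat_length: "bruhat n u v \<Longrightarrow> u = v \<or> perm_length n u < perm_length n v"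
  by (auto simp: bruhat_iff_up_steps dest: up_steps_length)

lemma bruhat_transpose:
  assumes "u \<in> Sym n" "1 \<le> a" "a < b" "b \<le> int n" "u a < u b"
  shows "bruhat n u (u \<circ> transpose a b)"
  using assms Sym_transpose[of u n a b] unfolding bruhat_iff_up_steps up_step_def by auto

text \<open>An intermediate position refines the step into three, following the pattern 123, 213,
  312, 321. Without one the length grows by exactly 1, which leaves no room for a further
  element.\<close>

lemma bruhat_cover_iff:
  "bruhat_cover n u w \<longleftrightarrow> u \<in> Sym n \<and>
     (\<exists>a b. 1 \<le> a \<and> a < b \<and> b \<le> int n \<and> u a < u b \<and> w = u \<circ> transpose a b \<and>
       (\<forall>c. a < c \<and> c < b \<longrightarrow> \<not> (u a < u c \<and> u c < u b)))" (is "?L \<longleftrightarrow> ?R")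
proof
  assume L: ?L
  then have b: "bruhat n u w" "u \<noteq> w" "u \<in> Sym n"
    and mid: "\<And>v. bruhat n u v \<Longrightarrow> bruhat n v w \<Longrightarrow> v = u \<or> v = w"
    by (auto simp: bruhat_cover_def bruhat_iff_up_steps)
  then obtain v where v: "up_step n u v" "(up_step n)\<^sup>*\<^sup>* v w"
    unfolding bruhat_iff_up_steps by (metis converse_rtranclpE)
  have "v \<noteq> u" using up_step_length[OF b(3) v(1)] by auto
  moreover have "bruhat n u v" "bruhat n v w"
    using b v up_step_Sym[OF b(3) v(1)] by (auto simp: bruhat_iff_up_steps)
  ultimately have "v = w" using mid by blast
  then obtain a b where ab: "1 \<le> a" "a < b" "b \<le> int n" "u a < u b" "w = u \<circ> transpose a b"
    using v(1) unfolding up_step_def by auto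
  have "\<not> (u a < u c \<and> u c < u b)" if c: "a < c" "c < b" for c
  proof
    assume uc: "u a < u c \<and> u c < u b"
    let ?x = "u \<circ> transpose a c"
    let ?y = "?x \<circ> transpose a b"
    have 1: "bruhat n u ?x" by (rule bruhat_transpose) (use ab b c uc in auto)
    have x: "?x \<in> Sym n" using 1 by (simp add: bruhat_iff_up_steps)
    have xv: "?x a = u c" "?x c = u a" "?x b = u b" using c by (auto simp: transpose_def)
    have 2: "bruhat n ?x ?y"
      by (rule bruhat_transpose[OF x]) (use ab c uc xv in \<open>auto simp del: comp_apply\<close>)
    have y: "?y \<in> Sym n" using 2 by (simp add: bruhat_iff_up_steps)
    have yv: "?y a = u b" "?y c = u a" "?y b = u c" using c by (auto simp: transpose_def)
    have 3: "bruhat n ?y (?y \<circ> transpose c b)"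
      by (rule bruhat_transpose[OF y]) (use ab c uc yv in \<open>auto simp del: comp_apply\<close>)
    have "?y \<circ> transpose c b = w" using ab c by (auto simp: fun_eq_iff transpose_def)
    then have "bruhat n ?x w" using bruhat_trans[OF 2 3] by simp
    then have "?x = u \<or> ?x = w" using mid 1 by blast
    then have "?x a = u a \<or> ?x a = w a" by metis
    then show False using xv uc ab by auto
  qed
  then show ?R using ab b by blast
next
  assume ?R
  then obtain a b where u: "u \<in> Sym n" and ab: "1 \<le> a" "a < b" "b \<le> int n" "u a < u b"
    and w: "w = u \<circ> transpose a b" and c: "\<And>c. a < c \<Longrightarrow> c < b \<Longrightarrow> \<not> (u a < u c \<and> u c < u b)"
    by blast
  have empty: "{c. a < c \<and> c < b \<and> u a < u c \<and> u c < u b} = {}" using c by auto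
  have len: "perm_length n w = perm_length n u + 1"
    using perm_length_transpose[OF u ab] unfolding empty w by simp
  then have "u \<noteq> w" by auto
  moreover have "v = u \<or> v = w" if "bruhat n u v" "bruhat n v w" for v
    using bruhat_length[OF that(1)] bruhat_length[OF that(2)] len by auto
  ultimately show ?L using bruhat_transpose[OF u ab] w by (auto simp: bruhat_cover_def)
qed

section \<open>The lifting property for adjacent transpositions\<close>

lemma perm_length_adjacent:
  assumes "u \<in> Sym n" "1 \<le> p" "p < int n" "u p < u (p + 1)"
  shows "perm_length n (u \<circ> transpose p (p + 1)) = perm_length n u + 1"
proof -
  have empty: "{c. p < c \<and> c < p + 1 \<and> u p < u c \<and> u c < u (p + 1)} = {}" by auto
  show ?thesis using perm_length_transpose[of u n p "p + 1", unfolded empty] assms by simp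
qed

text \<open>Conjugation by \<open>transpose p (p + 1)\<close> sends the transposition of
  \<open>a < b\<close> to that of their images, and these stay in order unless the pair is
  \<open>(p, p + 1)\<close> itself.\<close>

lemma up_step_adjacent:
  assumes "up_step n x y" "1 \<le> p" "p < int n"
  shows "y = x \<circ> transpose p (p + 1) \<or>
    up_step n (x \<circ> transpose p (p + 1)) (y \<circ> transpose p (p + 1))"
proof -
  let ?s = "transpose p (p + 1)"
  obtain a b where ab: "1 \<le> a" "a < b" "b \<le> int n" "x a < x b" "y = x \<circ> transpose a b"
    using assms unfolding up_step_def by auto
  show ?thesis
  proof (cases "a = p \<and> b = p + 1")
    case False
    have s: "1 \<le> ?s a" "?s a < ?s b" "?s b \<le> int n"
      using False ab assms by (auto simp: transpose_def)
    have "y \<circ> ?s = x \<circ> ?s \<circ> transpose (?s a) (?s b)"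
      unfolding ab by (auto simp: fun_eq_iff transpose_def)
    then have "up_step n (x \<circ> ?s) (y \<circ> ?s)"
      unfolding up_step_def using s ab
      by (intro exI[of _ "?s a"] exI[of _ "?s b"]) simp
    then show ?thesis ..
  qed (use ab in auto)
qed

text \<open>\<open>sort_down\<close> and \<open>sort_up\<close> choose the shorter and the longer
  element of the coset of \<open>x\<close> under \<open>transpose p (p + 1)\<close>. In these terms
  the lifting property says that both choices are monotone.\<close>

definition sort_down :: "int \<Rightarrow> (int \<Rightarrow> int) \<Rightarrow> int \<Rightarrow> int" where
  "sort_down p x = (if x (p + 1) < x p then x \<circ> transpose p (p + 1) else x)"

definition sort_up :: "int \<Rightarrow> (int \<Rightarrow> int) \<Rightarrow> int \<Rightarrow> int" where
  "sort_up p x = (if x (p + 1) < x p then x else x \<circ> transpose p (p + 1))"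

lemma up_steps_sort:
  assumes x: "x \<in> Sym n" and p: "1 \<le> p" "p < int n"
  shows "(up_step n)\<^sup>*\<^sup>* (sort_down p x) x" "(up_step n)\<^sup>*\<^sup>* (sort_down p x) (x \<circ> transpose p (p + 1))"
    "(up_step n)\<^sup>*\<^sup>* x (sort_up p x)" "(up_step n)\<^sup>*\<^sup>* (x \<circ> transpose p (p + 1)) (sort_up p x)"
proof -
  let ?s = "transpose p (p + 1)"
  have "up_step n x (x \<circ> ?s)" if "x p < x (p + 1)"
    using that p unfolding up_step_def by (intro exI[of _ p] exI[of _ "p + 1"]) simp
  moreover have "up_step n (x \<circ> ?s) x" if "x (p + 1) < x p"
    using that p unfolding up_step_def by (intro exI[of _ p] exI[of _ "p + 1"]) simp
  moreover have "x p < x (p + 1) \<or> x (p + 1) < x p"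
    using Sym_inj[OF x, of p "p + 1"] by linarith
  ultimately show "(up_step n)\<^sup>*\<^sup>* (sort_down p x) x"
    "(up_step n)\<^sup>*\<^sup>* (sort_down p x) (x \<circ> transpose p (p + 1))"
    "(up_step n)\<^sup>*\<^sup>* x (sort_up p x)" "(up_step n)\<^sup>*\<^sup>* (x \<circ> transpose p (p + 1)) (sort_up p x)"
    by (auto simp: sort_down_def sort_up_def)
qed

text \<open>A step from \<open>y\<close> to \<open>z\<close> is accompanied by one between the
  swapped elements, unless it is the swap itself, which both maps collapse. Since
  \<open>sort_down p y\<close> lies below both members of its coset, it can take whichever of the
  two steps ends in \<open>sort_down p z\<close>; \<open>sort_up\<close> is dual.\<close>

lemma up_steps_lifting:
  assumes "(up_step n)\<^sup>*\<^sup>* x y" "x \<in> Sym n" "1 \<le> p" "p < int n"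
  shows "(up_step n)\<^sup>*\<^sup>* (sort_down p x) (sort_down p y) \<and> (up_step n)\<^sup>*\<^sup>* (sort_up p x) (sort_up p y)"
  using assms
proof (induction rule: rtranclp_induct)
  case (step y z)
  let ?s = "transpose p (p + 1)"
  have y: "y \<in> Sym n" using up_steps_Sym[OF step.hyps(1)] step.prems by auto
  then have z: "z \<in> Sym n" using up_step_Sym step.hyps by blast
  have ny: "y p \<noteq> y (p + 1)" using Sym_inj[OF y, of p "p + 1"] by linarith
  have "(up_step n)\<^sup>*\<^sup>* (sort_down p y) (sort_down p z) \<and> (up_step n)\<^sup>*\<^sup>* (sort_up p y) (sort_up p z)"
  proof (cases "z = y \<circ> ?s")
    case True
    then have "sort_down p y = sort_down p z" "sort_up p y = sort_up p z"
      using ny by (auto simp: sort_down_def sort_up_def)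
    then show ?thesis by simp
  next
    case False
    then have "up_step n (y \<circ> ?s) (z \<circ> ?s)"
      using up_step_adjacent[OF step.hyps(2)] step.prems by blast
    moreover have "sort_down p z = z \<or> sort_down p z = z \<circ> ?s" "sort_up p y = y \<or> sort_up p y = y \<circ> ?s"
      by (auto simp: sort_down_def sort_up_def)
    ultimately show ?thesis
      using up_steps_sort[OF y step.prems(2,3)] up_steps_sort[OF z step.prems(2,3)] step.hyps(2)
      by (metis rtranclp.rtrancl_into_rtrancl converse_rtranclp_into_rtranclp)
  qed
  then show ?case using step by auto
qed simp

lemma bruhat_sort_down:
  assumes "bruhat n x y" "1 \<le> p" "p < int n"
  shows "bruhat n (sort_down p x) (sort_down p y)"
  using assms up_steps_lifting[of n x y p] Sym_transpose[of _ n p "p + 1"]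
  by (auto simp: bruhat_iff_up_steps sort_down_def)

lemma bruhat_sort_up:
  assumes "bruhat n x y" "1 \<le> p" "p < int n"
  shows "bruhat n (sort_up p x) (sort_up p y)"
  using assms up_steps_lifting[of n x y p] Sym_transpose[of _ n p "p + 1"]
  by (auto simp: bruhat_iff_up_steps sort_up_def)

section \<open>The criterion of Bergeron and Sottile\<close>

definition same_block :: "nat \<Rightarrow> nat \<Rightarrow> int \<Rightarrow> int \<Rightarrow> bool" where
  "same_block k n a b \<longleftrightarrow> 1 \<le> a \<and> a < b \<and> b \<le> int n \<and> (b \<le> int k \<or> int k < a)"

text \<open>The criterion of Bergeron and Sottile for comparability in the \<open>k\<close>-Bruhat order.\<close>

definition bs_pair :: "nat \<Rightarrow> nat \<Rightarrow> (int \<Rightarrow> int) \<Rightarrow> (int \<Rightarrow> int) \<Rightarrow> bool" where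
  "bs_pair k n u w \<longleftrightarrow> u \<in> Sym n \<and> w \<in> Sym n \<and>
     (\<forall>a. 1 \<le> a \<and> a \<le> int k \<longrightarrow> u a \<le> w a) \<and>
     (\<forall>b. int k < b \<and> b \<le> int n \<longrightarrow> w b \<le> u b) \<and>
     (\<forall>a b. same_block k n a b \<and> u a < u b \<longrightarrow> w a < w b)"

lemma sigma_transpose:
  assumes "u \<in> Sym n" "1 \<le> a" "a < b" "b \<le> int n"
  shows "sigma k u \<noteq> sigma k (u \<circ> transpose a b) \<longleftrightarrow> a \<le> int k \<and> int k < b"
proof
  assume ne: "sigma k u \<noteq> sigma k (u \<circ> transpose a b)"
  show "a \<le> int k \<and> int k < b"
  proof (rule ccontr)
    assume "\<not> ?thesis"
    then have "a \<in> {1..int k} \<longleftrightarrow> b \<in> {1..int k}" using assms by auto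
    then have "transpose a b ` {1..int k} = {1..int k}" by (rule transpose_image_eq)
    then show False using ne unfolding sigma_def image_comp[symmetric] by metis
  qed
next
  assume k: "a \<le> int k \<and> int k < b"
  have "(u \<circ> transpose a b) a \<in> sigma k (u \<circ> transpose a b)"
    unfolding sigma_def by (rule imageI) (use assms k in simp)
  moreover have "u b \<notin> sigma k u"
    using k Sym_inj[OF assms(1)] unfolding sigma_def by fastforce
  ultimately show "sigma k u \<noteq> sigma k (u \<circ> transpose a b)" by auto
qed

definition k_cover :: "nat \<Rightarrow> nat \<Rightarrow> (int \<Rightarrow> int) \<Rightarrow> (int \<Rightarrow> int) \<Rightarrow> bool" where
  "k_cover k n u w \<longleftrightarrow> bruhat_cover n u w \<and> sigma k u \<noteq> sigma k w"

lemma k_cover_iff: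
  "k_cover k n u w \<longleftrightarrow> u \<in> Sym n \<and>
     (\<exists>a b. 1 \<le> a \<and> a \<le> int k \<and> int k < b \<and> b \<le> int n \<and> u a < u b \<and> w = u \<circ> transpose a b \<and>
       (\<forall>c. a < c \<and> c < b \<longrightarrow> \<not> (u a < u c \<and> u c < u b)))" (is "?L \<longleftrightarrow> ?R")
proof
  assume ?L
  then show ?R unfolding k_cover_def bruhat_cover_iff using sigma_transpose by blast
next
  assume ?R
  then obtain a b where ab: "u \<in> Sym n" "1 \<le> a" "a \<le> int k" "int k < b" "b \<le> int n" "u a < u b"
    "w = u \<circ> transpose a b" "\<forall>c. a < c \<and> c < b \<longrightarrow> \<not> (u a < u c \<and> u c < u b)" by blast
  then have "a < b" by simp
  then show ?L unfolding k_cover_def bruhat_cover_iff using ab sigma_transpose[of u n a b k] by blast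
qed

lemma k_bruhat_iff_covers: "k_bruhat k n u w \<longleftrightarrow> u \<in> Sym n \<and> w \<in> Sym n \<and> (k_cover k n)\<^sup>*\<^sup>* u w"
  by (simp add: k_bruhat_def k_cover_def[abs_def])

lemma k_cover_bruhat: "k_cover k n u w \<Longrightarrow> bruhat n u w"
  by (auto simp: k_cover_def bruhat_cover_def)

lemma k_bruhat_imp_bruhat:
  assumes "k_bruhat k n u w"
  shows "bruhat n u w"
proof -
  have "(k_cover k n)\<^sup>*\<^sup>* u w" "u \<in> Sym n" using assms by (auto simp: k_bruhat_iff_covers)
  then show ?thesis
    by induction (auto intro: bruhat_refl bruhat_trans k_cover_bruhat)
qed

text \<open>Raising \<open>v p\<close> to \<open>v q\<close> could only overtake a position of the
  first block behind \<open>p\<close> with a value in between. Such a position lies between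
  \<open>p\<close> and \<open>q\<close>, where the cover condition forbids these values. Lowering
  \<open>v q\<close> is symmetric in the second block.\<close>

lemma bs_pair_k_cover:
  assumes "bs_pair k n u v" "k_cover k n v w"
  shows "bs_pair k n u w"
proof -
  obtain p q where v: "v \<in> Sym n" and pq: "1 \<le> p" "p \<le> int k" "int k < q" "q \<le> int n" "v p < v q"
    and w: "w = v \<circ> transpose p q" and c: "\<And>c. p < c \<Longrightarrow> c < q \<Longrightarrow> \<not> (v p < v c \<and> v c < v q)"
    using assms(2) unfolding k_cover_iff by blast
  have wS: "w \<in> Sym n" unfolding w by (rule Sym_transpose[OF v]) (use pq in auto)
  have wv: "w p = v q" "w q = v p" "\<And>a. a \<noteq> p \<Longrightarrow> a \<noteq> q \<Longrightarrow> w a = v a"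
    unfolding w by (auto simp: transpose_def)
  have u: "u \<in> Sym n" "\<And>a. 1 \<le> a \<Longrightarrow> a \<le> int k \<Longrightarrow> u a \<le> v a"
     "\<And>b. int k < b \<Longrightarrow> b \<le> int n \<Longrightarrow> v b \<le> u b"
     "\<And>a b. same_block k n a b \<Longrightarrow> u a < u b \<Longrightarrow> v a < v b"
    using assms(1) by (auto simp: bs_pair_def)
  have 1: "u a \<le> w a" if "1 \<le> a" "a \<le> int k" for a
    using u(2)[OF that] wv(1,3)[of] wv(3)[of a] pq that by (cases "a = p") auto
  have 2: "w b \<le> u b" if "int k < b" "b \<le> int n" for b
    using u(3)[OF that] wv(2) wv(3)[of b] pq that by (cases "b = q") auto
  have 3: "w a < w b" if s: "same_block k n a b" and l: "u a < u b" for a b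
  proof -
    have vab: "v a < v b" using u(4) s l by blast
    have ab: "1 \<le> a" "a < b" "b \<le> int n" "b \<le> int k \<or> int k < a" using s by (auto simp: same_block_def)
    have ne: "v b \<noteq> v q" if "b \<noteq> q" using that Sym_inj[OF v] by simp
    have ne': "v a \<noteq> v p" if "a \<noteq> p" using that Sym_inj[OF v] by simp
    show ?thesis
    proof (cases "b \<le> int k")
      case True
      then have nq: "a \<noteq> q" "b \<noteq> q" "b < q" using ab pq by auto
      show ?thesis
      proof (cases "a = p")
        case True
        then show ?thesis using c[of b] nq ab vab wv(1) wv(3)[of b] ne by auto
      next
        case False
        then show ?thesis using vab wv(1) wv(3)[of a] wv(3)[of b] nq pq by (cases "b = p") auto
      qed
    next
      case False
      then have np: "a \<noteq> p" "b \<noteq> p" "p < a" using ab pq by auto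
      show ?thesis
      proof (cases "b = q")
        case True
        then show ?thesis using c[of a] np ab vab wv(2) wv(3)[of a] ne' by auto
      next
        case False
        then show ?thesis using vab wv(2) wv(3)[of a] wv(3)[of b] np pq by (cases "a = q") auto
      qed
    qed
  qed
  show ?thesis unfolding bs_pair_def using u(1) wS 1 2 3 by blast
qed

lemma bs_pair_refl: "u \<in> Sym n \<Longrightarrow> bs_pair k n u u"
  by (simp add: bs_pair_def)

text \<open>Both permutations have the same sum of values; if nothing in the first block rises, then
  no value rises anywhere, so none can fall either.\<close>

lemma bs_pair_exists_moving:
  assumes "k \<le> n" "bs_pair k n u w" "u \<noteq> w"
  shows "\<exists>a. 1 \<le> a \<and> a \<le> int k \<and> u a < w a"
proof (rule ccontr)
  assume no: "\<not> ?thesis"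
  have u: "u \<in> Sym n" and w: "w \<in> Sym n" and le: "\<And>a. 1 \<le> a \<Longrightarrow> a \<le> int k \<Longrightarrow> u a \<le> w a"
     "\<And>b. int k < b \<Longrightarrow> b \<le> int n \<Longrightarrow> w b \<le> u b"
    using assms(2) unfolding bs_pair_def by blast+
  have wu: "w i \<le> u i" if "i \<in> {1..int n}" for i
    using no le(2) that by (cases "i \<le> int k") force+
  have "(\<Sum>i\<in>{1..int n}. v i) = (\<Sum>i\<in>{1..int n}. i)" if "v \<in> Sym n" for v
    using sum.permute[of v "{1..int n}" id] that by (simp add: Sym_def)
  then have "(\<Sum>i\<in>{1..int n}. u i) = (\<Sum>i\<in>{1..int n}. w i)" using u w by metis
  then have "(\<Sum>i\<in>{1..int n}. u i - w i) = 0" by (simp add: sum_subtractf)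
  then have "\<forall>i\<in>{1..int n}. u i - w i = 0"
    using wu by (subst (asm) sum_nonneg_eq_0_iff) auto
  then have "u = w" by (intro Sym_eqI[OF u w]) simp
  then show False using assms(3) by contradiction
qed

text \<open>
  One step of the Bergeron-Sottile algorithm: \<open>a\<close> has the largest value \<open>u a\<close> among the positions
  up to \<open>k\<close> that still have to move, and \<open>b\<close> the smallest value \<open>u b\<close> above \<open>u a\<close> that has to move
  to \<open>u a\<close> or below.
\<close>

lemma bs_pair_first_cover:
  assumes kn: "k \<le> n" and g: "bs_pair k n u w" and ne: "u \<noteq> w"
  obtains v where "k_cover k n u v" "bs_pair k n v w"
proof -
  have u: "u \<in> Sym n" and w: "w \<in> Sym n" and le: "\<And>a. 1 \<le> a \<Longrightarrow> a \<le> int k \<Longrightarrow> u a \<le> w a"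
     "\<And>b. int k < b \<Longrightarrow> b \<le> int n \<Longrightarrow> w b \<le> u b"
    and mono: "\<And>a b. same_block k n a b \<Longrightarrow> u a < u b \<Longrightarrow> w a < w b"
    using g unfolding bs_pair_def by blast+
  let ?A = "{a \<in> {1..int k}. u a < w a}"
  have "finite ?A" by (rule finite_subset[of _ "{1..int k}"]) auto
  then have "u ` ?A \<noteq> {}" "finite (u ` ?A)" using bs_pair_exists_moving[OF kn g ne] by auto
  then have "Max (u ` ?A) \<in> u ` ?A" by (rule Max_in[rotated])
  then obtain a where ua: "Max (u ` ?A) = u a" and a: "a \<in> ?A" by (rule imageE)
  have fixed: "w c = u c" if "1 \<le> c" "c \<le> int k" "u a < u c" for c
  proof (rule ccontr)
    assume "w c \<noteq> u c"
    then have "c \<in> ?A" using le(1)[OF that(1,2)] that by simp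
    then have "u c \<le> u a" unfolding ua[symmetric] using \<open>finite ?A\<close> by (intro Max_ge) auto
    then show False using that by simp
  qed
  let ?J = "{i \<in> {1..int n}. u a < u i \<and> u i \<le> w a}"
  let ?B = "{b. int k < b \<and> b \<le> int n \<and> w b \<le> u a \<and> u a < u b \<and> u b \<le> w a}"
  \<comment> \<open>Pigeonhole: were \<open>?B\<close> empty, \<open>w\<close> would map
    \<open>?J\<close> into, hence onto, the values above \<open>u a\<close> and up to
    \<open>w a\<close>. The value \<open>w a\<close> would then be attained in \<open>?J\<close>, so
    \<open>a\<close> would belong to \<open>?J\<close>, which it does not.\<close>
  have "?B \<noteq> {}"
  proof
    assume B: "?B = {}"
    have "w ` ?J \<subseteq> u ` ?J"
    proof
      fix y assume "y \<in> w ` ?J"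
      then obtain i where i: "i \<in> ?J" "y = w i" by auto
      have "u a < w i \<and> w i \<le> w a"
      proof (cases "i \<le> int k")
        case True
        then show ?thesis using fixed[of i] i by auto
      next
        case False
        then have "w i \<le> u i" using le(2) i by auto
        then show ?thesis using B i False by auto
      qed
      moreover have "w i \<in> {1..int n}" using i Sym_range[OF w] by auto
      then obtain j where "j \<in> {1..int n}" "w i = u j" using Sym_image[OF u] by (metis imageE)
      ultimately show "y \<in> u ` ?J" using i by auto
    qed
    moreover have "card (w ` ?J) = card (u ` ?J)"
      using Sym_inj[OF u] Sym_inj[OF w] by (simp add: card_image inj_on_def)
    moreover have "finite (u ` ?J)"
      by (intro finite_imageI finite_subset[of ?J "{1..int n}"]) auto
    ultimately have "w ` ?J = u ` ?J" by (intro card_subset_eq)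
    moreover have "w a \<in> u ` ?J"
    proof -
      have "w a \<in> {1..int n}" using a kn Sym_range[OF w, of a] by auto
      then obtain j where "j \<in> {1..int n}" "w a = u j" using Sym_image[OF u] by (metis imageE)
      then show ?thesis using a by auto
    qed
    ultimately have "w a \<in> w ` ?J" by simp
    then obtain i where "w a = w i" "i \<in> ?J" by (rule imageE)
    then have "a \<in> ?J" using Sym_inj[OF w] by auto
    then show False by simp
  qed
  moreover have "finite ?B" by (rule finite_subset[of _ "{1..int n}"]) auto
  ultimately have "Min (u ` ?B) \<in> u ` ?B" by (intro Min_in) auto
  then obtain b where ub: "Min (u ` ?B) = u b" and b: "b \<in> ?B" by (rule imageE)
  have minb: "u a < w c" if "int k < c" "c \<le> int n" "u a < u c" "u c < u b" for c
  proof (rule ccontr)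
    assume "\<not> u a < w c"
    then have "c \<in> ?B" using that b by auto
    then have "u b \<le> u c" unfolding ub[symmetric] using \<open>finite ?B\<close> by (intro Min_le) auto
    then show False using that by simp
  qed
  let ?v = "u \<circ> transpose a b"
  have vS: "?v \<in> Sym n" by (rule Sym_transpose[OF u]) (use a b kn in auto)
  have ab: "1 \<le> a" "a \<le> int k" "int k < b" "b \<le> int n" "u a < u b" "u a < w a"
    "w b \<le> u a" "u b \<le> w a" using a b by auto
  \<comment> \<open>Both extremal choices are used. In the first block maximality of
    \<open>u a\<close> gives \<open>w c = u c < u b \<le> w a\<close>; in the second, minimality of
    \<open>u b\<close> gives \<open>w b \<le> u a < w c\<close>. Each contradicts monotonicity
    inside the block.\<close>
  have "\<not> (u a < u c \<and> u c < u b)" if "a < c" "c < b" for c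
  proof
    assume uc: "u a < u c \<and> u c < u b"
    show False
    proof (cases "c \<le> int k")
      case True
      then have "same_block k n a c" using ab that kn by (auto simp: same_block_def)
      then have "w a < w c" using mono uc by blast
      then show False using fixed[of c] True that ab uc by auto
    next
      case False
      then have "same_block k n c b" using ab that by (auto simp: same_block_def)
      then have "w c < w b" using mono uc by blast
      then show False using minb[of c] False that ab uc by auto
    qed
  qed
  then have "k_cover k n u ?v" unfolding k_cover_iff using u ab by blast
  moreover have "bs_pair k n ?v w"
  proof -
    have vv: "?v a = u b" "?v b = u a" "\<And>c. c \<noteq> a \<Longrightarrow> c \<noteq> b \<Longrightarrow> ?v c = u c"
      by (auto simp: transpose_def)
    have 1: "?v c \<le> w c" if "1 \<le> c" "c \<le> int k" for c
      using le(1)[OF that] vv(1) vv(3)[of c] ab that by (cases "c = a") auto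
    have 2: "w c \<le> ?v c" if "int k < c" "c \<le> int n" for c
      using le(2)[OF that] vv(2) vv(3)[of c] ab that by (cases "c = b") auto
    have 3: "w c < w d" if s: "same_block k n c d" and l: "?v c < ?v d" for c d
    proof -
      have cd: "1 \<le> c" "c < d" "d \<le> int n" "d \<le> int k \<or> int k < c" using s by (auto simp: same_block_def)
      note m = mono[OF s]
      have ne: "u d \<noteq> u b" "w d \<noteq> w b" if "d \<noteq> b" using that Sym_inj[OF u] Sym_inj[OF w] by auto
      have ne': "u c \<noteq> u a" if "c \<noteq> a" using that Sym_inj[OF u] by auto
      show ?thesis
      proof (cases "d \<le> int k")
        case True
        then have nb: "c \<noteq> b" "d \<noteq> b" using cd ab by auto
        consider "c = a" | "d = a" | "c \<noteq> a" "d \<noteq> a" by blast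
        then show ?thesis
        proof cases
          case 1
          then show ?thesis using l vv(1) vv(3)[of d] nb m ab cd by auto
        next
          case 2
          then have "u c < u b" using l vv(1) vv(3)[of c] nb cd by auto
          then show ?thesis
            using 2 m fixed[of c] True cd ab ne' by (cases "u c < u a") auto
        next
          case 3
          then show ?thesis using l vv(3)[of c] vv(3)[of d] nb m by auto
        qed
      next
        case False
        then have na: "c \<noteq> a" "d \<noteq> a" "int k < c" using cd ab by auto
        consider "c = b" | "d = b" | "c \<noteq> b" "d \<noteq> b" by blast
        then show ?thesis
        proof cases
          case 1
          then have "u a < u d" using l vv(2) vv(3)[of d] na cd by auto
          then show ?thesis
            using 1 m minb[of d] False cd ab ne by (cases "u b < u d") auto
        next
          case 2
          then show ?thesis using l vv(2) vv(3)[of c] na m ab cd by auto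
        next
          case 3
          then show ?thesis using l vv(3)[of c] vv(3)[of d] na m by auto
        qed
      qed
    qed
    show ?thesis unfolding bs_pair_def using vS w 1 2 3 by blast
  qed
  ultimately show ?thesis using that by blast
qed

theorem k_bruhat_iff_bs_pair:
  assumes kn: "k \<le> n"
  shows "k_bruhat k n u w \<longleftrightarrow> bs_pair k n u w"
proof
  assume "k_bruhat k n u w"
  then have "(k_cover k n)\<^sup>*\<^sup>* u w" "u \<in> Sym n" by (auto simp: k_bruhat_iff_covers)
  then show "bs_pair k n u w"
    by induction (auto intro: bs_pair_refl bs_pair_k_cover)
next
  assume "bs_pair k n u w"
  then have "(k_cover k n)\<^sup>*\<^sup>* u w"
  \<comment> \<open>A cover raises exactly one position of the first block, so the total distance
    still to climb decreases; \<open>bs_pair\<close> keeps it nonnegative.\<close>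
  proof (induction "nat (\<Sum>a\<in>{1..int k}. w a - u a)" arbitrary: u rule: less_induct)
    case less
    show ?case
    proof (cases "u = w")
      case False
      then obtain v where v: "k_cover k n u v" "bs_pair k n v w"
        using bs_pair_first_cover[OF kn less.prems] by blast
      then obtain a b where ab: "1 \<le> a" "a \<le> int k" "int k < b" "u a < u b" "v = u \<circ> transpose a b"
        unfolding k_cover_iff by blast
      have le: "w c - v c \<le> w c - u c" if "c \<in> {1..int k}" for c
        using that ab by (auto simp: transpose_def)
      have "(\<Sum>c\<in>{1..int k}. w c - v c) < (\<Sum>c\<in>{1..int k}. w c - u c)"
        by (rule sum_strict_mono_ex1) (use le ab in \<open>auto intro!: bexI[of _ a]\<close>)
      moreover have "0 \<le> (\<Sum>c\<in>{1..int k}. w c - v c)"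
        using v(2) by (intro sum_nonneg) (auto simp: bs_pair_def)
      ultimately have "(k_cover k n)\<^sup>*\<^sup>* v w" using less.hyps[OF _ v(2)] by linarith
      with v(1) show ?thesis by (rule converse_rtranclp_into_rtranclp)
    qed simp
  qed
  then show "k_bruhat k n u w"
    using \<open>bs_pair k n u w\<close> by (auto simp: k_bruhat_iff_covers bs_pair_def)
qed

section \<open>Affine permutations\<close>

definition periodic :: "nat \<Rightarrow> (int \<Rightarrow> int) \<Rightarrow> bool" where
  "periodic n f \<longleftrightarrow> (\<forall>i. f (i + int n) = f i + int n)"

lemma periodic_mult:
  assumes "periodic n f"
  shows "f (i + m * int n) = f i + m * int n"
proof -
  have nat: "f (i + int j * int n) = f i + int j * int n" for i j
  proof (induction j)
    case (Suc j)
    have "f (i + int (Suc j) * int n) = f ((i + int j * int n) + int n)" by (simp add: algebra_simps)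
    also have "\<dots> = f (i + int j * int n) + int n" using assms by (simp only: periodic_def)
    finally show ?case using Suc by (simp add: algebra_simps)
  qed simp
  show ?thesis
  proof (cases "0 \<le> m")
    case True
    then show ?thesis using nat[of i "nat m"] by simp
  next
    case False
    then show ?thesis using nat[of "i + m * int n" "nat (- m)"] by simp
  qed
qed

lemma mod_eq_obtain:
  fixes a b :: int
  assumes "a mod n = b mod n"
  obtains m where "b = a + m * n"
  using assms by (metis mod_eqE mult.commute add.commute diff_add_cancel mod_eq_dvd_iff dvdE)

lemma periodic_mod_iff:
  assumes "periodic n f" "inj f"
  shows "f a mod int n = f b mod int n \<longleftrightarrow> a mod int n = b mod int n"
proof
  assume "f a mod int n = f b mod int n"
  then obtain m where "f b = f a + m * int n" by (rule mod_eq_obtain)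
  then have "f b = f (a + m * int n)" using periodic_mult[OF assms(1)] by simp
  then have "b = a + m * int n" using assms(2) by (simp add: inj_eq)
  then show "a mod int n = b mod int n" by simp
next
  assume "a mod int n = b mod int n"
  then obtain m where "b = a + m * int n" by (rule mod_eq_obtain)
  then show "f a mod int n = f b mod int n" using periodic_mult[OF assms(1), of a m] by simp
qed

text \<open>A reflection only if \<open>a\<close> and \<open>b\<close> are incongruent modulo \<open>n\<close>.\<close>

definition aff_refl :: "nat \<Rightarrow> int \<Rightarrow> int \<Rightarrow> int \<Rightarrow> int" where
  "aff_refl n a b = (\<lambda>i. if i mod int n = a mod int n then i + (b - a)
     else if i mod int n = b mod int n then i + (a - b) else i)"

lemma aff_refl_apply:
  assumes "a mod int n \<noteq> b mod int n"
  shows "aff_refl n a b (a + m * int n) = b + m * int n"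
    "aff_refl n a b (b + m * int n) = a + m * int n"
    "i mod int n \<noteq> a mod int n \<Longrightarrow> i mod int n \<noteq> b mod int n \<Longrightarrow> aff_refl n a b i = i"
  using assms by (auto simp: aff_refl_def)

lemma aff_refl_apply':
  assumes "a mod int n \<noteq> b mod int n"
  shows "aff_refl n a b a = b" "aff_refl n a b b = a"
  using aff_refl_apply(1,2)[OF assms, of 0] by auto

lemma aff_refl_cases:
  obtains (a) m where "i = a + m * int n" | (b) m where "i = b + m * int n"
  | (other) "i mod int n \<noteq> a mod int n" "i mod int n \<noteq> b mod int n"
  using mod_eq_obtain[of a "int n" i] mod_eq_obtain[of b "int n" i] by metis

lemma aff_refl_involution:
  assumes "a mod int n \<noteq> b mod int n"
  shows "aff_refl n a b \<circ> aff_refl n a b = id"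
proof
  fix i show "(aff_refl n a b \<circ> aff_refl n a b) i = id i"
    by (cases rule: aff_refl_cases[where i = i and a = a and b = b and n = n]) (simp_all add: aff_refl_apply[OF assms])
qed

lemma aff_refl_bij: "a mod int n \<noteq> b mod int n \<Longrightarrow> bij (aff_refl n a b)"
  using aff_refl_involution by (metis o_bij)

lemma aff_refl_periodic: "periodic n (aff_refl n a b)"
  by (auto simp: periodic_def aff_refl_def)

lemma aff_refl_translate: "aff_refl n (a + m * int n) (b + m * int n) = aff_refl n a b"
  by (auto simp: aff_refl_def)

text \<open>A periodic injection carries residue classes to residue classes, and so transports the
  exchange of two classes to their images. This trades right multiplication for left
  multiplication.\<close>

lemma comp_aff_refl:
  assumes ab: "a mod int n \<noteq> b mod int n" and f: "periodic n f" "inj f"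
  shows "f \<circ> aff_refl n a b = aff_refl n (f a) (f b) \<circ> f"
proof
  fix i
  have ab': "f a mod int n \<noteq> f b mod int n" using ab periodic_mod_iff[OF f] by simp
  show "(f \<circ> aff_refl n a b) i = (aff_refl n (f a) (f b) \<circ> f) i"
  proof (cases rule: aff_refl_cases[where i = i and a = a and b = b and n = n])
    case other
    then have "f i mod int n \<noteq> f a mod int n" "f i mod int n \<noteq> f b mod int n"
      using periodic_mod_iff[OF f] by auto
    then show ?thesis using other by (simp add: aff_refl_apply[OF ab] aff_refl_apply[OF ab'])
  qed (simp_all add: aff_refl_apply[OF ab] aff_refl_apply[OF ab'] periodic_mult[OF f(1)])
qed

lemma affine_simple_eq: "affine_simple n i = aff_refl n i (i + 1)"
  by (auto simp: affine_simple_def aff_refl_def fun_eq_iff)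

lemma mod_Suc_neq:
  assumes "2 \<le> n"
  shows "i mod int n \<noteq> (i + 1) mod int n"
proof
  assume "i mod int n = (i + 1) mod int n"
  then have "int n dvd 1" by (metis mod_eq_dvd_iff add_diff_cancel_left')
  then show False using assms by simp
qed

lemma affine_generators_eq:
  "affine_generators n = {aff_refl n i (i + 1) | i. 2 \<le> n}"
proof -
  have "\<exists>j. 2 \<le> n \<and> 0 \<le> j \<and> j < int n \<and> aff_refl n i (i + 1) = aff_refl n j (j + 1)" if "2 \<le> n" for i
  proof (intro exI conjI)
    show "0 \<le> i mod int n" "i mod int n < int n" using that by auto
    show "aff_refl n i (i + 1) = aff_refl n (i mod int n) (i mod int n + 1)"
      using aff_refl_translate[of n "i mod int n" "i div int n" "i mod int n + 1"]
      by (simp add: algebra_simps)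
  qed (use that in auto)
  then show ?thesis unfolding affine_generators_def affine_simple_eq by blast
qed

section \<open>Affine permutations and sums over a window\<close>

lemma affine_perms_periodic: "f \<in> affine_perms k n \<Longrightarrow> periodic n f"
  by (simp add: affine_perms_def periodic_def)

lemma affine_perms_bij: "f \<in> affine_perms k n \<Longrightarrow> bij f"
  by (simp add: affine_perms_def)

lemma affine_perms_iff:
  assumes "1 \<le> n"
  shows "f \<in> affine_perms k n \<longleftrightarrow>
    bij f \<and> periodic n f \<and> (\<Sum>i = 1..int n. f i - i) = int k * int n"
proof -
  have "(\<Sum>i = 1..int n. real_of_int (f i - i)) / real n = real k \<longleftrightarrow>
     real_of_int (\<Sum>i = 1..int n. f i - i) = real_of_int (int k * int n)"
    using assms by (simp add: field_simps)
  then show ?thesis unfolding affine_perms_def periodic_def of_int_eq_iff by simp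
qed

definition residue_rep :: "nat \<Rightarrow> int \<Rightarrow> int" where
  "residue_rep n i = (i - 1) mod int n + 1"

lemma residue_rep:
  assumes "1 \<le> n"
  shows "residue_rep n i \<in> {1..int n}" "residue_rep n i mod int n = i mod int n"
    "residue_rep n i + (i - 1) div int n * int n = i"
proof -
  have "0 \<le> (i - 1) mod int n" "(i - 1) mod int n < int n" using assms by auto
  then show "residue_rep n i \<in> {1..int n}" by (auto simp: residue_rep_def)
  show "residue_rep n i mod int n = i mod int n"
    by (simp add: residue_rep_def mod_simps)
  show "residue_rep n i + (i - 1) div int n * int n = i"
    using mod_div_mult_eq[of "i - 1" "int n"] unfolding residue_rep_def by linarith
qed

lemma residue_unique:
  assumes "i \<in> {1..int n}" "j \<in> {1..int n}" "i mod int n = j mod int n"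
  shows "i = j"
proof -
  have "(i - 1) mod int n = (j - 1) mod int n" using assms(3) by (metis mod_diff_left_eq)
  then show ?thesis using assms by simp
qed

text \<open>Multiplication by a reflection changes a periodic quantity on two residue classes only;
  the change of its window sum can be read off at \<open>a\<close> and \<open>b\<close>, wherever
  they lie.\<close>

lemma sum_two_residues:
  fixes g :: "int \<Rightarrow> int"
  assumes n: "1 \<le> n" and ab: "a mod int n \<noteq> b mod int n"
    and per: "\<And>i m. g (i + m * int n) = g i"
    and zero: "\<And>i. i mod int n \<noteq> a mod int n \<Longrightarrow> i mod int n \<noteq> b mod int n \<Longrightarrow> g i = 0"
  shows "(\<Sum>i = 1..int n. g i) = g a + g b"
proof -
  let ?a = "residue_rep n a" and ?b = "residue_rep n b"
  have "(\<Sum>i = 1..int n. g i) = (\<Sum>i\<in>{?a, ?b}. g i)"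
  proof (rule sum.mono_neutral_right)
    show "\<forall>i\<in>{1..int n} - {?a, ?b}. g i = 0"
      using zero residue_unique residue_rep[OF n] by (metis DiffE insertCI)
  qed (use residue_rep(1)[OF n] in auto)
  also have "\<dots> = g ?a + g ?b" using ab residue_rep(2)[OF n, of a] residue_rep(2)[OF n, of b] by (subst sum.insert) auto
  also have "g ?a = g a" using per residue_rep(3)[OF n] by metis
  also have "g ?b = g b" using per residue_rep(3)[OF n] by metis
  finally show ?thesis .
qed

lemma affine_perms_comp_aff_refl:
  assumes n: "1 \<le> n" and ab: "a mod int n \<noteq> b mod int n" and f: "f \<in> affine_perms k n"
  shows "f \<circ> aff_refl n a b \<in> affine_perms k n"
proof -
  have fp: "periodic n f" and fb: "bij f" and fs: "(\<Sum>i = 1..int n. f i - i) = int k * int n"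
    using f affine_perms_iff[OF n] by auto
  let ?h = "f \<circ> aff_refl n a b"
  let ?g = "\<lambda>i. ?h i - f i"
  have hp: "periodic n ?h" using fp aff_refl_periodic[of n a b] by (simp add: periodic_def)
  have "(\<Sum>i = 1..int n. ?g i) = ?g a + ?g b"
    by (rule sum_two_residues[OF n ab])
      (use aff_refl_apply(3)[OF ab] periodic_mult[OF hp] periodic_mult[OF fp] in auto)
  also have "\<dots> = 0" using aff_refl_apply'[OF ab] by simp
  finally have "(\<Sum>i = 1..int n. ?h i - i) = (\<Sum>i = 1..int n. f i - i)"
    by (simp add: sum_subtractf)
  moreover have "bij ?h" using fb aff_refl_bij[OF ab] by (rule bij_comp[rotated])
  ultimately show ?thesis using fs hp affine_perms_iff[OF n] by simp
qed

lemma id_affine_perms: "id \<in> affine_perms 0 n"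
  by (simp add: affine_perms_def)

lemma aff_refl_comp_affine_perms:
  assumes n: "1 \<le> n" and ab: "a mod int n \<noteq> b mod int n" and f: "f \<in> affine_perms k n"
  shows "aff_refl n a b \<circ> f \<in> affine_perms k n"
proof -
  have fp: "periodic n f" and fb: "bij f" using f affine_perms_iff[OF n] by auto
  obtain a' b' where ab': "f a' = a" "f b' = b" using fb by (metis bij_pointE)
  then have "a' mod int n \<noteq> b' mod int n" using ab periodic_mod_iff[OF fp bij_is_inj[OF fb]] by auto
  then show ?thesis
    using affine_perms_comp_aff_refl[OF n _ f, of a' b'] comp_aff_refl[OF _ fp bij_is_inj[OF fb], of a' b'] ab'
    by simp
qed

lemma reflection_conj:
  assumes "g \<in> affine_perms k n" "a mod int n \<noteq> b mod int n"
  shows "g \<circ> aff_refl n a b \<circ> inv g = aff_refl n (g a) (g b)"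
proof -
  have b: "bij g" using assms affine_perms_bij by blast
  have "g \<circ> aff_refl n a b \<circ> inv g = aff_refl n (g a) (g b) \<circ> (g \<circ> inv g)"
    using comp_aff_refl[OF assms(2) affine_perms_periodic[OF assms(1)] bij_is_inj[OF b]]
    by (simp only: comp_assoc)
  also have "g \<circ> inv g = id" using b by (simp add: bij_is_surj surj_iff[symmetric])
  finally show ?thesis by (simp only: comp_id)
qed

text \<open>
  Conjugating by a simple reflection shortens the distance \<open>b - a\<close>, by one in general and by two if \<open>b - 1\<close> is congruent to \<open>a\<close>.
\<close>

lemma aff_refl_conjugate:
  assumes n: "2 \<le> n"
  shows "a < b \<Longrightarrow> a mod int n \<noteq> b mod int n \<Longrightarrow>
    \<exists>g i. g \<in> affine_perms 0 n \<and> g i = a \<and> g (i + 1) = b"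
proof (induction "nat (b - a)" arbitrary: a b rule: less_induct)
  case less
  have n1: "1 \<le> n" using n by simp
  show ?case
  proof (cases "b = a + 1")
    case True
    then show ?thesis using id_affine_perms by (intro exI[of _ id] exI[of _ a]) simp
  next
    case False
    show ?thesis
    proof (cases "(b - 1) mod int n = a mod int n")
      case False
      let ?s = "aff_refl n (b - 1) b"
      have s: "(b - 1) mod int n \<noteq> b mod int n" using mod_Suc_neq[OF n, of "b - 1"] by simp
      obtain g i where g: "g \<in> affine_perms 0 n" "g i = a" "g (i + 1) = b - 1"
        using less.hyps[of "b - 1" a] less.prems \<open>b \<noteq> a + 1\<close> False by fastforce
      have "?s a = a" using aff_refl_apply(3)[OF s] False less.prems by metis
      then show ?thesis
        using g aff_refl_apply'[OF s] aff_refl_comp_affine_perms[OF n1 s g(1)]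
        by (intro exI[of _ "?s \<circ> g"] exI[of _ i]) simp
    next
      case True
      let ?s = "aff_refl n a (a + 1)"
      have s: "a mod int n \<noteq> (a + 1) mod int n" using mod_Suc_neq[OF n] .
      obtain m where m: "b - 1 = a + m * int n" using True by (metis mod_eq_obtain)
      then have "0 < m * int n" using less.prems \<open>b \<noteq> a + 1\<close> by linarith
      then have "0 < m" by (simp add: zero_less_mult_iff)
      then have "1 * int n \<le> m * int n" by (intro mult_right_mono) auto
      \<comment> \<open>\<open>b - 1\<close> is at least \<open>a + n\<close>, hence at least
        \<open>a + 2\<close>, so both ends can move inwards without meeting.\<close>
      then have lt: "a + 1 < b - 1" using m n by linarith
      have b: "b = (a + 1) + m * int n" using m by simp
      have ne: "(a + 1) mod int n \<noteq> (b - 1) mod int n" using s True by simp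
      obtain g i where g: "g \<in> affine_perms 0 n" "g i = a + 1" "g (i + 1) = b - 1"
        using less.hyps[of "b - 1" "a + 1"] lt ne by fastforce
      have "?s (a + 1) = a" "?s (b - 1) = b"
        using aff_refl_apply'[OF s] aff_refl_apply(1)[OF s, of m] m by auto
      then show ?thesis
        using g aff_refl_comp_affine_perms[OF n1 s g(1)]
        by (intro exI[of _ "?s \<circ> g"] exI[of _ i]) simp
    qed
  qed
qed

lemma aff_refl_sym:
  assumes "a mod int n \<noteq> b mod int n"
  shows "aff_refl n a b = aff_refl n b a"
  using assms by (auto simp: aff_refl_def fun_eq_iff)

text \<open>Conjugation by \<open>g\<close> turns the exchange of \<open>i\<close> and
  \<open>i + 1\<close> into that of \<open>g i\<close> and \<open>g (i + 1)\<close>, and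
  \<open>aff_refl_conjugate\<close> reaches every incongruent pair. For \<open>n = 1\<close> both
  sides are empty.\<close>

lemma affine_reflections_eq:
  assumes "1 \<le> n"
  shows "affine_reflections n = {aff_refl n a b | a b. a < b \<and> a mod int n \<noteq> b mod int n}"
proof (intro equalityI subsetI)
  fix r assume "r \<in> affine_reflections n"
  then obtain g i where g: "g \<in> affine_perms 0 n" "2 \<le> n" "r = g \<circ> aff_refl n i (i + 1) \<circ> inv g"
    unfolding affine_reflections_def affine_generators_eq by blast
  then have r: "r = aff_refl n (g i) (g (i + 1))" using reflection_conj[OF g(1) mod_Suc_neq] by simp
  have ne: "g i mod int n \<noteq> g (i + 1) mod int n"
    using mod_Suc_neq[OF g(2)] periodic_mod_iff[OF affine_perms_periodic[OF g(1)] bij_is_inj[OF affine_perms_bij[OF g(1)]]]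
    by simp
  then have "g i < g (i + 1) \<or> g (i + 1) < g i" by (metis linorder_less_linear)
  then show "r \<in> {aff_refl n a b | a b. a < b \<and> a mod int n \<noteq> b mod int n}"
  proof
    assume "g i < g (i + 1)"
    then show ?thesis using r ne by blast
  next
    assume "g (i + 1) < g i"
    moreover have "r = aff_refl n (g (i + 1)) (g i)" using r aff_refl_sym[OF ne] by simp
    moreover have "g (i + 1) mod int n \<noteq> g i mod int n" using ne by simp
    ultimately show ?thesis by blast
  qed
next
  fix r assume "r \<in> {aff_refl n a b | a b. a < b \<and> a mod int n \<noteq> b mod int n}"
  then obtain a b where ab: "a < b" "a mod int n \<noteq> b mod int n" "r = aff_refl n a b" by blast
  have "n \<noteq> 1" using ab(2) by auto
  then have n: "2 \<le> n" using assms by simp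
  obtain g i where g: "g \<in> affine_perms 0 n" "g i = a" "g (i + 1) = b"
    using aff_refl_conjugate[OF n ab(1,2)] by blast
  then have "r = g \<circ> aff_refl n i (i + 1) \<circ> inv g"
    using reflection_conj[OF g(1) mod_Suc_neq[OF n]] ab(3) by simp
  then show "r \<in> affine_reflections n"
    unfolding affine_reflections_def affine_generators_eq using g(1) n by blast
qed

text \<open>A gap between \<open>f i\<close> and \<open>f (i + 1)\<close> would have to be filled by
  some \<open>f j\<close> with \<open>i < j < i + 1\<close>.\<close>

lemma increasing_bij_shift:
  fixes f :: "int \<Rightarrow> int"
  assumes b: "bij f" and inc: "\<And>i. f i < f (i + 1)"
  shows "f i = f 0 + i"
proof -
  have less: "f i < f j" if "i < j" for i j
    using that by (induction j rule: int_gr_induct) (use inc less_trans in blast)+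
  have step: "f (i + 1) = f i + 1" for i
  proof (rule ccontr)
    assume "f (i + 1) \<noteq> f i + 1"
    then have lt: "f i + 1 < f (i + 1)" using inc[of i] by linarith
    obtain j where j: "f j = f i + 1" using b by (metis bij_pointE)
    then have "i < j" using less[of j i] by (metis less_irrefl linorder_less_linear add_less_cancel_left less_add_one less_asym)
    moreover have "j < i + 1" using j lt less[of "i + 1" j] by (metis less_asym linorder_less_linear)
    ultimately show False by simp
  qed
  show ?thesis
  proof (induction i rule: int_induct[of _ 0])
    case (step2 i)
    then show ?case using step[of "i - 1"] by simp
  qed (use step in auto)
qed

section \<open>Words in simple reflections, strong exchange and Coxeter length\<close>

definition word_prod :: "(int \<Rightarrow> int) list \<Rightarrow> int \<Rightarrow> int" where
  "word_prod ss = foldr (\<circ>) ss id"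

lemma word_prod_Nil [simp]: "word_prod [] = id"
  by (simp only: word_prod_def foldr.simps id_apply)

lemma word_prod_Cons [simp]: "word_prod (s # ss) = s \<circ> word_prod ss"
  by (simp only: word_prod_def foldr.simps comp_apply)

lemma word_prod_append: "word_prod (ss @ [s]) = word_prod ss \<circ> s"
  by (induction ss) (simp_all add: comp_assoc)

text \<open>
  At a descent \<open>f (i + 1) < f i\<close> the sum of the squares \<open>(f i - i)\<^sup>2\<close> over a period drops
  by \<open>2 (f i - f (i + 1))\<close> under right multiplication by the simple reflection.
\<close>

lemma affine_perms_generated:
  assumes n: "1 \<le> n" and f: "f \<in> affine_perms 0 n"
  shows "\<exists>ss. set ss \<subseteq> affine_generators n \<and> f = word_prod ss"
  using f
proof (induction "nat (\<Sum>i = 1..int n. (f i - i)^2)" arbitrary: f rule: less_induct)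
  case less
  have fp: "periodic n f" and fb: "bij f" and fs: "(\<Sum>i = 1..int n. f i - i) = 0"
    using less.prems affine_perms_iff[OF n] by auto
  show ?case
  proof (cases "\<forall>i. f i < f (i + 1)")
    case True
    \<comment> \<open>Without descents \<open>f\<close> is a translation, and the vanishing sum of
      displacements leaves only the identity.\<close>
    then have sh: "f i - i = f 0" for i using increasing_bij_shift[OF fb, of i] by simp
    then have "(\<Sum>i = 1..int n. f i - i) = (\<Sum>i = 1..int n. f 0)" by (simp only: sh)
    then have "f 0 = 0" using fs n by simp
    then have "f i = id i" for i using sh[of i] by simp
    then have "f = id" ..
    then show ?thesis by (intro exI[of _ "[]"]) simp
  next
    case False
    then obtain i where "\<not> f i < f (i + 1)" by blast
    moreover have "f i \<noteq> f (i + 1)" using fb by (metis bij_is_inj inj_eq add_cancel_left_right zero_neq_one)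
    ultimately have i: "f (i + 1) < f i" by linarith
    have "n \<noteq> 1"
    proof
      assume "n = 1"
      then show False using fp i by (auto simp: periodic_def)
    qed
    then have n2: "2 \<le> n" using n by simp
    note ne = mod_Suc_neq[OF n2, of i]
    let ?s = "aff_refl n i (i + 1)"
    let ?h = "f \<circ> ?s"
    have h: "?h \<in> affine_perms 0 n" by (rule affine_perms_comp_aff_refl[OF n ne less.prems])
    have hp: "periodic n ?h" using h affine_perms_periodic by blast
    let ?g = "\<lambda>j. (?h j - j)^2 - (f j - j)^2"
    have "(\<Sum>j = 1..int n. ?g j) = ?g i + ?g (i + 1)"
      by (rule sum_two_residues[OF n ne])
        (use aff_refl_apply(3)[OF ne] periodic_mult[OF hp] periodic_mult[OF fp] in auto)
    also have "\<dots> = 2 * (f (i + 1) - f i)"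
      using aff_refl_apply'[OF ne] by (simp add: power2_eq_square algebra_simps)
    finally have "(\<Sum>j = 1..int n. (?h j - j)^2) < (\<Sum>j = 1..int n. (f j - j)^2)"
      using i by (simp add: sum_subtractf)
    moreover have "0 \<le> (\<Sum>j = 1..int n. (?h j - j)^2)" by (intro sum_nonneg) auto
    ultimately have "nat (\<Sum>j = 1..int n. (?h j - j)^2) < nat (\<Sum>j = 1..int n. (f j - j)^2)"
      by linarith
    from less.hyps[OF this h] obtain ss where ss: "set ss \<subseteq> affine_generators n" "?h = word_prod ss"
      by blast
    have "f = ?h \<circ> ?s" using aff_refl_involution[OF ne] by (simp add: comp_assoc)
    then have "f = word_prod (ss @ [?s])" using ss(2) by (simp add: word_prod_append)
    moreover have "?s \<in> affine_generators n" unfolding affine_generators_eq using n2 by blast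
    ultimately show ?thesis using ss(1) by (intro exI[of _ "ss @ [?s]"]) simp
  qed
qed

lemma word_periodic_bij:
  assumes "set ss \<subseteq> affine_generators n"
  shows "periodic n (word_prod ss) \<and> bij (word_prod ss)"
  using assms
proof (induction ss)
  case (Cons s ss)
  obtain i where s: "s = aff_refl n i (i + 1)" "2 \<le> n" using Cons.prems by (auto simp: affine_generators_eq)
  then have "periodic n s" "bij s" using aff_refl_periodic aff_refl_bij[OF mod_Suc_neq] by auto
  moreover have "periodic n (word_prod ss)" "bij (word_prod ss)" using Cons by auto
  ultimately show ?case using bij_comp[of "word_prod ss" s] by (simp add: periodic_def comp_def)
qed (simp add: periodic_def)

text \<open>Some letter \<open>s\<close> reverses the images of \<open>a\<close> and
  \<open>b\<close> that the suffix to its right still keeps in order. A simple reflection moves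
  integers by at most 1, so these images are adjacent and \<open>s\<close> exchanges them. Hence
  \<open>s\<close> times the suffix equals the suffix times the reflection in \<open>a\<close> and
  \<open>b\<close>, and that letter can be deleted.\<close>

lemma strong_exchange:
  assumes "set ss \<subseteq> affine_generators n" "a < b" "a mod int n \<noteq> b mod int n"
    and "word_prod ss b < word_prod ss a"
  shows "\<exists>ss'. set ss' \<subseteq> affine_generators n \<and> length ss = Suc (length ss') \<and>
    word_prod ss \<circ> aff_refl n a b = word_prod ss'"
  using assms
proof (induction ss)
  case (Cons s ss)
  let ?G = "word_prod ss"
  have G: "periodic n ?G" "inj ?G" using word_periodic_bij[of ss n] Cons.prems(1) by (auto simp: bij_is_inj)
  obtain i where s: "s = aff_refl n i (i + 1)" "2 \<le> n" using Cons.prems(1) by (auto simp: affine_generators_eq)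
  note ne = mod_Suc_neq[OF s(2), of i]
  show ?case
  proof (cases "?G b < ?G a")
    case True
    then obtain ss' where ss': "set ss' \<subseteq> affine_generators n" "length ss = Suc (length ss')"
       "?G \<circ> aff_refl n a b = word_prod ss'"
      using Cons.IH[OF _ Cons.prems(2,3) True] Cons.prems(1) by (meson set_subset_Cons subset_trans)
    have "word_prod (s # ss) \<circ> aff_refl n a b = word_prod (s # ss')"
      using ss'(3) by (simp only: word_prod_Cons comp_assoc)
    then show ?thesis using ss' Cons.prems(1) by (intro exI[of _ "s # ss'"]) (simp add: comp_def)
  next
    case False
    have "?G a \<noteq> ?G b" using G(2) Cons.prems(2) by (simp add: inj_eq)
    then have lt: "?G a < ?G b" using False by simp
    have gt: "s (?G b) < s (?G a)" using Cons.prems(4) by simp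
    obtain m where m: "?G a = i + m * int n" "?G b = (i + 1) + m * int n"
    proof (cases rule: aff_refl_cases[where i = "?G a" and a = i and b = "i + 1" and n = n])
      case (a m)
      have sa: "s (?G a) = ?G a + 1" using aff_refl_apply(1)[OF ne, of m] a s by simp
      have "?G b - 1 \<le> s (?G b)" by (simp add: s aff_refl_def)
      moreover have "s (?G b) = ?G b - 1 \<or> ?G b \<le> s (?G b)" by (simp add: s aff_refl_def)
      moreover have "s (?G b) = ?G b - 1 \<Longrightarrow> ?G b mod int n = (i + 1) mod int n"
        by (auto simp: s aff_refl_def split: if_splits)
      ultimately have "?G b = ?G a + 1" using lt gt sa by linarith
      then show ?thesis using a that[of m] by simp
    next
      case (b m)
      have sa: "s (?G a) = ?G a - 1" using aff_refl_apply(2)[OF ne, of m] b s by simp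
      have "?G b - 1 \<le> s (?G b)" by (simp add: s aff_refl_def)
      then show ?thesis using lt gt sa by linarith
    next
      case other
      have sa: "s (?G a) = ?G a" using aff_refl_apply(3)[OF ne other] s by simp
      have "?G b - 1 \<le> s (?G b)" by (simp add: s aff_refl_def)
      then show ?thesis using lt gt sa by linarith
    qed
    then have "s = aff_refl n (?G a) (?G b)" using s aff_refl_translate by simp
    then have "s \<circ> ?G = ?G \<circ> aff_refl n a b" using comp_aff_refl[OF Cons.prems(3) G] by simp
    then have "word_prod (s # ss) \<circ> aff_refl n a b = ?G"
      using aff_refl_involution[OF Cons.prems(3)] by (simp add: comp_assoc)
    then show ?thesis using Cons.prems(1) by (intro exI[of _ ss]) (simp add: comp_def)
  qed
qed simp

lemma coxeter_length_word:
  assumes "1 \<le> n" "f \<in> affine_perms 0 n"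
  obtains ss where "length ss = coxeter_length (affine_generators n) f"
    "set ss \<subseteq> affine_generators n" "f = word_prod ss"
proof -
  have "\<exists>m ss. length ss = m \<and> set ss \<subseteq> affine_generators n \<and> f = word_prod ss"
    using affine_perms_generated[OF assms] by blast
  from LeastI_ex[OF this] show ?thesis using that unfolding coxeter_length_def word_prod_def by blast
qed

lemma coxeter_length_le:
  "set ss \<subseteq> S \<Longrightarrow> coxeter_length S (word_prod ss) \<le> length ss"
  unfolding coxeter_length_def word_prod_def by (intro Least_le) blast

text \<open>Deleting a letter from a shortest word shows that the reflection shortens whatever
  reverses \<open>a\<close> and \<open>b\<close>. Exactly one of \<open>f\<close> and
  \<open>f \<circ> aff_refl n a b\<close> does so, which settles both directions.\<close>

lemma coxeter_length_less_iff:
  assumes n: "1 \<le> n" and f: "f \<in> affine_perms 0 n" and ab: "a < b" "a mod int n \<noteq> b mod int n"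
  shows "coxeter_length (affine_generators n) f < coxeter_length (affine_generators n) (f \<circ> aff_refl n a b)
    \<longleftrightarrow> f a < f b"
proof -
  let ?l = "coxeter_length (affine_generators n)"
  have dec: "?l (h \<circ> aff_refl n a b) < ?l h" if h: "h \<in> affine_perms 0 n" "h b < h a" for h
  proof -
    obtain ss where ss: "length ss = ?l h" "set ss \<subseteq> affine_generators n" "h = word_prod ss"
      using coxeter_length_word[OF n h(1)] by blast
    then obtain ss' where "set ss' \<subseteq> affine_generators n" "length ss = Suc (length ss')"
      "h \<circ> aff_refl n a b = word_prod ss'"
      using strong_exchange[OF ss(2) ab] h(2) by auto
    then show ?thesis using coxeter_length_le[of ss' "affine_generators n"] ss(1) by simp
  qed
  have "f a \<noteq> f b" using affine_perms_bij[OF f] ab(1) by (metis bij_is_inj inj_eq less_irrefl)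
  moreover have "?l f < ?l (f \<circ> aff_refl n a b)" if "f a < f b"
  proof -
    have "f \<circ> aff_refl n a b \<circ> aff_refl n a b = f" using aff_refl_involution[OF ab(2)] by (simp add: comp_assoc)
    then show ?thesis
      using dec[OF affine_perms_comp_aff_refl[OF n ab(2) f]] that aff_refl_apply'[OF ab(2)] by simp
  qed
  moreover have "\<not> ?l f < ?l (f \<circ> aff_refl n a b)" if "f b < f a"
    using dec[OF f that] by simp
  ultimately show ?thesis by linarith
qed

section \<open>Chains in the affine Bruhat order\<close>

definition aff_step :: "nat \<Rightarrow> (int \<Rightarrow> int) \<Rightarrow> (int \<Rightarrow> int) \<Rightarrow> bool" where
  "aff_step n f g \<longleftrightarrow>
     (\<exists>a b. a < b \<and> a mod int n \<noteq> b mod int n \<and> f a < f b \<and> g = f \<circ> aff_refl n a b)"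

lemma aff_step_affine_perms:
  "1 \<le> n \<Longrightarrow> f \<in> affine_perms k n \<Longrightarrow> aff_step n f g \<Longrightarrow> g \<in> affine_perms k n"
  by (auto simp: aff_step_def intro: affine_perms_comp_aff_refl)

lemma aff_steps_affine_perms:
  "(aff_step n)\<^sup>*\<^sup>* f g \<Longrightarrow> 1 \<le> n \<Longrightarrow> f \<in> affine_perms k n \<Longrightarrow> g \<in> affine_perms k n"
  by (induction rule: rtranclp_induct) (auto intro: aff_step_affine_perms)

lemma aff_step_length:
  assumes "1 \<le> n" "f \<in> affine_perms 0 n"
  shows "aff_step n f g \<longleftrightarrow> coxeter_length (affine_generators n) f < coxeter_length (affine_generators n) g
    \<and> (\<exists>t\<in>affine_reflections n. g = f \<circ> t)"
    (is "?L \<longleftrightarrow> ?R")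
proof
  assume ?L
  then obtain a b where ab: "a < b" "a mod int n \<noteq> b mod int n" "f a < f b" "g = f \<circ> aff_refl n a b"
    unfolding aff_step_def by blast
  then have "aff_refl n a b \<in> affine_reflections n" unfolding affine_reflections_eq[OF assms(1)] by blast
  then show ?R using coxeter_length_less_iff[OF assms ab(1,2)] ab(3,4) by blast
next
  assume ?R
  then obtain a b where ab: "a < b" "a mod int n \<noteq> b mod int n" "g = f \<circ> aff_refl n a b"
    unfolding affine_reflections_eq[OF assms(1)] by blast
  then have "f a < f b" using coxeter_length_less_iff[OF assms ab(1,2)] \<open>?R\<close> by simp
  then show ?L unfolding aff_step_def using ab by blast
qed

lemma affine_bruhat0_iff:
  assumes "1 \<le> n"
  shows "affine_bruhat0 n f g \<longleftrightarrow>
    f \<in> affine_perms 0 n \<and> g \<in> affine_perms 0 n \<and> (aff_step n)\<^sup>*\<^sup>* f g"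
proof -
  have "bruhat_le (coxeter_length (affine_generators n)) (affine_reflections n) f g = (aff_step n)\<^sup>*\<^sup>* f g"
    if "f \<in> affine_perms 0 n"
    unfolding bruhat_le_def
  proof (rule rtranclp_cong_on[where I = "\<lambda>f. f \<in> affine_perms 0 n", OF _ _ that])
    show "h \<in> affine_perms 0 n" if "f \<in> affine_perms 0 n" "aff_step n f h" for f h
      using aff_step_affine_perms[OF assms that] .
  qed (simp only: aff_step_length[OF assms])
  then show ?thesis unfolding affine_bruhat0_def by auto
qed

lemma periodic_sum_shift:
  fixes g :: "int \<Rightarrow> int"
  assumes "\<And>i. g (i + int n) = g i"
  shows "(\<Sum>i = 1..int n. g (i + c)) = (\<Sum>i = 1..int n. g i)"
proof -
  have step: "(\<Sum>i = 1..int n. g (i + (c + 1))) = (\<Sum>i = 1..int n. g (i + c))" for c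
  proof -
    have "(\<Sum>i = 1..int n. g (i + (c + 1))) = (\<Sum>i = 2..int n + 1. g (i + c))"
      by (rule sum.reindex_bij_witness[of _ "\<lambda>i. i - 1" "\<lambda>i. i + 1"]) (auto simp: algebra_simps)
    also have "\<dots> = (\<Sum>i = 1..int n. g (i + c))"
    proof (cases "n = 0")
      case False
      have "{2..int n + 1} = insert (int n + 1) {2..int n}" "{1..int n} = insert 1 {2..int n}"
        using False by auto
      then show ?thesis using assms[of "1 + c"] by (simp add: algebra_simps)
    qed simp
    finally show ?thesis .
  qed
  show ?thesis
  proof (induction c rule: int_induct[of _ 0])
    case (step2 c)
    then show ?case using step[of "c - 1"] by simp
  next
    case (step1 c)
    then show ?case using step[of c] by simp
  qed simp
qed

lemma affine_perms_shift:
  assumes n: "1 \<le> n"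
  shows "f \<circ> (\<lambda>i. i - int k) \<in> affine_perms 0 n \<longleftrightarrow> f \<in> affine_perms k n"
proof -
  let ?h = "f \<circ> (\<lambda>i. i - int k)"
  have b: "bij (\<lambda>i. i - int k)" by (rule bij_betw_byWitness[of _ "\<lambda>i. i + int k"]) auto
  have "f = ?h \<circ> (\<lambda>i. i + int k)" by (simp add: fun_eq_iff)
  moreover have "bij (\<lambda>i. i + int k)" by (rule bij_betw_byWitness[of _ "\<lambda>i. i - int k"]) auto
  ultimately have bij: "bij ?h \<longleftrightarrow> bij f" using b by (metis bij_comp)
  have per: "periodic n ?h \<longleftrightarrow> periodic n f"
  proof
    assume h: "periodic n ?h"
    have "f (i + int n) = f i + int n" for i
      using h[unfolded periodic_def, rule_format, of "i + int k"] by (simp add: algebra_simps)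
    then show "periodic n f" by (simp add: periodic_def)
  next
    assume f: "periodic n f"
    have "f (i + int n - int k) = f (i - int k) + int n" for i
      using f[unfolded periodic_def, rule_format, of "i - int k"] by (simp add: algebra_simps)
    then show "periodic n ?h" by (simp add: periodic_def)
  qed
  have "(\<Sum>i = 1..int n. ?h i - i) = (\<Sum>i = 1..int n. f i - i) - int k * int n" if "periodic n f"
  proof -
    have "(\<Sum>i = 1..int n. ?h i - i) = (\<Sum>i = 1..int n. (\<lambda>j. f j - j) (i + (- int k)) - int k)"
      by (rule sum.cong) auto
    also have "\<dots> = (\<Sum>i = 1..int n. (\<lambda>j. f j - j) (i + (- int k))) - int k * int n"
      by (simp add: sum_subtractf)
    also have "(\<Sum>i = 1..int n. (\<lambda>j. f j - j) (i + (- int k))) = (\<Sum>i = 1..int n. f i - i)"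
      by (rule periodic_sum_shift[of "\<lambda>j. f j - j"]) (use that in \<open>simp add: periodic_def\<close>)
    finally show ?thesis .
  qed
  then show ?thesis unfolding affine_perms_iff[OF n] bij per by auto
qed

text \<open>Precomposing with a translation turns the reflection in \<open>a\<close> and
  \<open>b\<close> into that in \<open>a + c\<close> and \<open>b + c\<close>, so chains can be
  compared before the transport to \<open>affine_perms 0 n\<close>. The converse is the case
  \<open>- c\<close>.\<close>

lemma aff_step_shift: "aff_step n (f \<circ> (\<lambda>i. i - c)) (g \<circ> (\<lambda>i. i - c)) \<longleftrightarrow> aff_step n f g"
proof -
  have fwd: "aff_step n (f \<circ> (\<lambda>i. i - c)) (g \<circ> (\<lambda>i. i - c))"
    if st: "aff_step n f g" for f g :: "int \<Rightarrow> int" and c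
  proof -
    obtain a b where ab: "a < b" "a mod int n \<noteq> b mod int n" "f a < f b" "g = f \<circ> aff_refl n a b"
      using st unfolding aff_step_def by blast
    have m: "x mod int n = (a + c) mod int n \<longleftrightarrow> (x - c) mod int n = a mod int n" for x a
      by (simp add: mod_eq_dvd_iff algebra_simps)
    have "(\<lambda>i. i - c) \<circ> aff_refl n (a + c) (b + c) = aff_refl n a b \<circ> (\<lambda>i. i - c)"
      by (auto simp: aff_refl_def m fun_eq_iff)
    then have "g \<circ> (\<lambda>i. i - c) = f \<circ> (\<lambda>i. i - c) \<circ> aff_refl n (a + c) (b + c)"
      unfolding ab(4) by (simp add: comp_assoc)
    moreover have "(a + c) mod int n \<noteq> (b + c) mod int n" using ab(2) m[of "a + c" b] by simp
    ultimately show ?thesis unfolding aff_step_def using ab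
      by (intro exI[of _ "a + c"] exI[of _ "b + c"]) simp
  qed
  have "h \<circ> (\<lambda>i. i - c) \<circ> (\<lambda>i. i - (- c)) = h" for h :: "int \<Rightarrow> int" by (simp add: fun_eq_iff)
  then show ?thesis using fwd[of f g c] fwd[of "f \<circ> (\<lambda>i. i - c)" "g \<circ> (\<lambda>i. i - c)" "- c"] by metis
qed

lemma aff_steps_shift:
  "(aff_step n)\<^sup>*\<^sup>* (f \<circ> (\<lambda>i. i - c)) (g \<circ> (\<lambda>i. i - c)) \<longleftrightarrow> (aff_step n)\<^sup>*\<^sup>* f g"
proof -
  have fwd: "(aff_step n)\<^sup>*\<^sup>* (f \<circ> (\<lambda>i. i - c)) (g \<circ> (\<lambda>i. i - c))" 
    if "(aff_step n)\<^sup>*\<^sup>* f g" for f g :: "int \<Rightarrow> int" and c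
    using that
  proof induction
    case (step y z)
    have "aff_step n (y \<circ> (\<lambda>i. i - c)) (z \<circ> (\<lambda>i. i - c))" using step.hyps(2) aff_step_shift by blast
    then show ?case using step.IH by (rule rtranclp.rtrancl_into_rtrancl[rotated])
  qed blast
  have "h \<circ> (\<lambda>i. i - c) \<circ> (\<lambda>i. i - (- c)) = h" for h :: "int \<Rightarrow> int" by (simp add: fun_eq_iff)
  then show ?thesis using fwd[of f g c] fwd[of "f \<circ> (\<lambda>i. i - c)" "g \<circ> (\<lambda>i. i - c)" "- c"] by metis
qed

lemma affine_bruhat_iff:
  assumes "1 \<le> n"
  shows "affine_bruhat k n f g \<longleftrightarrow>
    f \<in> affine_perms k n \<and> g \<in> affine_perms k n \<and> (aff_step n)\<^sup>*\<^sup>* f g"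
  unfolding affine_bruhat_def affine_bruhat0_iff[OF assms] affine_perms_shift[OF assms] aff_steps_shift
  by blast

lemma aff_steps_coxeter_length:
  assumes "(aff_step n)\<^sup>*\<^sup>* f g" "1 \<le> n" "f \<in> affine_perms 0 n"
  shows "f = g \<or> coxeter_length (affine_generators n) f < coxeter_length (affine_generators n) g"
  using assms
proof (induction rule: rtranclp_induct)
  case (step y z)
  have "y \<in> affine_perms 0 n" using aff_steps_affine_perms[OF step.hyps(1) step.prems] .
  then have "coxeter_length (affine_generators n) y < coxeter_length (affine_generators n) z"
    using step.hyps(2) aff_step_length[OF step.prems(1), of y z] by blast
  then show ?case using step.IH[OF step.prems] by auto
qed simp

lemma affine_bruhat_antisym:
  assumes n: "1 \<le> n" and "affine_bruhat k n f g" "affine_bruhat k n g f"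
  shows "f = g"
proof -
  let ?f = "f \<circ> (\<lambda>i. i - int k)" and ?g = "g \<circ> (\<lambda>i. i - int k)"
  have "affine_bruhat0 n ?f ?g" "affine_bruhat0 n ?g ?f"
    using assms by (auto simp: affine_bruhat_def)
  then have "?f = ?g"
    using aff_steps_coxeter_length[OF _ n, of ?f ?g] aff_steps_coxeter_length[OF _ n, of ?g ?f]
    unfolding affine_bruhat0_iff[OF n] by auto
  then have "?f \<circ> (\<lambda>i. i + int k) = ?g \<circ> (\<lambda>i. i + int k)" by (rule arg_cong)
  then show ?thesis by (simp add: comp_def)
qed

text \<open>The chain \<open>b \<le> g b = f a < f b = g a \<le> a + n\<close>, together with
  \<open>a < b\<close>, contains all four bounds on \<open>f a\<close> and
  \<open>f b\<close>.\<close>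

lemma Bound_aff_step:
  assumes "aff_step n f g" "g \<in> Bound k n" "f \<in> affine_perms k n"
  shows "f \<in> Bound k n"
proof -
  obtain a b where ab: "a < b" "a mod int n \<noteq> b mod int n" "f a < f b" "g = f \<circ> aff_refl n a b"
    using assms by (auto simp: aff_step_def)
  have g: "i \<le> g i" "g i \<le> i + int n" for i using assms by (auto simp: Bound_def)
  have gab: "g a = f b" "g b = f a" unfolding ab(4) using aff_refl_apply'[OF ab(2)] by auto
  have fp: "periodic n f" using assms affine_perms_periodic by blast
  have "i \<le> f i \<and> f i \<le> i + int n" for i
  proof (cases rule: aff_refl_cases[where i = i and a = a and b = b and n = n])
    case (a m)
    then show ?thesis
      using periodic_mult[OF fp, of a m] g[of a] g[of b] gab ab by auto
  next
    case (b m)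
    then show ?thesis
      using periodic_mult[OF fp, of b m] g[of a] g[of b] gab ab by auto
  next
    case other
    then show ?thesis using g[of i] aff_refl_apply(3)[OF ab(2)] ab(4) by simp
  qed
  then show ?thesis using assms by (simp add: Bound_def)
qed

section \<open>The affine permutation of a pair\<close>

text \<open>The displacement of \<open>t_omega k n\<close> at a position of the window from 1 to
  \<open>n\<close>.\<close>

definition block_shift :: "nat \<Rightarrow> nat \<Rightarrow> int \<Rightarrow> int" where
  "block_shift k n p = (if p \<le> int k then int n else 0)"

lemma periodic_obtain:
  assumes "1 \<le> n" "w \<in> Sym n"
  obtains p m where "p \<in> {1..int n}" "i = w p + m * int n"
proof -
  have "residue_rep n i \<in> w ` {1..int n}" using residue_rep(1)[OF assms(1)] Sym_image[OF assms(2)] by simp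
  then obtain p where "residue_rep n i = w p" "p \<in> {1..int n}" by (rule imageE)
  moreover from this have "i = w p + (i - 1) div int n * int n" using residue_rep(3)[OF assms(1), of i] by simp
  ultimately show ?thesis using that by blast
qed

lemma periodic_eqI:
  assumes "1 \<le> n" "w \<in> Sym n" "periodic n f" "periodic n g"
    and "\<And>p. p \<in> {1..int n} \<Longrightarrow> f (w p) = g (w p)"
  shows "f = g"
proof
  fix i
  obtain p m where "p \<in> {1..int n}" "i = w p + m * int n" using periodic_obtain[OF assms(1,2)] .
  then show "f i = g i" using assms(5) periodic_mult[OF assms(3)] periodic_mult[OF assms(4)] by simp
qed

text \<open>Injectivity modulo \<open>n\<close> on one window yields a permutation of the residues
  by finiteness. The window is indexed by \<open>w p\<close> because that is where
  \<open>f_perm\<close> has a closed form.\<close>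

lemma periodic_bijI:
  assumes n: "1 \<le> n" and w: "w \<in> Sym n" and f: "periodic n f"
    and inj: "\<And>p q. p \<in> {1..int n} \<Longrightarrow> q \<in> {1..int n} \<Longrightarrow> f (w p) mod int n = f (w q) mod int n \<Longrightarrow> p = q"
  shows "bij f"
proof (rule bijI)
  show "inj f"
  proof (rule injI)
    fix i j assume eq: "f i = f j"
    obtain p m where p: "p \<in> {1..int n}" "i = w p + m * int n" using periodic_obtain[OF n w] .
    obtain q l where q: "q \<in> {1..int n}" "j = w q + l * int n" using periodic_obtain[OF n w] .
    have e: "f (w p) + m * int n = f (w q) + l * int n" using eq p q periodic_mult[OF f] by simp
    then have "f (w p) mod int n = f (w q) mod int n" by (metis mod_mult_self3 add.commute)
    then have "p = q" using inj p q by blast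
    then show "i = j" using e p q by simp
  qed
  let ?g = "\<lambda>p. residue_rep n (f (w p))"
  have "inj_on ?g {1..int n}"
  proof (rule inj_onI)
    fix p q assume "p \<in> {1..int n}" "q \<in> {1..int n}" "?g p = ?g q"
    then show "p = q" using inj residue_rep(2)[OF n] by metis
  qed
  moreover have "?g ` {1..int n} \<subseteq> {1..int n}" using residue_rep(1)[OF n] by blast
  ultimately have img: "?g ` {1..int n} = {1..int n}" by (intro endo_inj_surj) auto
  show "surj f"
    unfolding surj_def
  proof
    fix y
    have "residue_rep n y \<in> ?g ` {1..int n}" unfolding img by (rule residue_rep(1)[OF n])
    then obtain p where "residue_rep n y = residue_rep n (f (w p))" by (rule imageE)
    then have "f (w p) mod int n = y mod int n" using residue_rep(2)[OF n] by metis
    then obtain m where "y = f (w p) + m * int n" by (rule mod_eq_obtain)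
    then show "\<exists>x. y = f x" using periodic_mult[OF f, of "w p" m] by metis
  qed
qed

lemma periodic_ext_periodic: "1 \<le> n \<Longrightarrow> periodic n (periodic_ext n g)"
proof -
  assume n: "1 \<le> n"
  have "periodic_ext n g (i + int n) = periodic_ext n g i + int n" for i
  proof -
    have e: "i + int n - 1 = (i - 1) + int n" by simp
    have "(i + int n - 1) mod int n = (i - 1) mod int n" unfolding e by (rule mod_add_self2)
    moreover have "(i + int n - 1) div int n = (i - 1) div int n + 1"
      unfolding e using n by (intro div_add_self2) simp
    ultimately show ?thesis by (simp add: periodic_ext_def algebra_simps)
  qed
  then show ?thesis by (simp add: periodic_def)
qed

lemma periodic_ext_apply: "i \<in> {1..int n} \<Longrightarrow> periodic_ext n g i = g i"
  by (simp add: periodic_ext_def)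

lemma periodic_comp: "periodic n f \<Longrightarrow> periodic n g \<Longrightarrow> periodic n (f \<circ> g)"
  by (simp add: periodic_def)

lemma f_perm_periodic: "1 \<le> n \<Longrightarrow> periodic n (f_perm k n u w)"
  unfolding f_perm_def t_omega_def by (intro periodic_comp periodic_ext_periodic)

lemma f_perm_apply:
  assumes n: "1 \<le> n" and w: "w \<in> Sym n" and p: "p \<in> {1..int n}"
  shows "f_perm k n u w (w p) = u p + block_shift k n p"
proof -
  have "w p \<in> {1..int n}" using Sym_range[OF w] p by blast
  then have 1: "periodic_ext n (inv w) (w p) = p"
    using w by (simp add: periodic_ext_apply Sym_def permutes_inj)
  have 2: "t_omega k n p = p + block_shift k n p"
    using p by (simp add: t_omega_def periodic_ext_apply block_shift_def)
  have 3: "periodic_ext n u (p + block_shift k n p) = u p + block_shift k n p"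
    using periodic_ext_periodic[OF n, of u] p
    by (simp add: block_shift_def periodic_def periodic_ext_apply)
  show ?thesis unfolding f_perm_def using 1 2 3 by simp
qed

lemma f_perm_eqI:
  assumes "1 \<le> n" "w \<in> Sym n" "periodic n f"
    and "\<And>p. p \<in> {1..int n} \<Longrightarrow> f (w p) = u p + block_shift k n p"
  shows "f_perm k n u w = f"
  by (rule periodic_eqI[OF assms(1,2) f_perm_periodic[OF assms(1)] assms(3)])
    (simp add: assms(4) f_perm_apply[OF assms(1,2)])

lemma Sym_mod_inj:
  assumes "u \<in> Sym n" "p \<in> {1..int n}" "q \<in> {1..int n}" "u p mod int n = u q mod int n"
  shows "p = q"
  using residue_unique[of "u p" n "u q"] assms Sym_range[OF assms(1)] Sym_inj[OF assms(1)] by blast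

lemma sum_Sym:
  fixes g :: "int \<Rightarrow> int"
  assumes "w \<in> Sym n"
  shows "(\<Sum>i\<in>{1..int n}. g i) = (\<Sum>p\<in>{1..int n}. g (w p))"
  using sum.permute[of w "{1..int n}" g] assms by (simp add: Sym_def comp_def)

lemma block_shift_mod: "(x + block_shift k n p) mod int n = x mod int n"
  by (simp add: block_shift_def)

lemma sum_block_shift: "k \<le> n \<Longrightarrow> (\<Sum>p\<in>{1..int n}. block_shift k n p) = int k * int n"
proof -
  assume kn: "k \<le> n"
  have "(\<Sum>p\<in>{1..int n}. block_shift k n p) = (\<Sum>p\<in>{1..int k}. int n)"
    by (rule sum.mono_neutral_cong_right) (use kn in \<open>auto simp: block_shift_def\<close>)
  then show ?thesis by simp
qed

lemma f_perm_affine_perms: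
  assumes n: "1 \<le> n" and kn: "k \<le> n" and u: "u \<in> Sym n" and w: "w \<in> Sym n"
  shows "f_perm k n u w \<in> affine_perms k n"
proof -
  let ?f = "f_perm k n u w"
  note a = f_perm_apply[OF n w]
  have per: "periodic n ?f" by (rule f_perm_periodic[OF n])
  have "bij ?f"
  proof (rule periodic_bijI[OF n w per])
    fix p q assume pq: "p \<in> {1..int n}" "q \<in> {1..int n}" "?f (w p) mod int n = ?f (w q) mod int n"
    then show "p = q" using Sym_mod_inj[OF u] unfolding a[OF pq(1)] a[OF pq(2)] block_shift_mod by blast
  qed
  moreover have "(\<Sum>i = 1..int n. ?f i - i) = int k * int n"
  proof -
    have "(\<Sum>i = 1..int n. ?f i - i) = (\<Sum>p = 1..int n. ?f (w p) - w p)" by (rule sum_Sym[OF w])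
    also have "\<dots> = (\<Sum>p = 1..int n. (u p - w p) + block_shift k n p)"
      by (rule sum.cong) (simp_all add: a)
    also have "\<dots> = (\<Sum>p = 1..int n. u p) - (\<Sum>p = 1..int n. w p) + int k * int n"
      by (simp add: sum.distrib sum_subtractf sum_block_shift[OF kn])
    also have "(\<Sum>p = 1..int n. u p) = (\<Sum>p = 1..int n. w p)"
      using sum_Sym[OF u, of "\<lambda>i. i"] sum_Sym[OF w, of "\<lambda>i. i"] by simp
    finally show ?thesis by simp
  qed
  ultimately show ?thesis using per affine_perms_iff[OF n] by blast
qed

text \<open>One of the two bounds at \<open>w p\<close> is automatic, since \<open>u p\<close> and
  \<open>w p\<close> lie between 1 and \<open>n\<close>: the lower one in the first block, the upper
  one in the second.\<close>

lemma f_perm_Bound_iff: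
  assumes n: "1 \<le> n" and kn: "k \<le> n" and u: "u \<in> Sym n" and w: "w \<in> Sym n"
  shows "f_perm k n u w \<in> Bound k n \<longleftrightarrow>
    (\<forall>a. 1 \<le> a \<and> a \<le> int k \<longrightarrow> u a \<le> w a) \<and> (\<forall>b. int k < b \<and> b \<le> int n \<longrightarrow> w b \<le> u b)"
    (is "_ \<longleftrightarrow> ?R")
proof
  let ?f = "f_perm k n u w"
  note a = f_perm_apply[OF n w]
  assume B: "?f \<in> Bound k n"
  have b: "w p \<le> u p + block_shift k n p" "u p + block_shift k n p \<le> w p + int n" if "p \<in> {1..int n}" for p
    using B a[OF that, of k u] unfolding Bound_def by (metis (mono_tags, lifting) mem_Collect_eq)+
  show ?R
  proof (intro conjI allI impI)
    fix p assume "1 \<le> p \<and> p \<le> int k"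
    then show "u p \<le> w p" using b(2)[of p] kn by (simp add: block_shift_def)
  next
    fix p assume "int k < p \<and> p \<le> int n"
    then show "w p \<le> u p" using b(1)[of p] by (simp add: block_shift_def)
  qed
next
  let ?f = "f_perm k n u w"
  note a = f_perm_apply[OF n w]
  assume R: ?R
  have "i \<le> ?f i \<and> ?f i \<le> i + int n" for i
  proof -
    obtain p m where p: "p \<in> {1..int n}" "i = w p + m * int n" using periodic_obtain[OF n w] .
    have "w p \<in> {1..int n}" "u p \<in> {1..int n}" using p Sym_range[OF w] Sym_range[OF u] by blast+
    then have "w p \<le> u p + block_shift k n p" "u p + block_shift k n p \<le> w p + int n"
      using R p by (auto simp: block_shift_def)
    then show ?thesis using p a[OF p(1)] periodic_mult[OF f_perm_periodic[OF n]] by simp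
  qed
  then show "?f \<in> Bound k n" using f_perm_affine_perms[OF assms] by (simp add: Bound_def)
qed

text \<open>The part of \<open>bs_pair\<close> that \<open>f_perm\<close> does not see: boundedness
  is a property of the affine permutation alone, while this condition depends on the chosen
  representative.\<close>

definition block_compat :: "nat \<Rightarrow> nat \<Rightarrow> (int \<Rightarrow> int) \<Rightarrow> (int \<Rightarrow> int) \<Rightarrow> bool" where
  "block_compat k n u w \<longleftrightarrow> (\<forall>a b. same_block k n a b \<and> u a < u b \<longrightarrow> w a < w b)"

lemma bs_pair_iff_Bound:
  assumes "1 \<le> n" "k \<le> n"
  shows "bs_pair k n u w \<longleftrightarrow>
    u \<in> Sym n \<and> w \<in> Sym n \<and> f_perm k n u w \<in> Bound k n \<and> block_compat k n u w"
  unfolding bs_pair_def block_compat_def using f_perm_Bound_iff[OF assms] by blast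

text \<open>The length formula is obtained by counting representatives \<open>(i, j)\<close> of the inversions with
  \<open>1 \<le> i \<le> n\<close>; boundedness leaves only \<open>j \<le> 2n\<close>.\<close>

lemma affine_length_window:
  assumes n: "1 \<le> n" and f: "f \<in> Bound k n"
  shows "int (affine_length n f) =
    (\<Sum>i\<in>{1..int n}. \<Sum>j\<in>{1..int n}. of_bool (i < j \<and> f j < f i) + of_bool (f j + int n < f i))"
proof -
  let ?I = "{1..int n}"
  let ?D = "{(i, j). i < j \<and> f i > f j}"
  let ?T = "{((i, j), (i', j')). \<exists>m. i' = i + m * int n \<and> j' = j + m * int n}"
  let ?Low = "{x \<in> ?I \<times> ?I. fst x < snd x \<and> f (snd x) < f (fst x)}"
  let ?High = "{x \<in> ?I \<times> ?I. f (snd x) + int n < f (fst x)}"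
  let ?s = "\<lambda>x. (fst x, snd x + int n)"
  let ?E = "?Low \<union> ?s ` ?High"
  let ?c = "\<lambda>x. ?T `` {x}"
  have fp: "periodic n f" using f affine_perms_periodic by (auto simp: Bound_def)
  have fb: "i \<le> f i" "f i \<le> i + int n" for i using f by (auto simp: Bound_def)
  have f1: "f (i + int n) = f i + int n" for i using fp by (simp add: periodic_def)
  have ED: "?E \<subseteq> ?D" using f1 by auto
  have E1: "fst x \<in> ?I" if "x \<in> ?E" for x using that by auto
  have c: "y \<in> ?c x \<longleftrightarrow> (\<exists>m. fst y = fst x + m * int n \<and> snd y = snd x + m * int n)" for x y
    by (cases x, cases y) auto
  have trans: "?c x = ?c y" if "fst y = fst x + m * int n" "snd y = snd x + m * int n" for x y m
  proof (intro set_eqI iffI)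
    fix z assume "z \<in> ?c x"
    then obtain l where "fst z = fst x + l * int n" "snd z = snd x + l * int n" unfolding c by blast
    then show "z \<in> ?c y" unfolding c using that by (intro exI[of _ "l - m"]) (simp add: algebra_simps)
  next
    fix z assume "z \<in> ?c y"
    then obtain l where "fst z = fst y + l * int n" "snd z = snd y + l * int n" unfolding c by blast
    then show "z \<in> ?c x" unfolding c using that by (intro exI[of _ "l + m"]) (simp add: algebra_simps)
  qed
  have inj: "inj_on ?c ?E"
  proof (rule inj_onI)
    fix x y assume x: "x \<in> ?E" and y: "y \<in> ?E" and eq: "?c x = ?c y"
    have "y \<in> ?c y" unfolding c by (intro exI[of _ 0]) simp
    then have "y \<in> ?c x" using eq by simp
    then obtain m where m: "fst y = fst x + m * int n" "snd y = snd x + m * int n" unfolding c by blast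
    then have "fst x = fst y" using residue_unique[OF E1[OF x] E1[OF y]] by simp
    then show "x = y" using m by (simp add: prod_eq_iff)
  qed
  have "?c ` ?E = ?D // ?T"
  proof (intro equalityI subsetI)
    fix X assume "X \<in> ?c ` ?E"
    then show "X \<in> ?D // ?T" using ED unfolding quotient_def by blast
  next
    fix X assume "X \<in> ?D // ?T"
    then obtain x where x: "x \<in> ?D" "X = ?c x" unfolding quotient_def by blast
    let ?m = "(fst x - 1) div int n"
    let ?y = "(residue_rep n (fst x), snd x - ?m * int n)"
    have Xy: "X = ?c ?y" unfolding x(2)
      by (rule trans[of _ _ "- ?m"]) (use residue_rep(3)[OF n, of "fst x"] in auto)
    define i where "i = fst ?y"
    define j where "j = snd ?y"
    have ij: "i = fst x + (- ?m) * int n" "j = snd x + (- ?m) * int n"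
      using residue_rep(3)[OF n, of "fst x"] by (auto simp: i_def j_def)
    have i: "i \<in> ?I" using residue_rep(1)[OF n] by (simp add: i_def)
    have lt: "i < j" "f j < f i"
      using x(1) unfolding ij periodic_mult[OF fp] by (auto simp: case_prod_beta)
    \<comment> \<open>Boundedness gives \<open>j \<le> f j < f i \<le> i + n\<close>.\<close>
    have "j \<le> 2 * int n" using lt fb[of i] fb[of j] i by auto
    have "(i, j) \<in> ?E"
    proof (cases "j \<le> int n")
      case True
      then show ?thesis using i lt by auto
    next
      case False
      then have "(i, j - int n) \<in> ?High" using i lt f1[of "j - int n"] \<open>j \<le> 2 * int n\<close> by auto
      then have "?s (i, j - int n) \<in> ?s ` ?High" by (rule imageI)
      then show ?thesis by simp
    qed
    moreover have "X = ?c (i, j)" using Xy by (simp only: i_def j_def prod.collapse)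
    ultimately show "X \<in> ?c ` ?E" by (rule image_eqI[rotated])
  qed
  then have "affine_length n f = card ?E"
    unfolding affine_length_def using card_image[OF inj] by simp
  also have "\<dots> = card ?Low + card (?s ` ?High)"
  proof (rule card_Un_disjoint)
    show "finite ?Low" "finite (?s ` ?High)"
      by (auto intro!: finite_imageI intro: finite_subset[of _ "?I \<times> ?I"])
  qed auto
  also have "card (?s ` ?High) = card ?High" by (intro card_image inj_onI) (auto simp: prod_eq_iff)
  finally have len: "affine_length n f = card ?Low + card ?High" .
  have count: "int (card {x \<in> ?I \<times> ?I. P (fst x) (snd x)}) = (\<Sum>i\<in>?I. \<Sum>j\<in>?I. of_bool (P i j))"
    for P :: "int \<Rightarrow> int \<Rightarrow> bool"
  proof -
    have "int (card {x \<in> ?I \<times> ?I. P (fst x) (snd x)}) = (\<Sum>x\<in>?I \<times> ?I. of_bool (P (fst x) (snd x)))"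
      by (subst sum_of_bool_eq) (auto simp: Int_def)
    also have "\<dots> = (\<Sum>(i, j)\<in>?I \<times> ?I. of_bool (P i j))" by (rule sum.cong) auto
    finally show ?thesis by (simp only: sum.cartesian_product)
  qed
  show ?thesis unfolding len of_nat_add count[of "\<lambda>i j. i < j \<and> f j < f i"] count[of "\<lambda>i j. f j + int n < f i"]
    by (simp only: sum.distrib)
qed

text \<open>After the inversions of \<open>f\<close> are reindexed by \<open>w\<close>, either of
  two positions may come first. Adding both orders of each pair prepares the comparison with the
  inversions of \<open>u\<close> and \<open>w\<close>, which are counted over
  \<open>p < q\<close>.\<close>

lemma double_sum_symmetrize:
  fixes h :: "int \<Rightarrow> int \<Rightarrow> int"
  assumes "finite I" "\<And>i. i \<in> I \<Longrightarrow> h i i = 0"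
  shows "(\<Sum>i\<in>I. \<Sum>j\<in>I. h i j) = (\<Sum>i\<in>I. \<Sum>j\<in>I. of_bool (i < j) * (h i j + h j i))"
proof -
  have "(\<Sum>i\<in>I. \<Sum>j\<in>I. h i j) = (\<Sum>i\<in>I. \<Sum>j\<in>I. of_bool (i < j) * h i j + of_bool (j < i) * h i j)"
    using assms(2) by (intro sum.cong refl) (auto simp: of_bool_def)
  also have "\<dots> = (\<Sum>i\<in>I. \<Sum>j\<in>I. of_bool (i < j) * h i j) + (\<Sum>i\<in>I. \<Sum>j\<in>I. of_bool (j < i) * h i j)"
    by (simp only: sum.distrib)
  also have "(\<Sum>i\<in>I. \<Sum>j\<in>I. of_bool (j < i) * h i j) = (\<Sum>i\<in>I. \<Sum>j\<in>I. of_bool (i < j) * h j i)"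
    by (rule sum.swap)
  finally show ?thesis by (simp only: sum.distrib distrib_left)
qed

lemma sum_crossing_pairs:
  assumes "k \<le> n"
  shows "(\<Sum>p\<in>{1..int n}. \<Sum>q\<in>{1..int n}. of_bool (p \<le> int k \<and> int k < q)) = int k * (int n - int k)"
proof -
  have "(\<Sum>p\<in>{1..int n}. \<Sum>q\<in>{1..int n}. of_bool (p \<le> int k \<and> int k < q)) =
     (\<Sum>p\<in>{1..int n}. of_bool (p \<le> int k) * (\<Sum>q\<in>{1..int n}. of_bool (int k < q) :: int))"
    by (simp only: of_bool_conj sum_distrib_left)
  also have "\<dots> = (\<Sum>p\<in>{1..int n}. of_bool (p \<le> int k)) * (\<Sum>q\<in>{1..int n}. of_bool (int k < q) :: int)"
    by (simp only: sum_distrib_right)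
  also have "(\<Sum>p\<in>{1..int n}. of_bool (p \<le> int k)) = int (card {1..int k})"
  proof -
    have "{1..int n} \<inter> {p. p \<le> int k} = {1..int k}" using assms by auto
    then show ?thesis by (simp only: sum_of_bool_eq finite_atLeastAtMost_int)
  qed
  also have "(\<Sum>q\<in>{1..int n}. of_bool (int k < q) :: int) = int (card {int k + 1..int n})"
  proof -
    have "{1..int n} \<inter> {q. int k < q} = {int k + 1..int n}" by auto
    then show ?thesis by (simp only: sum_of_bool_eq finite_atLeastAtMost_int)
  qed
  finally show ?thesis using assms by simp
qed

text \<open>The formula holds pair by pair: positions \<open>p < q\<close> contribute the inversion
  of \<open>u\<close> minus that of \<open>w\<close>, plus 1 if they lie in different blocks. The
  crossing pairs add up to \<open>k * (n - k)\<close>.\<close>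

theorem affine_length_f_perm:
  assumes n: "1 \<le> n" and kn: "k \<le> n" and bs: "bs_pair k n u w"
  shows "int (affine_length n (f_perm k n u w)) =
    int k * (int n - int k) - int (perm_length n w) + int (perm_length n u)"
proof -
  let ?f = "f_perm k n u w" and ?I = "{1..int n}" and ?d = "block_shift k n"
  have u: "u \<in> Sym n" and w: "w \<in> Sym n" and B: "?f \<in> Bound k n" and bc: "block_compat k n u w"
    using bs bs_pair_iff_Bound[OF n kn] by auto
  note a = f_perm_apply[OF n w]
  let ?h = "\<lambda>p q. of_bool (w p < w q \<and> u q + ?d q < u p + ?d p) + of_bool (u q + ?d q + int n < u p + ?d p) :: int"
  have "int (affine_length n ?f) =
      (\<Sum>p\<in>?I. \<Sum>q\<in>?I. of_bool (w p < w q \<and> ?f (w q) < ?f (w p)) + of_bool (?f (w q) + int n < ?f (w p)))"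
    unfolding affine_length_window[OF n B]
    by (subst sum_Sym[OF w], rule sum.cong[OF refl], rule sum_Sym[OF w])
  also have "\<dots> = (\<Sum>p\<in>?I. \<Sum>q\<in>?I. ?h p q)"
    by (intro sum.cong refl) (simp only: a)
  also have "\<dots> = (\<Sum>p\<in>?I. \<Sum>q\<in>?I. of_bool (p < q) * (?h p q + ?h q p))"
    by (rule double_sum_symmetrize) auto
  also have "\<dots> = (\<Sum>p\<in>?I. \<Sum>q\<in>?I. of_bool (p \<le> int k \<and> int k < q)
      + of_bool (p < q \<and> u q < u p) - of_bool (p < q \<and> w q < w p))"
  proof (intro sum.cong refl)
    fix p q assume p: "p \<in> ?I" and q: "q \<in> ?I"
    have r: "u p \<in> ?I" "u q \<in> ?I" using p q Sym_range[OF u] by blast+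
    show "of_bool (p < q) * (?h p q + ?h q p) = of_bool (p \<le> int k \<and> int k < q)
      + of_bool (p < q \<and> u q < u p) - of_bool (p < q \<and> w q < w p)"
    proof (cases "p < q")
      case True
      have ne: "w p \<noteq> w q" "u p \<noteq> u q" using True Sym_inj[OF u] Sym_inj[OF w] by simp_all
      show ?thesis
      proof (cases "p \<le> int k \<and> int k < q")
        case cross: True
        then have d: "?d p = int n" "?d q = 0" by (auto simp: block_shift_def)
        \<comment> \<open>The translation by \<open>n\<close> puts \<open>u p + n\<close> above
          \<open>u q\<close>, so only the order of \<open>w p\<close> and \<open>w q\<close> counts
          in the first summand; its complement produces the 1.\<close>
        have "?h p q = of_bool (w p < w q) + of_bool (u q < u p)" "?h q p = 0"
          using r unfolding d by auto
        then show ?thesis using True cross ne by (auto simp: of_bool_def)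
      next
        case False
        then have d: "?d p = ?d q" and sb: "same_block k n p q"
          using True p q by (auto simp: block_shift_def same_block_def)
        have h: "?h p q = of_bool (w p < w q \<and> u q < u p)" "?h q p = of_bool (w q < w p \<and> u p < u q)"
          using r unfolding d by auto
        \<comment> \<open>Within a block every inversion of \<open>w\<close> is one of
          \<open>u\<close>, so the second term vanishes and the first becomes a difference of
          indicators.\<close>
        have "u p < u q \<Longrightarrow> w p < w q" using bc sb by (auto simp: block_compat_def)
        then show ?thesis unfolding h using False True ne by (auto simp: of_bool_def)
      qed
    next
      case False
      then show ?thesis by auto
    qed
  qed
  also have "\<dots> = (\<Sum>p\<in>?I. \<Sum>q\<in>?I. of_bool (p \<le> int k \<and> int k < q))
      + int (perm_length n u) - int (perm_length n w)"
    by (simp only: sum.distrib sum_subtractf perm_length_sum)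
  finally show ?thesis unfolding sum_crossing_pairs[OF kn] by simp
qed

section \<open>Comparison of the orders\<close>

definition block_inc :: "nat \<Rightarrow> nat \<Rightarrow> (int \<Rightarrow> int) \<Rightarrow> bool" where
  "block_inc k n w \<longleftrightarrow> (\<forall>a b. same_block k n a b \<longrightarrow> w a < w b)"

text \<open>\<open>block_inc\<close> and \<open>block_dec\<close> single out the shortest and the
  longest elements of the cosets under right multiplication by
  \<open>young_subgroup k n\<close>.\<close>

definition block_dec :: "nat \<Rightarrow> nat \<Rightarrow> (int \<Rightarrow> int) \<Rightarrow> bool" where
  "block_dec k n w \<longleftrightarrow> (\<forall>a b. same_block k n a b \<longrightarrow> w b < w a)"

definition block_simple :: "nat \<Rightarrow> nat \<Rightarrow> int \<Rightarrow> bool" where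
  "block_simple k n p \<longleftrightarrow> 1 \<le> p \<and> p < int n \<and> p \<noteq> int k"

lemma block_simple_same_block: "block_simple k n p \<Longrightarrow> same_block k n p (p + 1)"
  by (auto simp: block_simple_def same_block_def)

text \<open>Reduces transitive relations to adjacent positions, so that a failure of monotonicity in
  a block always shows at some simple transposition.\<close>

lemma block_adjacent_induct:
  assumes adj: "\<And>p. block_simple k n p \<Longrightarrow> R p (p + 1)"
    and trans: "\<And>p q r. R p q \<Longrightarrow> R q r \<Longrightarrow> R p r"
    and sb: "same_block k n a b"
  shows "R a b"
proof -
  have "a < b" using sb by (simp add: same_block_def)
  then show ?thesis using sb
  proof (induction b rule: int_gr_induct)
    case base
    then show ?case using adj[of a] by (auto simp: same_block_def block_simple_def)
  next
    case (step b)
    then have "same_block k n a b" "block_simple k n b" by (auto simp: same_block_def block_simple_def)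
    then show ?case using step.IH adj trans by blast
  qed
qed

lemma not_block_inc_descent:
  assumes "w \<in> Sym n" "\<not> block_inc k n w"
  obtains p where "block_simple k n p" "w (p + 1) < w p"
proof (rule ccontr)
  assume "\<not> thesis"
  then have "\<forall>p. block_simple k n p \<longrightarrow> \<not> w (p + 1) < w p" using that by blast
  then have no: "\<not> w (p + 1) < w p" if "block_simple k n p" for p using that by blast
  have "w p < w (p + 1)" if "block_simple k n p" for p
    using no[OF that] Sym_inj[OF assms(1), of p "p + 1"] by linarith
  then have "w a < w b" if "same_block k n a b" for a b
    by (rule block_adjacent_induct[where R = "\<lambda>a b. w a < w b", OF _ _ that]) auto
  then show False using assms(2) by (simp add: block_inc_def)
qed

lemma not_block_dec_ascent:
  assumes "w \<in> Sym n" "\<not> block_dec k n w"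
  obtains p where "block_simple k n p" "w p < w (p + 1)"
proof (rule ccontr)
  assume "\<not> thesis"
  then have "\<forall>p. block_simple k n p \<longrightarrow> \<not> w p < w (p + 1)" using that by blast
  then have no: "\<not> w p < w (p + 1)" if "block_simple k n p" for p using that by blast
  have "w (p + 1) < w p" if "block_simple k n p" for p
    using no[OF that] Sym_inj[OF assms(1), of p "p + 1"] by linarith
  then have "w b < w a" if "same_block k n a b" for a b
    by (rule block_adjacent_induct[where R = "\<lambda>a b. w b < w a", OF _ _ that]) auto
  then show False using assms(2) by (simp add: block_dec_def)
qed

abbreviation adj_swap :: "(int \<Rightarrow> int) \<Rightarrow> int \<Rightarrow> int \<Rightarrow> int" where
  "adj_swap u p \<equiv> u \<circ> transpose p (p + 1)"

lemma adj_swap_apply: "adj_swap u p p = u (p + 1)" "adj_swap u p (p + 1) = u p"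
  by auto

lemma adj_swap_Sym: "u \<in> Sym n \<Longrightarrow> block_simple k n p \<Longrightarrow> adj_swap u p \<in> Sym n"
  by (intro Sym_transpose) (auto simp: block_simple_def)

lemma block_compat_ascent:
  "block_compat k n u w \<Longrightarrow> block_simple k n p \<Longrightarrow> u p < u (p + 1) \<Longrightarrow> w p < w (p + 1)"
  using block_simple_same_block by (auto simp: block_compat_def)

lemma block_compat_descent:
  assumes "block_compat k n u w" "u \<in> Sym n" "block_simple k n p" "w (p + 1) < w p"
  shows "u (p + 1) < u p"
  using block_compat_ascent[OF assms(1,3)] assms(4) Sym_inj[OF assms(2), of p "p + 1"] by linarith

text \<open>The swap permutes the pairs inside a block except for \<open>(p, p + 1)\<close>, which
  it reverses; \<open>eq\<close> is the condition left over for that pair.\<close>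

lemma block_compat_adj_swap:
  assumes bc: "block_compat k n u w" and p: "block_simple k n p"
    and eq: "u (p + 1) < u p \<Longrightarrow> w (p + 1) < w p"
  shows "block_compat k n (adj_swap u p) (adj_swap w p)"
  unfolding block_compat_def
proof (intro allI impI)
  fix a b assume ab: "same_block k n a b \<and> adj_swap u p a < adj_swap u p b"
  let ?s = "transpose p (p + 1)"
  show "adj_swap w p a < adj_swap w p b"
  proof (cases "a = p \<and> b = p + 1")
    case True
    then show ?thesis using ab eq by simp
  next
    case False
    then have "same_block k n (?s a) (?s b)"
      using ab p by (auto simp: same_block_def block_simple_def transpose_def)
    then show ?thesis using ab bc by (simp add: block_compat_def)
  qed
qed

lemma adj_young_subgroup:
  assumes "block_simple k n p"
  shows "transpose p (p + 1) \<in> young_subgroup k n"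
proof -
  have "p \<in> {1..int k} \<longleftrightarrow> p + 1 \<in> {1..int k}" using assms by (auto simp: block_simple_def)
  then have "transpose p (p + 1) ` {1..int k} = {1..int k}" by (rule transpose_image_eq)
  moreover have "transpose p (p + 1) permutes {1..int n}"
    using assms by (intro permutes_swap_id) (auto simp: block_simple_def)
  ultimately show ?thesis by (simp add: young_subgroup_def Sym_def)
qed

text \<open>\<open>z\<close> preserves the blocks, so \<open>block_shift\<close> agrees at
  \<open>p\<close> and \<open>z p\<close>. In group terms \<open>z\<close> commutes with
  \<open>t_omega\<close> and cancels between \<open>u\<close> and the inverse of
  \<open>w\<close>.\<close>

lemma f_perm_young:
  assumes n: "1 \<le> n" and w: "w \<in> Sym n" and z: "z \<in> young_subgroup k n"
  shows "f_perm k n (u \<circ> z) (w \<circ> z) = f_perm k n u w"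
proof (rule f_perm_eqI[OF n _ f_perm_periodic[OF n]])
  have zS: "z \<in> Sym n" and zk: "z ` {1..int k} = {1..int k}" using z by (auto simp: young_subgroup_def)
  show "w \<circ> z \<in> Sym n" using w zS by (auto simp: Sym_def permutes_compose)
  fix p assume p: "p \<in> {1..int n}"
  then have zp: "z p \<in> {1..int n}" using Sym_range[OF zS] by blast
  have "z p \<in> {1..int k} \<longleftrightarrow> p \<in> {1..int k}"
    using zk Sym_inj[OF zS] by (metis imageE imageI)
  then have "block_shift k n (z p) = block_shift k n p" using p zp by (auto simp: block_shift_def)
  then show "f_perm k n u w ((w \<circ> z) p) = (u \<circ> z) p + block_shift k n p"
    using f_perm_apply[OF n w zp] by simp
qed

context
  fixes k n :: nat
  assumes n: "1 \<le> n" and kn: "k \<le> n"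
begin

lemma f_perm_adj_swap:
  "w \<in> Sym n \<Longrightarrow> block_simple k n p \<Longrightarrow> f_perm k n (adj_swap u p) (adj_swap w p) = f_perm k n u w"
  by (intro f_perm_young[OF n] adj_young_subgroup)

lemma bs_pair_adj_swap:
  assumes "bs_pair k n u w" "block_simple k n p" "u (p + 1) < u p \<Longrightarrow> w (p + 1) < w p"
  shows "bs_pair k n (adj_swap u p) (adj_swap w p)"
  using assms f_perm_adj_swap block_compat_adj_swap adj_swap_Sym
  unfolding bs_pair_iff_Bound[OF n kn] by metis

section \<open>Reflections of one endpoint as reflections of the affine permutation\<close>

lemma block_shift_cases: "block_shift k n p = 0 \<or> block_shift k n p = int n"
  by (simp add: block_shift_def)

text \<open>At \<open>w p\<close> the new map must take the value
  \<open>u q + block_shift k n p\<close>, whereas \<open>f_perm k n u w\<close> at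
  \<open>w q\<close> carries the shift of \<open>q\<close>. Moving the argument by the difference of
  the shifts, a multiple of \<open>n\<close>, corrects this.\<close>

lemma f_perm_transpose_left:
  assumes u: "u \<in> Sym n" and w: "w \<in> Sym n" and pq: "1 \<le> p" "p < q" "q \<le> int n"
  shows "w p mod int n \<noteq> (w q + (block_shift k n p - block_shift k n q)) mod int n"
    "f_perm k n (u \<circ> transpose p q) w =
      f_perm k n u w \<circ> aff_refl n (w p) (w q + (block_shift k n p - block_shift k n q))"
proof -
  let ?d = "block_shift k n p - block_shift k n q"
  obtain e where e: "?d = e * int n"
    using block_shift_cases[of p] block_shift_cases[of q]
    by (metis diff_zero diff_self diff_0 mult_minus_left mult_1 mult_zero_left)
  have mq: "(w q + ?d) mod int n = w q mod int n" unfolding e by simp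
  have pI: "p \<in> {1..int n}" and qI: "q \<in> {1..int n}" using pq by auto
  have ne: "w p mod int n \<noteq> (w q + ?d) mod int n"
    using Sym_mod_inj[OF w pI qI] pq mq by auto
  show "w p mod int n \<noteq> (w q + ?d) mod int n" by (fact ne)
  note a = f_perm_apply[OF n w]
  note per = periodic_mult[OF f_perm_periodic[OF n]]
  show "f_perm k n (u \<circ> transpose p q) w = f_perm k n u w \<circ> aff_refl n (w p) (w q + ?d)"
  proof (rule f_perm_eqI[OF n w periodic_comp[OF f_perm_periodic[OF n] aff_refl_periodic]])
    fix r assume r: "r \<in> {1..int n}"
    consider "r = p" | "r = q" | "r \<noteq> p" "r \<noteq> q" by blast
    then show "(f_perm k n u w \<circ> aff_refl n (w p) (w q + ?d)) (w r) = (u \<circ> transpose p q) r + block_shift k n r"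
    proof cases
      case 1
      then have "aff_refl n (w p) (w q + ?d) (w r) = w q + e * int n"
        using aff_refl_apply'(1)[OF ne] e by simp
      then show ?thesis using 1 a[OF qI] per e by simp
    next
      case 2
      have "w r = (w q + ?d) + (- e) * int n" using 2 e by simp
      then have "aff_refl n (w p) (w q + ?d) (w r) = w p + (- e) * int n"
        using aff_refl_apply(2)[OF ne] by metis
      then show ?thesis using 2 a[OF pI] per[of k u w "w p" "- e"] e by simp
    next
      case 3
      then have "w r mod int n \<noteq> w p mod int n" "w r mod int n \<noteq> (w q + ?d) mod int n"
        using Sym_mod_inj[OF w r pI] Sym_mod_inj[OF w r qI] mq by auto
      then show ?thesis using aff_refl_apply(3)[OF ne] a[OF r] 3 by (simp add: transpose_def)
    qed
  qed
qed

lemma f_perm_transpose_right: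
  assumes u: "u \<in> Sym n" and w: "w \<in> Sym n" and pq: "1 \<le> p" "p < q" "q \<le> int n"
  shows "w p mod int n \<noteq> w q mod int n"
    "f_perm k n u (w \<circ> transpose p q) = f_perm k n u w \<circ> aff_refl n (w p) (w q)"
proof -
  have pI: "p \<in> {1..int n}" and qI: "q \<in> {1..int n}" using pq by auto
  have ne: "w p mod int n \<noteq> w q mod int n" using Sym_mod_inj[OF w pI qI] pq by auto
  then show "w p mod int n \<noteq> w q mod int n" .
  have wS: "w \<circ> transpose p q \<in> Sym n" by (rule Sym_transpose[OF w]) (use pq in auto)
  note a = f_perm_apply[OF n w]
  show "f_perm k n u (w \<circ> transpose p q) = f_perm k n u w \<circ> aff_refl n (w p) (w q)"
  proof (rule f_perm_eqI[OF n wS periodic_comp[OF f_perm_periodic[OF n] aff_refl_periodic]])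
    fix r assume r: "r \<in> {1..int n}"
    consider "r = p" | "r = q" | "r \<noteq> p" "r \<noteq> q" by blast
    then show "(f_perm k n u w \<circ> aff_refl n (w p) (w q)) ((w \<circ> transpose p q) r) = u r + block_shift k n r"
    proof cases
      case 1
      then show ?thesis using aff_refl_apply'[OF ne] a[OF pI] by simp
    next
      case 2
      then show ?thesis using aff_refl_apply'[OF ne] a[OF qI] by simp
    next
      case 3
      then have "w r mod int n \<noteq> w p mod int n" "w r mod int n \<noteq> w q mod int n"
        using Sym_mod_inj[OF w r pI] Sym_mod_inj[OF w r qI] by auto
      then show ?thesis using aff_refl_apply(3)[OF ne] a[OF r] 3 by (simp add: transpose_def)
    qed
  qed
qed

text \<open>The exchanged values are ordered by \<open>u p < u q\<close>; the question is the order
  of their arguments. For a crossing pair the correction by \<open>n\<close> puts the second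
  argument beyond the window, while inside a block only the monotonicity of \<open>w\<close> orders
  them.\<close>

lemma aff_step_f_perm_left:
  assumes u: "u \<in> Sym n" and w: "w \<in> Sym n" and inc: "block_inc k n w" and st: "up_step n u v"
  shows "aff_step n (f_perm k n u w) (f_perm k n v w)"
proof -
  obtain p q where pq: "1 \<le> p" "p < q" "q \<le> int n" and up: "u p < u q" and v: "v = u \<circ> transpose p q"
    using st unfolding up_step_def by blast
  note t = f_perm_transpose_left[OF u w pq]
  let ?d = "block_shift k n p - block_shift k n q"
  have pI: "p \<in> {1..int n}" and qI: "q \<in> {1..int n}" using pq by auto
  have r: "w p \<in> {1..int n}" "w q \<in> {1..int n}" using pI qI Sym_range[OF w] by blast+
  have lt: "w p < w q + ?d"
  proof (cases "p \<le> int k \<and> int k < q")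
    case True
    then show ?thesis using r by (simp add: block_shift_def)
  next
    case False
    then have "same_block k n p q" "?d = 0" using pq by (auto simp: same_block_def block_shift_def)
    then show ?thesis using inc by (simp add: block_inc_def)
  qed
  obtain e where e: "?d = e * int n"
    using block_shift_cases[of p] block_shift_cases[of q]
    by (metis diff_zero diff_self diff_0 mult_minus_left mult_1 mult_zero_left)
  have "f_perm k n u w (w q + ?d) = u q + block_shift k n p"
    unfolding e using periodic_mult[OF f_perm_periodic[OF n]] f_perm_apply[OF n w qI] e by simp
  then have "f_perm k n u w (w p) < f_perm k n u w (w q + ?d)"
    using f_perm_apply[OF n w pI] up by simp
  then show ?thesis unfolding aff_step_def v t(2) using lt t(1) by blast
qed

text \<open>Now the arguments are ordered by \<open>w p < w q\<close> and the values are in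
  question. For a crossing pair \<open>u p + n\<close> exceeds \<open>u q\<close>; inside a block
  the decrease of \<open>u\<close> is needed.\<close>

lemma aff_step_f_perm_right:
  assumes u: "u \<in> Sym n" and w: "w \<in> Sym n" and dec: "block_dec k n u" and st: "up_step n w v"
  shows "aff_step n (f_perm k n u v) (f_perm k n u w)"
proof -
  obtain p q where pq: "1 \<le> p" "p < q" "q \<le> int n" and up: "w p < w q" and v: "v = w \<circ> transpose p q"
    using st unfolding up_step_def by blast
  note t = f_perm_transpose_right[OF u w pq]
  have pI: "p \<in> {1..int n}" and qI: "q \<in> {1..int n}" using pq by auto
  have r: "u p \<in> {1..int n}" "u q \<in> {1..int n}" using pI qI Sym_range[OF u] by blast+
  have "u q + block_shift k n q < u p + block_shift k n p"
  proof (cases "p \<le> int k \<and> int k < q")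
    case True
    then show ?thesis using r by (simp add: block_shift_def)
  next
    case False
    then have "same_block k n p q" "block_shift k n q = block_shift k n p"
      using pq by (auto simp: same_block_def block_shift_def)
    then show ?thesis using dec by (simp add: block_dec_def)
  qed
  then have "f_perm k n u v (w p) < f_perm k n u v (w q)"
    using f_perm_apply[OF n w pI, of k u] f_perm_apply[OF n w qI, of k u] aff_refl_apply'[OF t(1)]
    unfolding v t(2) by simp
  moreover have "f_perm k n u w = f_perm k n u v \<circ> aff_refl n (w p) (w q)"
    unfolding v t(2) using aff_refl_involution[OF t(1)] by (simp add: comp_assoc)
  ultimately show ?thesis unfolding aff_step_def using up t(1) by blast
qed

lemma aff_steps_f_perm_left:
  assumes "bruhat n u v" "w \<in> Sym n" "block_inc k n w"
  shows "(aff_step n)\<^sup>*\<^sup>* (f_perm k n u w) (f_perm k n v w)"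
proof -
  have "(up_step n)\<^sup>*\<^sup>* u v" "u \<in> Sym n" using assms(1) by (auto simp: bruhat_iff_up_steps)
  then show ?thesis
  proof induction
    case (step y z)
    have "aff_step n (f_perm k n y w) (f_perm k n z w)"
      using aff_step_f_perm_left up_steps_Sym[OF step.hyps(1) step.prems] assms(2,3) step.hyps(2) by blast
    then show ?case using step.IH[OF step.prems] by (rule rtranclp.rtrancl_into_rtrancl[rotated])
  qed simp
qed

lemma aff_steps_f_perm_right:
  assumes "bruhat n w v" "u \<in> Sym n" "block_dec k n u"
  shows "(aff_step n)\<^sup>*\<^sup>* (f_perm k n u v) (f_perm k n u w)"
proof -
  have "(up_step n)\<^sup>*\<^sup>* w v" "w \<in> Sym n" using assms(1) by (auto simp: bruhat_iff_up_steps)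
  then show ?thesis
  proof induction
    case (step y z)
    have "aff_step n (f_perm k n u z) (f_perm k n u y)"
      using aff_step_f_perm_right up_steps_Sym[OF step.hyps(1) step.prems] assms(2,3) step.hyps(2) by blast
    then show ?case using step.IH[OF step.prems] by (rule converse_rtranclp_into_rtranclp)
  qed simp
qed

section \<open>Nested intervals and comparable affine permutations\<close>

lemma bruhat_Sym: "bruhat n u v \<Longrightarrow> u \<in> Sym n" "bruhat n u v \<Longrightarrow> v \<in> Sym n"
  by (auto simp: bruhat_iff_up_steps)

text \<open>The lifting property, sorted by the descents of \<open>x\<close> and \<open>y\<close> at
  \<open>p\<close>. The last two clauses only prepend or append one step.\<close>

lemma bruhat_adj_swap:
  assumes "bruhat n x y" "block_simple k n p"
  shows "x (p + 1) < x p \<Longrightarrow> y (p + 1) < y p \<Longrightarrow> bruhat n (adj_swap x p) (adj_swap y p)"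
    "x p < x (p + 1) \<Longrightarrow> y p < y (p + 1) \<Longrightarrow> bruhat n (adj_swap x p) (adj_swap y p)"
    "x p < x (p + 1) \<Longrightarrow> y (p + 1) < y p \<Longrightarrow> bruhat n x (adj_swap y p) \<and> bruhat n (adj_swap x p) y"
    "x (p + 1) < x p \<Longrightarrow> bruhat n (adj_swap x p) y"
    "y p < y (p + 1) \<Longrightarrow> bruhat n x (adj_swap y p)"
proof -
  have p: "1 \<le> p" "p < int n" using assms(2) by (auto simp: block_simple_def)
  note d = bruhat_sort_down[OF assms(1) p] and u = bruhat_sort_up[OF assms(1) p]
  show "x (p + 1) < x p \<Longrightarrow> y (p + 1) < y p \<Longrightarrow> bruhat n (adj_swap x p) (adj_swap y p)"
    "x p < x (p + 1) \<Longrightarrow> y p < y (p + 1) \<Longrightarrow> bruhat n (adj_swap x p) (adj_swap y p)"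
    "x p < x (p + 1) \<Longrightarrow> y (p + 1) < y p \<Longrightarrow> bruhat n x (adj_swap y p) \<and> bruhat n (adj_swap x p) y"
    using d u by (auto simp: sort_down_def sort_up_def)
  have x: "x \<in> Sym n" and y: "y \<in> Sym n" using assms(1) bruhat_Sym by blast+
  show "bruhat n (adj_swap x p) y" if "x (p + 1) < x p"
  proof (rule bruhat_trans[OF _ assms(1)])
    have "bruhat n (adj_swap x p) (adj_swap (adj_swap x p) p)"
      by (rule bruhat_transpose[OF adj_swap_Sym[OF x assms(2)]]) (use p that adj_swap_apply in auto)
    then show "bruhat n (adj_swap x p) x" by simp
  qed
  show "bruhat n x (adj_swap y p)" if "y p < y (p + 1)"
    by (rule bruhat_trans[OF assms(1) bruhat_transpose[OF y]]) (use p that in auto)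
qed

lemma perm_length_adj_swap:
  assumes "w \<in> Sym n" "block_simple k n p"
  shows "w p < w (p + 1) \<Longrightarrow> perm_length n (adj_swap w p) = perm_length n w + 1"
    "w (p + 1) < w p \<Longrightarrow> perm_length n w = perm_length n (adj_swap w p) + 1"
proof -
  have p: "1 \<le> p" "p < int n" using assms(2) by (auto simp: block_simple_def)
  show "w p < w (p + 1) \<Longrightarrow> perm_length n (adj_swap w p) = perm_length n w + 1"
    by (rule perm_length_adjacent[OF assms(1) p])
  show "perm_length n w = perm_length n (adj_swap w p) + 1" if "w (p + 1) < w p"
    using perm_length_adjacent[OF adj_swap_Sym[OF assms] p] that by simp
qed

text \<open>A crude ceiling that supplies a decreasing measure for the inductions in which
  \<open>u\<close> gets longer.\<close>

lemma perm_length_bound: "perm_length n u \<le> n * n"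
proof -
  have "{(i, j). 1 \<le> i \<and> i < j \<and> j \<le> int n \<and> u i > u j} \<subseteq> {1..int n} \<times> {1..int n}" by auto
  then have "perm_length n u \<le> card ({1..int n} \<times> {1..int n})"
    unfolding perm_length_def by (intro card_mono) auto
  then show ?thesis by (simp add: card_cartesian_product)
qed

text \<open>Raising \<open>u\<close> to the longest element of its coset leaves \<open>f_perm\<close> unchanged,
  and then every reflection applied to \<open>w\<close> goes in the right direction.\<close>

lemma f_perm_mono_right:
  assumes "u \<in> Sym n" "block_compat k n u w" "block_compat k n u w'" "bruhat n w w'"
  shows "(aff_step n)\<^sup>*\<^sup>* (f_perm k n u w') (f_perm k n u w)"
  using assms
proof (induction "n * n - perm_length n u" arbitrary: u w w' rule: less_induct)
  case less
  show ?case
  proof (cases "block_dec k n u")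
    case True
    then show ?thesis using aff_steps_f_perm_right less.prems by blast
  next
    case False
    then obtain p where p: "block_simple k n p" "u p < u (p + 1)"
      using not_block_dec_ascent less.prems(1) by blast
    \<comment> \<open>Compatibility transfers the ascent of \<open>u\<close> to both upper
      endpoints, so all three can be swapped together.\<close>
    have w: "w p < w (p + 1)" "w' p < w' (p + 1)"
      using block_compat_ascent[OF _ p] less.prems by blast+
    have S: "w \<in> Sym n" "w' \<in> Sym n" "adj_swap u p \<in> Sym n"
      using less.prems bruhat_Sym adj_swap_Sym p by blast+
    have "perm_length n (adj_swap u p) = perm_length n u + 1"
      using perm_length_adj_swap(1)[OF less.prems(1) p] .
    then have "n * n - perm_length n (adj_swap u p) < n * n - perm_length n u"
      using perm_length_bound[of "adj_swap u p"] by simp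
    moreover have "block_compat k n (adj_swap u p) (adj_swap w p)" "block_compat k n (adj_swap u p) (adj_swap w' p)"
      using block_compat_adj_swap[OF _ p(1)] less.prems p(2) by auto
    moreover have "bruhat n (adj_swap w p) (adj_swap w' p)"
      using bruhat_adj_swap(2)[OF less.prems(4) p(1) w] .
    ultimately have "(aff_step n)\<^sup>*\<^sup>* (f_perm k n (adj_swap u p) (adj_swap w' p)) (f_perm k n (adj_swap u p) (adj_swap w p))"
      using less.hyps S(3) by blast
    then show ?thesis using f_perm_adj_swap S p(1) by simp
  qed
qed

text \<open>A descent of \<open>w'\<close> at \<open>p\<close> forces one of \<open>u'\<close>, so
  \<open>(u', w')\<close> can be shortened. If \<open>w\<close> descends at \<open>p\<close> too,
  then so does \<open>u\<close>, and \<open>(u, w)\<close> is shortened along with it; otherwise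
  lifting keeps \<open>(u, w)\<close> nested as it stands.\<close>

lemma f_perm_antimono:
  assumes "bs_pair k n u w" "bs_pair k n u' w'" "bruhat n u' u" "bruhat n w w'"
  shows "(aff_step n)\<^sup>*\<^sup>* (f_perm k n u' w') (f_perm k n u w)"
  using assms
proof (induction "perm_length n w'" arbitrary: u w u' w' rule: less_induct)
  case less
  have S: "u \<in> Sym n" "w \<in> Sym n" "u' \<in> Sym n" "w' \<in> Sym n"
    and bc: "block_compat k n u w" "block_compat k n u' w'"
    using less.prems unfolding bs_pair_iff_Bound[OF n kn] by blast+
  show ?case
  proof (cases "block_inc k n w'")
    case True
    \<comment> \<open>An increasing \<open>w'\<close> is compatible with every lower endpoint, in
      particular with \<open>u\<close>, so the mixed pair \<open>(u, w')\<close> can serve as the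
      intermediate.\<close>
    then have "block_compat k n u w'" by (simp add: block_inc_def block_compat_def)
    then have "(aff_step n)\<^sup>*\<^sup>* (f_perm k n u w') (f_perm k n u w)"
      using f_perm_mono_right[OF S(1) bc(1)] less.prems(4) by blast
    moreover have "(aff_step n)\<^sup>*\<^sup>* (f_perm k n u' w') (f_perm k n u w')"
      using aff_steps_f_perm_left[OF less.prems(3) S(4) True] .
    ultimately show ?thesis by (rule rtranclp_trans[rotated])
  next
    case False
    then obtain p where p: "block_simple k n p" "w' (p + 1) < w' p"
      using not_block_inc_descent S by blast
    have du': "u' (p + 1) < u' p" using block_compat_descent bc(2) S p by blast
    have len: "perm_length n (adj_swap w' p) < perm_length n w'"
      using perm_length_adj_swap(2)[OF S(4) p] by simp
    have bs': "bs_pair k n (adj_swap u' p) (adj_swap w' p)"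
      using bs_pair_adj_swap less.prems(2) p by blast
    have f': "f_perm k n (adj_swap u' p) (adj_swap w' p) = f_perm k n u' w'"
      using f_perm_adj_swap S p by blast
    show ?thesis
    proof (cases "w (p + 1) < w p")
      case True
      then have du: "u (p + 1) < u p" using block_compat_descent bc(1) S p by blast
      have bs: "bs_pair k n (adj_swap u p) (adj_swap w p)"
        using bs_pair_adj_swap less.prems(1) p True by blast
      show ?thesis
        using less.hyps[OF len bs bs' bruhat_adj_swap(1)[OF less.prems(3) p(1) du' du]
            bruhat_adj_swap(1)[OF less.prems(4) p(1) True p(2)]]
        unfolding f' f_perm_adj_swap[OF S(2) p(1)] .
    next
      case False
      then have up: "w p < w (p + 1)" using Sym_inj[OF S(2), of p "p + 1"] by linarith
      show ?thesis
        using less.hyps[OF len less.prems(1) bs' bruhat_adj_swap(4)[OF less.prems(3) p(1) du']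
            bruhat_adj_swap(3)[OF less.prems(4) p(1) up p(2), THEN conjunct1]]
        unfolding f' .
    qed
  qed
qed

text \<open>This depends only on the class of \<open>(u', w')\<close>, which makes the order on classes transitive.\<close>

definition covers_rep :: "(int \<Rightarrow> int) \<Rightarrow> (int \<Rightarrow> int) \<Rightarrow> (int \<Rightarrow> int) \<Rightarrow> bool" where
  "covers_rep g u' w' \<longleftrightarrow>
     (\<exists>u w. bs_pair k n u w \<and> f_perm k n u w = g \<and> bruhat n u' u \<and> bruhat n w w')"

text \<open>Passing down, the inner pair is swapped as well if \<open>w\<close> descends at
  \<open>p\<close>; passing back up, if \<open>u\<close> ascends at \<open>p\<close>. Otherwise it
  is kept. Lifting preserves the nesting and the swap preserves \<open>f_perm\<close>.\<close>

lemma covers_rep_adj_swap: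
  assumes bs': "bs_pair k n u' w'" and p: "block_simple k n p" and d: "w' (p + 1) < w' p"
  shows "covers_rep g u' w' \<longleftrightarrow> covers_rep g (adj_swap u' p) (adj_swap w' p)"
proof
  have S': "u' \<in> Sym n" "w' \<in> Sym n" and bc': "block_compat k n u' w'"
    using bs' unfolding bs_pair_iff_Bound[OF n kn] by blast+
  have du': "u' (p + 1) < u' p" using block_compat_descent bc' S' p d by blast
  {
    assume "covers_rep g u' w'"
    then obtain u w where bs: "bs_pair k n u w" and f: "f_perm k n u w = g" and b: "bruhat n u' u" "bruhat n w w'"
      unfolding covers_rep_def by blast
    have S: "u \<in> Sym n" "w \<in> Sym n" and bc: "block_compat k n u w"
      using bs unfolding bs_pair_iff_Bound[OF n kn] by blast+
    show "covers_rep g (adj_swap u' p) (adj_swap w' p)"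
    proof (cases "w (p + 1) < w p")
      case True
      then have du: "u (p + 1) < u p" using block_compat_descent bc S p by blast
      then show ?thesis unfolding covers_rep_def
        using bs_pair_adj_swap[OF bs p True] f_perm_adj_swap[OF S(2) p, of u] f
          bruhat_adj_swap(1)[OF b(1) p du' du] bruhat_adj_swap(1)[OF b(2) p True d] by metis
    next
      case False
      then have up: "w p < w (p + 1)" using Sym_inj[OF S(2), of p "p + 1"] by linarith
      then show ?thesis unfolding covers_rep_def
        using bs f bruhat_adj_swap(4)[OF b(1) p du'] bruhat_adj_swap(3)[OF b(2) p up d] by blast
    qed
  }
  {
    assume "covers_rep g (adj_swap u' p) (adj_swap w' p)"
    then obtain u w where bs: "bs_pair k n u w" and f: "f_perm k n u w = g"
      and b: "bruhat n (adj_swap u' p) u" "bruhat n w (adj_swap w' p)"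
      unfolding covers_rep_def by blast
    have S: "u \<in> Sym n" "w \<in> Sym n" and bc: "block_compat k n u w"
      using bs unfolding bs_pair_iff_Bound[OF n kn] by blast+
    have asc: "adj_swap u' p p < adj_swap u' p (p + 1)" "adj_swap w' p p < adj_swap w' p (p + 1)"
      using du' d by simp_all
    show "covers_rep g u' w'"
    proof (cases "u (p + 1) < u p")
      case True
      have "bruhat n u' u" using bruhat_adj_swap(3)[OF b(1) p asc(1) True] by (simp only: comp_transpose_cancel)
      moreover have "bruhat n w w'" using bruhat_adj_swap(5)[OF b(2) p asc(2)] by (simp only: comp_transpose_cancel)
      ultimately show ?thesis unfolding covers_rep_def using bs f by blast
    next
      case False
      then have up: "u p < u (p + 1)" using Sym_inj[OF S(1), of p "p + 1"] by linarith
      then have upw: "w p < w (p + 1)" using block_compat_ascent[OF bc p] by blast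
      have "bruhat n u' (adj_swap u p)" using bruhat_adj_swap(2)[OF b(1) p asc(1) up] by (simp only: comp_transpose_cancel)
      moreover have "bruhat n (adj_swap w p) w'" using bruhat_adj_swap(2)[OF b(2) p upw asc(2)] by (simp only: comp_transpose_cancel)
      moreover have "bs_pair k n (adj_swap u p) (adj_swap w p)"
        using bs_pair_adj_swap[OF bs p] False by blast
      ultimately show ?thesis unfolding covers_rep_def
        using f f_perm_adj_swap[OF S(2) p, of u] by metis
    qed
  }
qed

text \<open>A descent of \<open>w\<close> forces one of \<open>u\<close>, so removing the simple
  transposition shortens both endpoints by exactly 1; this is the length additivity required of a
  step.\<close>

lemma k_step_adj_swap:
  assumes bs: "bs_pair k n u w" and p: "block_simple k n p" and d: "w (p + 1) < w p"
  shows "k_step k n (adj_swap u p, adj_swap w p) (u, w)"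
proof -
  let ?s = "transpose p (p + 1)"
  have S: "u \<in> Sym n" "w \<in> Sym n" and bc: "block_compat k n u w"
    using bs unfolding bs_pair_iff_Bound[OF n kn] by blast+
  have du: "u (p + 1) < u p" using block_compat_descent bc S p d by blast
  have "bs_pair k n (adj_swap u p) (adj_swap w p)" using bs_pair_adj_swap[OF bs p d] by blast
  then have "(u, w) \<in> k_intervals k n" "(adj_swap u p, adj_swap w p) \<in> k_intervals k n"
    using bs k_bruhat_iff_bs_pair[OF kn] by (auto simp: k_intervals_def)
  moreover have "?s \<in> young_subgroup k n" by (rule adj_young_subgroup[OF p])
  moreover have "perm_length n ?s = 1"
  proof -
    have "id \<in> Sym n" by (simp add: Sym_def permutes_id)
    moreover have "perm_length n id = 0"
    proof -
      have "{(i, j). 1 \<le> i \<and> i < j \<and> j \<le> int n \<and> id i > id j} = {}" by auto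
      then show ?thesis by (simp only: perm_length_def card.empty)
    qed
    ultimately show ?thesis using perm_length_adj_swap(1)[of id p] p by simp
  qed
  moreover have "perm_length n u = perm_length n (adj_swap u p) + 1" "perm_length n w = perm_length n (adj_swap w p) + 1"
    using perm_length_adj_swap(2) S p d du by blast+
  ultimately show ?thesis unfolding k_step_def by (auto simp: intro!: bexI[of _ ?s])
qed

section \<open>Extremal representatives of a class and their uniqueness\<close>

lemma min_representative:
  assumes "bs_pair k n u w"
  shows "\<exists>x y. bs_pair k n x y \<and> block_inc k n y \<and> f_perm k n x y = f_perm k n u w \<and>
    (\<forall>g. covers_rep g u w \<longleftrightarrow> covers_rep g x y) \<and> equivclp (k_step k n) (u, w) (x, y)"
  using assms
proof (induction "perm_length n w" arbitrary: u w rule: less_induct)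
  case less
  have S: "u \<in> Sym n" "w \<in> Sym n" using less.prems unfolding bs_pair_iff_Bound[OF n kn] by blast+
  show ?case
  proof (cases "block_inc k n w")
    case True
    then show ?thesis using less.prems by (intro exI[of _ u] exI[of _ w]) (simp add: equivclp_refl)
  next
    case False
    then obtain p where p: "block_simple k n p" "w (p + 1) < w p"
      using not_block_inc_descent S by blast
    have "perm_length n (adj_swap w p) < perm_length n w"
      using perm_length_adj_swap(2)[OF S(2) p] by simp
    moreover have "bs_pair k n (adj_swap u p) (adj_swap w p)"
      using bs_pair_adj_swap less.prems p by blast
    ultimately obtain x y where xy: "bs_pair k n x y" "block_inc k n y"
      "f_perm k n x y = f_perm k n (adj_swap u p) (adj_swap w p)"
      "\<forall>g. covers_rep g (adj_swap u p) (adj_swap w p) \<longleftrightarrow> covers_rep g x y"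
      "equivclp (k_step k n) (adj_swap u p, adj_swap w p) (x, y)"
      using less.hyps by blast
    have "equivclp (k_step k n) (adj_swap u p, adj_swap w p) (u, w)"
      using k_step_adj_swap[OF less.prems p] by (rule r_into_equivclp)
    then have "equivclp (k_step k n) (u, w) (adj_swap u p, adj_swap w p)" by (rule equivclp_sym)
    then have "equivclp (k_step k n) (u, w) (x, y)" using xy(5) by (rule equivclp_trans)
    moreover have "f_perm k n x y = f_perm k n u w"
      unfolding xy(3) by (rule f_perm_adj_swap[OF S(2) p(1)])
    moreover have "\<forall>g. covers_rep g u w \<longleftrightarrow> covers_rep g x y"
      using xy(4) covers_rep_adj_swap[OF less.prems p] by simp
    ultimately show ?thesis using xy(1,2) by (intro exI[of _ x] exI[of _ y] conjI)
  qed
qed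

lemma max_representative:
  assumes "bs_pair k n u w"
  shows "\<exists>x y. bs_pair k n x y \<and> block_dec k n x \<and> f_perm k n x y = f_perm k n u w"
  using assms
proof (induction "n * n - perm_length n u" arbitrary: u w rule: less_induct)
  case less
  have S: "u \<in> Sym n" "w \<in> Sym n" using less.prems unfolding bs_pair_iff_Bound[OF n kn] by blast+
  show ?case
  proof (cases "block_dec k n u")
    case True
    then show ?thesis using less.prems by blast
  next
    case False
    then obtain p where p: "block_simple k n p" "u p < u (p + 1)"
      using not_block_dec_ascent S by blast
    have "perm_length n (adj_swap u p) = perm_length n u + 1"
      using perm_length_adj_swap(1)[OF S(1) p] .
    then have "n * n - perm_length n (adj_swap u p) < n * n - perm_length n u"
      using perm_length_bound[of "adj_swap u p"] by simp
    moreover have "bs_pair k n (adj_swap u p) (adj_swap w p)"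
      using bs_pair_adj_swap[OF less.prems p(1)] p(2) by simp
    ultimately obtain x y where "bs_pair k n x y" "block_dec k n x"
      "f_perm k n x y = f_perm k n (adj_swap u p) (adj_swap w p)"
      using less.hyps by blast
    then show ?thesis using f_perm_adj_swap[OF S(2) p(1), of u] by metis
  qed
qed

lemma increasing_enumeration_unique:
  fixes f g :: "int \<Rightarrow> int"
  assumes "\<And>i j. a \<le> i \<Longrightarrow> i < j \<Longrightarrow> j \<le> b \<Longrightarrow> f i < f j" "\<And>i j. a \<le> i \<Longrightarrow> i < j \<Longrightarrow> j \<le> b \<Longrightarrow> g i < g j"
    and "f ` {a..b} = g ` {a..b}"
  shows "i \<in> {a..b} \<Longrightarrow> f i = g i"
proof (induction "nat (i - a)" arbitrary: i rule: less_induct)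
  case less
  \<comment> \<open>The value \<open>g' i\<close> is taken by \<open>f'\<close> at some
    \<open>j\<close>, and \<open>j < i\<close> is excluded because the maps agree there. The claim
    is used in both directions.\<close>
  have below: "f' i \<le> g' i"
    if fg: "\<And>i j. a \<le> i \<Longrightarrow> i < j \<Longrightarrow> j \<le> b \<Longrightarrow> f' i < f' j" "\<And>i j. a \<le> i \<Longrightarrow> i < j \<Longrightarrow> j \<le> b \<Longrightarrow> g' i < g' j"
      "f' ` {a..b} = g' ` {a..b}" and eq: "\<And>j. a \<le> j \<Longrightarrow> j < i \<Longrightarrow> f' j = g' j"
    for f' g' :: "int \<Rightarrow> int"
  proof -
    have "g' i \<in> f' ` {a..b}" using less.prems fg(3) by simp
    then obtain j where j: "g' i = f' j" "j \<in> {a..b}" by (rule imageE)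
    have "\<not> j < i"
    proof
      assume "j < i"
      then have "f' j = g' j" "g' j < g' i" using eq[of j] fg(2)[of j i] j less.prems by auto
      then show False using j(1) by simp
    qed
    then show ?thesis using fg(1)[of i j] j less.prems by (cases "i = j") auto
  qed
  have eq: "f j = g j" if "a \<le> j" "j < i" for j using less.hyps[of j] that less.prems by auto
  have "f i \<le> g i" by (rule below) (use assms eq in auto)
  moreover have "g i \<le> f i" by (rule below) (use assms eq in auto)
  ultimately show ?case by simp
qed

text \<open>The image of the first block under \<open>w\<close> consists of the arguments in the
  window where the affine permutation exceeds \<open>n\<close>. Monotonicity recovers
  \<open>w\<close> from this set, and then the values recover \<open>u\<close>.\<close>

lemma block_inc_representative_unique:
  assumes "bs_pair k n u w" "bs_pair k n x y" "block_inc k n w" "block_inc k n y"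
    and eq: "f_perm k n u w = f_perm k n x y"
  shows "u = x \<and> w = y"
proof -
  have S: "u \<in> Sym n" "w \<in> Sym n" "x \<in> Sym n" "y \<in> Sym n"
    using assms(1,2) unfolding bs_pair_iff_Bound[OF n kn] by blast+
  have img: "v ` {1..int k} = {i \<in> {1..int n}. int n < f_perm k n t v i}"
    if t: "t \<in> Sym n" and v: "v \<in> Sym n" for t v
  proof (intro equalityI subsetI)
    fix i assume "i \<in> v ` {1..int k}"
    then obtain p where p: "i = v p" "p \<in> {1..int k}" by (rule imageE)
    then have pI: "p \<in> {1..int n}" using kn by auto
    then have "t p \<in> {1..int n}" "v p \<in> {1..int n}" using Sym_range[OF t] Sym_range[OF v] by blast+
    then show "i \<in> {i \<in> {1..int n}. int n < f_perm k n t v i}"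
      using p f_perm_apply[OF n v pI] by (simp add: block_shift_def)
  next
    fix i assume i: "i \<in> {i \<in> {1..int n}. int n < f_perm k n t v i}"
    then have "i \<in> v ` {1..int n}" using Sym_image[OF v] by simp
    then obtain p where p: "i = v p" "p \<in> {1..int n}" by (rule imageE)
    have "t p \<in> {1..int n}" using Sym_range[OF t] p by blast
    then have "p \<le> int k" using i p f_perm_apply[OF n v p(2), of k t] by (auto simp: block_shift_def split: if_splits)
    then show "i \<in> v ` {1..int k}" using p by auto
  qed
  have low: "w ` {1..int k} = y ` {1..int k}" using img[OF S(1,2)] img[OF S(3,4)] eq by simp
  have split: "v ` {int k + 1..int n} = {1..int n} - v ` {1..int k}" if v: "v \<in> Sym n" for v
  proof -
    have "{int k + 1..int n} = {1..int n} - {1..int k}" by auto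
    moreover have "inj v" using Sym_inj[OF v] by (simp add: inj_def)
    ultimately show ?thesis using Sym_image[OF v] by (simp add: image_set_diff)
  qed
  have high: "w ` {int k + 1..int n} = y ` {int k + 1..int n}" using split S low by simp
  have inc: "v i < v j" if "block_inc k n v" "1 \<le> i" "i < j" "j \<le> int n" "j \<le> int k \<or> int k < i" for v i j
    using that by (auto simp: block_inc_def same_block_def)
  have "w = y"
  proof (rule Sym_eqI[OF S(2,4)])
    fix i assume i: "i \<in> {1..int n}"
    show "w i = y i"
    proof (cases "i \<le> int k")
      case True
      then have "i \<in> {1..int k}" using i by simp
      then show ?thesis
        by (rule increasing_enumeration_unique[rotated -1]) (use low inc assms(3,4) kn in auto)
    next
      case False
      then have "i \<in> {int k + 1..int n}" using i by simp
      then show ?thesis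
        by (rule increasing_enumeration_unique[rotated -1]) (use high inc assms(3,4) kn in auto)
    qed
  qed
  moreover have "u = x"
  proof (rule Sym_eqI[OF S(1,3)])
    fix i assume i: "i \<in> {1..int n}"
    show "u i = x i"
      using f_perm_apply[OF n S(2) i, of k u] f_perm_apply[OF n S(4) i, of k x] eq \<open>w = y\<close> by simp
  qed
  ultimately show ?thesis by simp
qed

lemma f_perm_eq_imp:
  assumes "bs_pair k n u w" "bs_pair k n x y" "f_perm k n u w = f_perm k n x y"
  shows "equivclp (k_step k n) (u, w) (x, y)" "covers_rep g u w \<longleftrightarrow> covers_rep g x y"
proof -
  obtain u1 w1 where 1: "bs_pair k n u1 w1" "block_inc k n w1" "f_perm k n u1 w1 = f_perm k n u w"
    "\<forall>g. covers_rep g u w \<longleftrightarrow> covers_rep g u1 w1" "equivclp (k_step k n) (u, w) (u1, w1)"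
    using min_representative[OF assms(1)] by blast
  obtain x1 y1 where 2: "bs_pair k n x1 y1" "block_inc k n y1" "f_perm k n x1 y1 = f_perm k n x y"
    "\<forall>g. covers_rep g x y \<longleftrightarrow> covers_rep g x1 y1" "equivclp (k_step k n) (x, y) (x1, y1)"
    using min_representative[OF assms(2)] by blast
  have e: "u1 = x1 \<and> w1 = y1"
    by (rule block_inc_representative_unique) (use 1 2 assms(3) in auto)
  show "covers_rep g u w \<longleftrightarrow> covers_rep g x y" using 1(4) 2(4) e by simp
  show "equivclp (k_step k n) (u, w) (x, y)"
    using 1(5) 2(5) e by (metis equivclp_sym equivclp_trans)
qed

end

section \<open>The isomorphism\<close>

context
  fixes k n :: nat
  assumes n: "1 \<le> n" and kn: "k \<le> n"
begin

text \<open>Subtracting \<open>n\<close> from the values above \<open>n\<close> makes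
  \<open>f\<close> a permutation of the window, so the sum of displacements is \<open>n\<close>
  times the number of values that had to be reduced.\<close>

lemma card_exceedances:
  assumes f: "f \<in> Bound k n"
  shows "card {i \<in> {1..int n}. int n < f i} = k"
    "inj_on (\<lambda>i. f i - (if int n < f i then int n else 0)) {1..int n}"
    "(\<lambda>i. f i - (if int n < f i then int n else 0)) ` {1..int n} = {1..int n}"
proof -
  let ?I = "{1..int n}"
  let ?v = "\<lambda>i. f i - (if int n < f i then int n else 0)"
  have fa: "f \<in> affine_perms k n" and fb: "\<And>i. i \<le> f i" "\<And>i. f i \<le> i + int n" using f by (auto simp: Bound_def)
  have fp: "periodic n f" and inj: "inj f" and fs: "(\<Sum>i\<in>?I. f i - i) = int k * int n"
    using fa affine_perms_iff[OF n] by (auto simp: bij_is_inj)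
  show vinj: "inj_on ?v ?I"
  proof (rule inj_onI)
    fix i j assume ij: "i \<in> ?I" "j \<in> ?I" "?v i = ?v j"
    have "?v l mod int n = f l mod int n" for l by simp
    then have "f i mod int n = f j mod int n" using ij(3) by metis
    then show "i = j" using periodic_mod_iff[OF fp inj] residue_unique ij(1,2) by blast
  qed
  have "?v ` ?I \<subseteq> ?I"
  proof
    fix y assume "y \<in> ?v ` ?I"
    then obtain i where "y = ?v i" "i \<in> ?I" by (rule imageE)
    then show "y \<in> ?I" using fb[of i] by auto
  qed
  then show vI: "?v ` ?I = ?I" using vinj by (intro endo_inj_surj) auto
  have "(\<Sum>i\<in>?I. ?v i) = (\<Sum>i\<in>?I. i)"
    using sum.reindex[OF vinj, of "\<lambda>i. i"] vI by simp
  then have "(\<Sum>i\<in>?I. if int n < f i then int n else 0) = int k * int n"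
    using fs by (simp add: sum_subtractf)
  moreover have "(\<Sum>i\<in>?I. if int n < f i then int n else 0) = int (card {i \<in> ?I. int n < f i}) * int n"
    by (simp add: sum.If_cases Int_def)
  ultimately have "int (card {i \<in> ?I. int n < f i}) * int n = int k * int n" by simp
  then show "card {i \<in> ?I. int n < f i} = k" using n by simp
qed

text \<open>Among the permutations sending the first block onto \<open>A\<close>, one of least
  length will do: a descent inside a block could be removed without changing the image.\<close>

lemma block_inc_perm_exists:
  assumes A: "A \<subseteq> {1..int n}" "card A = k"
  shows "\<exists>w\<in>Sym n. w ` {1..int k} = A \<and> block_inc k n w"
proof -
  let ?I = "{1..int n}" and ?K = "{1..int k}" and ?L = "{int k + 1..int n}"
  have finA: "finite A" using A(1) by (rule finite_subset) simp
  have "card ?K = card A" "card ?L = card (?I - A)"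
    using A finA by (simp_all add: card_Diff_subset)
  then obtain g h where g: "bij_betw g ?K A" and h: "bij_betw h ?L (?I - A)"
    using finite_same_card_bij[of ?K A] finite_same_card_bij[of ?L "?I - A"] finA by auto
  define w0 where "w0 i = (if i \<in> ?K then g i else if i \<in> ?I then h i else i)" for i
  have "bij_betw w0 ?K A" using g by (rule bij_betw_cong[THEN iffD1, rotated]) (simp add: w0_def)
  moreover have "bij_betw w0 ?L (?I - A)" using h by (rule bij_betw_cong[THEN iffD1, rotated]) (auto simp: w0_def)
  ultimately have "bij_betw w0 (?K \<union> ?L) (A \<union> (?I - A))" by (rule bij_betw_combine) auto
  moreover have "?K \<union> ?L = ?I" "A \<union> (?I - A) = ?I" using A(1) kn by auto
  ultimately have "bij_betw w0 ?I ?I" by simp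
  then have "w0 permutes ?I" by (rule bij_imp_permutes) (use kn in \<open>auto simp: w0_def\<close>)
  then have "w0 \<in> Sym n \<and> w0 ` ?K = A"
    using \<open>bij_betw w0 ?K A\<close> by (simp add: Sym_def bij_betw_imp_surj_on)
  from ex_has_least_nat[of "\<lambda>w. w \<in> Sym n \<and> w ` ?K = A", OF this, of "perm_length n"]
  obtain w where w: "w \<in> Sym n" "w ` ?K = A"
    and least: "\<And>y. y \<in> Sym n \<Longrightarrow> y ` ?K = A \<Longrightarrow> perm_length n w \<le> perm_length n y"
    by blast
  have "block_inc k n w"
  proof (rule ccontr)
    assume "\<not> block_inc k n w"
    then obtain p where p: "block_simple k n p" "w (p + 1) < w p"
      using not_block_inc_descent w(1) by blast
    have "transpose p (p + 1) ` ?K = ?K" using adj_young_subgroup[OF p(1)] by (simp add: young_subgroup_def)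
    then have "adj_swap w p ` ?K = A" using w(2) by (metis image_comp)
    then have "perm_length n w \<le> perm_length n (adj_swap w p)"
      using least adj_swap_Sym[OF w(1) p(1)] by blast
    then show False using perm_length_adj_swap(2)[OF n kn w(1) p] by simp
  qed
  then show ?thesis using w by blast
qed

lemma Bound_representative:
  assumes f: "f \<in> Bound k n"
  shows "\<exists>u w. bs_pair k n u w \<and> f_perm k n u w = f"
proof -
  let ?I = "{1..int n}" and ?A = "{i \<in> {1..int n}. int n < f i}"
  let ?v = "\<lambda>i. f i - (if int n < f i then int n else 0)"
  have "?A \<subseteq> ?I" by blast
  then obtain w where w: "w \<in> Sym n" "w ` {1..int k} = ?A" "block_inc k n w"
    using block_inc_perm_exists card_exceedances(1)[OF f] by blast
  define u where "u p = (if p \<in> ?I then ?v (w p) else p)" for p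
  have winj: "inj_on w ?I" using Sym_inj[OF w(1)] by (simp add: inj_on_def)
  have "inj_on (?v \<circ> w) ?I"
    by (rule comp_inj_on[OF winj]) (use card_exceedances(2)[OF f] Sym_image[OF w(1)] in simp)
  moreover have "(?v \<circ> w) ` ?I = ?I"
    using card_exceedances(3)[OF f] Sym_image[OF w(1)] by (metis image_comp)
  ultimately have "bij_betw (?v \<circ> w) ?I ?I" by (simp add: bij_betw_def)
  then have "bij_betw u ?I ?I" by (rule bij_betw_cong[THEN iffD1, rotated]) (simp add: u_def)
  then have "u permutes ?I" by (rule bij_imp_permutes) (simp only: u_def if_False)
  then have u: "u \<in> Sym n" by (simp add: Sym_def)
  have fp: "periodic n f" using f affine_perms_periodic by (auto simp: Bound_def)
  have fw: "f (w p) = u p + block_shift k n p" if p: "p \<in> ?I" for p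
  proof -
    have "w p \<in> w ` {1..int k} \<longleftrightarrow> p \<in> {1..int k}" using Sym_inj[OF w(1)] by auto
    moreover have "w p \<in> ?I" using Sym_range[OF w(1)] p by blast
    ultimately have "int n < f (w p) \<longleftrightarrow> p \<le> int k" using w(2) p by auto
    then show ?thesis using p by (simp add: u_def block_shift_def)
  qed
  have "f_perm k n u w = f" by (rule f_perm_eqI[OF n w(1) fp fw])
  moreover have "block_compat k n u w" using w(3) by (simp add: block_inc_def block_compat_def)
  ultimately show ?thesis using u w(1) f bs_pair_iff_Bound[OF n kn] by blast
qed

text \<open>A single reflection between bounded affine permutations is realised by a reflection of one endpoint
  of a suitable representative: of the upper endpoint of the representative with \<open>u\<close> longest in its
  coset if the reflection exchanges a value above \<open>n\<close> with a value up to \<open>n\<close> inside the window, and of the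
  lower endpoint of the representative with \<open>w\<close> shortest in its coset otherwise.\<close>

lemma aff_step_covers_rep:
  assumes st: "aff_step n f' f" and f: "f \<in> Bound k n" and f': "f' \<in> Bound k n"
  shows "\<exists>u' w'. bs_pair k n u' w' \<and> f_perm k n u' w' = f' \<and> covers_rep k n f u' w'"
proof -
  let ?I = "{1..int n}"
  note iff = bs_pair_iff_Bound[OF n kn]
  have fb: "i \<le> f i" "f i \<le> i + int n" for i using f by (auto simp: Bound_def)
  have fp: "periodic n f" "periodic n f'" using f f' affine_perms_periodic by (auto simp: Bound_def)
  obtain a0 b0 where ab0: "a0 < b0" "a0 mod int n \<noteq> b0 mod int n" "f' a0 < f' b0" "f = f' \<circ> aff_refl n a0 b0"
    using st unfolding aff_step_def by blast
  define m where "m = - ((a0 - 1) div int n)"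
  define a where "a = a0 + m * int n"
  define b where "b = b0 + m * int n"
  have aI: "a \<in> ?I" using residue_rep(1,3)[OF n, of a0] by (simp add: a_def m_def algebra_simps)
  have ab: "a < b" "a mod int n \<noteq> b mod int n" "f' a < f' b" "f = f' \<circ> aff_refl n a b"
    using ab0 aff_refl_translate[of n a0 m b0] periodic_mult[OF fp(2)] unfolding a_def b_def by auto
  have f'f: "f' = f \<circ> aff_refl n a b"
    unfolding ab(4) using aff_refl_involution[OF ab(2)] by (simp add: comp_assoc)
  have gt: "f b < f a" unfolding ab(4) using ab(3) aff_refl_apply'[OF ab(2)] by simp
  \<comment> \<open>From \<open>b \<le> f b < f a \<le> a + n\<close>: the second argument lies in
    the window of \<open>a\<close> or in the next one.\<close>
  have b_less: "b < a + int n" using gt fb(1)[of b] fb(2)[of a] by linarith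
  obtain u0 w0 where r0: "bs_pair k n u0 w0" "f_perm k n u0 w0 = f" using Bound_representative[OF f] by blast
  have pos: "\<exists>p\<in>?I. w p = i \<and> f i = u p + block_shift k n p"
    if "w \<in> Sym n" "f_perm k n u w = f" "i \<in> ?I" for u w i
  proof -
    have "i \<in> w ` ?I" using Sym_image[OF that(1)] that(3) by simp
    then obtain p where "i = w p" "p \<in> ?I" by (rule imageE)
    then show ?thesis using f_perm_apply[OF n that(1), of p k u] that(2) by auto
  qed
  show ?thesis
  proof (cases "b \<le> int n \<and> int n < f a \<and> f b \<le> int n")
    case True
    obtain u w where r: "bs_pair k n u w" "block_dec k n u" "f_perm k n u w = f"
      using max_representative[OF n kn r0(1)] r0(2) by auto
    have S: "u \<in> Sym n" "w \<in> Sym n" using r(1) iff by auto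
    have bI: "b \<in> ?I" using True ab(1) aI by auto
    obtain p where p: "p \<in> ?I" "w p = a" "f a = u p + block_shift k n p" using pos[OF S(2) r(3) aI] by blast
    obtain q where q: "q \<in> ?I" "w q = b" "f b = u q + block_shift k n q" using pos[OF S(2) r(3) bI] by blast
    have "u p \<in> ?I" "u q \<in> ?I" using p q Sym_range[OF S(1)] by blast+
    then have "p \<le> int k" "int k < q" using p q True by (auto simp: block_shift_def split: if_splits)
    then have pq: "1 \<le> p" "p < q" "q \<le> int n" using p q by auto
    let ?w = "w \<circ> transpose p q"
    have e: "f_perm k n u ?w = f'" using f_perm_transpose_right(2)[OF n kn S pq] p q r(3) f'f by simp
    have wS: "?w \<in> Sym n" by (rule Sym_transpose[OF S(2)]) (use pq in auto)
    \<comment> \<open>Inside a block \<open>u\<close> has no ascents, so compatibility with any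
      upper endpoint is vacuous.\<close>
    have "block_compat k n u ?w" using r(2) by (force simp: block_dec_def block_compat_def)
    then have "bs_pair k n u ?w" using iff S wS e f' by simp
    moreover have "bruhat n w ?w" by (rule bruhat_transpose[OF S(2) pq]) (use p q ab(1) in simp)
    then have "covers_rep k n f u ?w"
      unfolding covers_rep_def[OF n kn] using r(1,3) bruhat_refl[OF S(1)] by blast
    ultimately show ?thesis using e by blast
  next
    case False
    obtain u w where r: "bs_pair k n u w" "block_inc k n w" "f_perm k n u w = f"
      using min_representative[OF n kn r0(1)] r0(2) by auto
    have S: "u \<in> Sym n" "w \<in> Sym n" using r(1) iff by auto
    obtain p where p: "p \<in> ?I" "w p = a" "f a = u p + block_shift k n p" using pos[OF S(2) r(3) aI] by blast
    have "\<exists>q. q \<in> ?I \<and> p < q \<and> u q < u p \<and> b = w q + (block_shift k n p - block_shift k n q)"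
    proof (cases "b \<le> int n")
      case True
      then have bI: "b \<in> ?I" using ab(1) aI by auto
      obtain q where q: "q \<in> ?I" "w q = b" "f b = u q + block_shift k n q" using pos[OF S(2) r(3) bI] by blast
      have rng: "u p \<in> ?I" "u q \<in> ?I" using p q Sym_range[OF S(1)] by blast+
      \<comment> \<open>With the first case excluded and \<open>f b < f a\<close>, both values lie
        on the same side of \<open>n\<close>, so \<open>a\<close> and \<open>b\<close> come from one
        block.\<close>
      have same: "p \<le> int k \<longleftrightarrow> q \<le> int k"
        using p q rng gt False True by (auto simp: block_shift_def split: if_splits)
      then have d: "block_shift k n p = block_shift k n q" by (simp add: block_shift_def)
      have "\<not> q < p"
      proof
        assume "q < p"
        then have "same_block k n q p" using p q same by (auto simp: same_block_def)
        then have "w q < w p" using r(2) by (simp add: block_inc_def)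
        then show False using p q ab(1) by simp
      qed
      then have "p < q" using p q ab(1) by (cases "p = q") auto
      then show ?thesis using p q gt d by (intro exI[of _ q]) simp
    next
      case False
      then have bI: "b - int n \<in> ?I" using b_less aI by auto
      obtain q where q: "q \<in> ?I" "w q = b - int n" "f (b - int n) = u q + block_shift k n q"
        using pos[OF S(2) r(3) bI] by blast
      have rng: "u p \<in> ?I" "u q \<in> ?I" using p q Sym_range[OF S(1)] by blast+
      have fbn: "f b = f (b - int n) + int n" using fp(1) unfolding periodic_def by (metis diff_add_cancel)
      \<comment> \<open>Here \<open>f a\<close> exceeds \<open>f (b - n) + n\<close>, which is
        possible only if \<open>f a\<close> carries the shift by \<open>n\<close> and
        \<open>f (b - n)\<close> does not.\<close>
      have "p \<le> int k" "int k < q"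
        using p q rng gt fbn by (auto simp: block_shift_def split: if_splits)
      then show ?thesis using p q gt fbn by (intro exI[of _ q]) (simp add: block_shift_def)
    qed
    then obtain q where q: "q \<in> ?I" "p < q" "u q < u p" "b = w q + (block_shift k n p - block_shift k n q)"
      by blast
    have pq: "1 \<le> p" "p < q" "q \<le> int n" using p q by auto
    let ?u = "u \<circ> transpose p q"
    have e: "f_perm k n ?u w = f'" using f_perm_transpose_left(2)[OF n kn S pq] p q r(3) f'f by simp
    have uS: "?u \<in> Sym n" by (rule Sym_transpose[OF S(1)]) (use pq in auto)
    have "block_compat k n ?u w" using r(2) by (simp add: block_inc_def block_compat_def)
    then have "bs_pair k n ?u w" using iff S uS e f' by simp
    moreover have "bruhat n ?u (?u \<circ> transpose p q)"
      by (rule bruhat_transpose[OF uS pq]) (use q in simp)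
    then have "bruhat n ?u u" by (simp only: comp_transpose_cancel)
    then have "covers_rep k n f ?u w"
      unfolding covers_rep_def[OF n kn] using r(1,3) bruhat_refl[OF S(2)] by blast
    ultimately show ?thesis using e by blast
  qed
qed

text \<open>The chain is followed down from \<open>g\<close>. Each new step brings its own
  representative of the middle element, and the class invariance of \<open>covers_rep\<close>
  exchanges it for the one already reached.\<close>

lemma aff_steps_covers_rep:
  assumes "(aff_step n)\<^sup>*\<^sup>* f g" "f \<in> affine_perms k n" "g \<in> Bound k n"
  shows "f \<in> Bound k n \<and> (\<exists>u w. bs_pair k n u w \<and> f_perm k n u w = f \<and> covers_rep k n g u w)"
  using assms
proof (induction rule: converse_rtranclp_induct)
  case base
  obtain u w where r: "bs_pair k n u w" "f_perm k n u w = g" using Bound_representative[OF base(2)] by blast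
  then have "u \<in> Sym n" "w \<in> Sym n" using bs_pair_iff_Bound[OF n kn] by auto
  then have "covers_rep k n g u w" unfolding covers_rep_def[OF n kn] using r bruhat_refl by blast
  then show ?case using r base by blast
next
  case (step f h)
  have ha: "h \<in> affine_perms k n" using aff_step_affine_perms[OF n step.prems(1) step.hyps(1)] .
  obtain x y where xy: "h \<in> Bound k n" "bs_pair k n x y" "f_perm k n x y = h" "covers_rep k n g x y"
    using step.IH[OF ha step.prems(2)] by blast
  have fB: "f \<in> Bound k n" using Bound_aff_step[OF step.hyps(1) xy(1) step.prems(1)] .
  obtain u w where uw: "bs_pair k n u w" "f_perm k n u w = f" "covers_rep k n h u w"
    using aff_step_covers_rep[OF step.hyps(1) xy(1) fB] by blast
  then obtain u1 w1 where 1: "bs_pair k n u1 w1" "f_perm k n u1 w1 = h" "bruhat n u u1" "bruhat n w1 w"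
    unfolding covers_rep_def[OF n kn] by blast
  have "covers_rep k n g u1 w1" using f_perm_eq_imp(2)[OF n kn 1(1) xy(2)] 1(2) xy(3,4) by simp
  then have "covers_rep k n g u w"
    unfolding covers_rep_def[OF n kn] using 1(3,4) bruhat_trans by blast
  then show ?case using fB uw by blast
qed

section \<open>Classes as fibres of \<open>f_perm\<close>, and the two orders\<close>

lemma k_intervals_iff: "(u, w) \<in> k_intervals k n \<longleftrightarrow> bs_pair k n u w"
  by (simp add: k_intervals_def k_bruhat_iff_bs_pair[OF kn])

lemma k_equiv_iff:
  "((u, w), (x, y)) \<in> k_equiv k n \<longleftrightarrow> bs_pair k n u w \<and> bs_pair k n x y \<and> f_perm k n u w = f_perm k n x y"
proof -
  have step: "f_perm k n (fst p) (snd p) = f_perm k n (fst q) (snd q)" if "k_step k n p q" for p q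
    using that f_perm_young[OF n] bs_pair_iff_Bound[OF n kn]
    by (auto simp: k_step_def k_intervals_iff)
  have "f_perm k n (fst p) (snd p) = f_perm k n (fst q) (snd q)" if "equivclp (k_step k n) p q" for p q
    using that by (induction rule: equivclp_induct) (use step in metis)+
  from this[of "(u, w)" "(x, y)"] show ?thesis
    using f_perm_eq_imp(1)[OF n kn, of u w x y] unfolding k_equiv_def by (auto simp: k_intervals_iff)
qed

lemma k_class_eq:
  "k_class k n u w = {(x, y). bs_pair k n u w \<and> bs_pair k n x y \<and> f_perm k n u w = f_perm k n x y}"
  unfolding k_class_def using k_equiv_iff by auto

lemma class_map_k_class:
  assumes "bs_pair k n u w"
  shows "class_map k n (k_class k n u w) = f_perm k n u w"
proof -
  have "(\<lambda>(u, w). f_perm k n u w) ` k_class k n u w = {f_perm k n u w}"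
    using assms unfolding k_class_eq by auto
  then show ?thesis by (simp add: class_map_def)
qed

lemma Q_eq: "Q k n = {k_class k n u w | u w. bs_pair k n u w}"
  unfolding Q_def quotient_def k_class_def using k_intervals_iff by auto

lemma Q_member:
  assumes "q \<in> Q k n"
  shows "(u, w) \<in> q \<longleftrightarrow> bs_pair k n u w \<and> f_perm k n u w = class_map k n q"
proof -
  obtain x y where "bs_pair k n x y" "q = k_class k n x y" using assms unfolding Q_eq by blast
  then show ?thesis using class_map_k_class unfolding k_class_eq by auto
qed

lemma class_map_bij: "bij_betw (class_map k n) (Q k n) (Bound k n)"
proof (rule bij_betwI')
  fix p q assume pq: "p \<in> Q k n" "q \<in> Q k n"
  show "class_map k n p = class_map k n q \<longleftrightarrow> p = q"
    using Q_member[OF pq(1)] Q_member[OF pq(2)] by auto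
next
  fix q assume "q \<in> Q k n"
  then obtain u w where "bs_pair k n u w" "q = k_class k n u w" unfolding Q_eq by blast
  then show "class_map k n q \<in> Bound k n" using class_map_k_class bs_pair_iff_Bound[OF n kn] by simp
next
  fix f assume "f \<in> Bound k n"
  then obtain u w where uw: "bs_pair k n u w" "f_perm k n u w = f" using Bound_representative by blast
  then have "k_class k n u w \<in> Q k n" unfolding Q_eq by blast
  moreover have "f = class_map k n (k_class k n u w)" using class_map_k_class uw by simp
  ultimately show "\<exists>q\<in>Q k n. f = class_map k n q" by blast
qed

text \<open>The assumption puts both endpoints into the smaller interval, so the inclusion can be
  tested on them.\<close>

lemma bruhat_interval_subset_iff:
  assumes "bruhat n u w"
  shows "bruhat_interval n u w \<subseteq> bruhat_interval n u' w' \<longleftrightarrow> bruhat n u' u \<and> bruhat n w w'"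
proof
  assume sub: "bruhat_interval n u w \<subseteq> bruhat_interval n u' w'"
  have "u \<in> bruhat_interval n u w" "w \<in> bruhat_interval n u w"
    using assms bruhat_refl by (auto simp: bruhat_interval_def bruhat_iff_up_steps)
  then show "bruhat n u' u \<and> bruhat n w w'" using sub by (auto simp: bruhat_interval_def)
next
  assume "bruhat n u' u \<and> bruhat n w w'"
  then show "bruhat_interval n u w \<subseteq> bruhat_interval n u' w'"
    unfolding bruhat_interval_def using bruhat_trans by blast
qed

lemma bs_pair_bruhat: "bs_pair k n u w \<Longrightarrow> bruhat n u w"
  using k_bruhat_iff_bs_pair[OF kn] k_bruhat_imp_bruhat by blast

lemma Q_order_iff:
  assumes q': "q' \<in> Q k n" and q: "q \<in> Q k n"
  shows "(q', q) \<in> Q_order k n \<longleftrightarrow> (class_map k n q', class_map k n q) \<in> Bound_order k n"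
proof -
  let ?f' = "class_map k n q'" and ?f = "class_map k n q"
  have B: "?f' \<in> Bound k n" "?f \<in> Bound k n" using class_map_bij q q' by (auto dest: bij_betwE)
  then have A: "?f' \<in> affine_perms k n" "?f \<in> affine_perms k n" by (auto simp: Bound_def)
  have "(q', q) \<in> Q_order k n \<longleftrightarrow> (\<exists>u' w'. bs_pair k n u' w' \<and> f_perm k n u' w' = ?f' \<and> covers_rep k n ?f u' w')"
    (is "_ \<longleftrightarrow> ?R")
  proof
    assume "(q', q) \<in> Q_order k n"
    then obtain u w u' w' where m: "(u, w) \<in> q" "(u', w') \<in> q'"
      and sub: "bruhat_interval n u w \<subseteq> bruhat_interval n u' w'"
      unfolding Q_order_def by auto
    have bs: "bs_pair k n u w" "f_perm k n u w = ?f" "bs_pair k n u' w'" "f_perm k n u' w' = ?f'"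
      using m Q_member[OF q] Q_member[OF q'] by auto
    then have "bruhat n u' u \<and> bruhat n w w'" using sub bruhat_interval_subset_iff bs_pair_bruhat by blast
    then show ?R unfolding covers_rep_def[OF n kn] using bs by blast
  next
    assume ?R
    then obtain u w u' w' where bs: "bs_pair k n u w" "f_perm k n u w = ?f" "bs_pair k n u' w'" "f_perm k n u' w' = ?f'"
      and b: "bruhat n u' u" "bruhat n w w'"
      unfolding covers_rep_def[OF n kn] by blast
    have "(u, w) \<in> q" "(u', w') \<in> q'" using bs Q_member[OF q] Q_member[OF q'] by auto
    moreover have "bruhat_interval n u w \<subseteq> bruhat_interval n u' w'"
      using b bruhat_interval_subset_iff[OF bs_pair_bruhat[OF bs(1)]] by blast
    ultimately show "(q', q) \<in> Q_order k n" unfolding Q_order_def using q q' by blast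
  qed
  also have "\<dots> \<longleftrightarrow> (aff_step n)\<^sup>*\<^sup>* ?f' ?f"
  proof
    assume ?R
    then obtain u w u' w' where bs: "bs_pair k n u w" "f_perm k n u w = ?f" "bs_pair k n u' w'" "f_perm k n u' w' = ?f'"
      and b: "bruhat n u' u" "bruhat n w w'"
      unfolding covers_rep_def[OF n kn] by blast
    then show "(aff_step n)\<^sup>*\<^sup>* ?f' ?f" using f_perm_antimono[OF n kn bs(1,3) b] by simp
  next
    assume "(aff_step n)\<^sup>*\<^sup>* ?f' ?f"
    then show ?R using aff_steps_covers_rep[OF _ A(1) B(2)] by blast
  qed
  also have "\<dots> \<longleftrightarrow> (?f', ?f) \<in> Bound_order k n"
    unfolding Bound_order_def using affine_bruhat_iff[OF n] A B by blast
  finally show ?thesis .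
qed

lemma Bound_order_partial_order: "partial_order_on (Bound k n) (Bound_order k n)"
proof -
  have "refl_on (Bound k n) (Bound_order k n)"
    unfolding refl_on_def Bound_order_def using affine_bruhat_iff[OF n] by (auto simp: Bound_def)
  moreover have "trans (Bound_order k n)"
    unfolding trans_def Bound_order_def using affine_bruhat_iff[OF n] by (auto intro: rtranclp_trans)
  moreover have "antisym (Bound_order k n)"
    unfolding antisym_def Bound_order_def using affine_bruhat_antisym[OF n] by blast
  moreover have "Bound_order k n \<subseteq> Bound k n \<times> Bound k n" by (auto simp: Bound_order_def)
  ultimately show ?thesis by (simp add: partial_order_on_def preorder_on_def)
qed

end

text \<open>Transitivity and antisymmetry of \<open>Q_order\<close> are hard to see on
  representatives; they are transported back from \<open>Bound_order\<close> along the
  bijection.\<close>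

lemma partial_order_on_pullback:
  assumes s: "partial_order_on B s" and F: "inj_on F A" "F ` A \<subseteq> B" and r: "r \<subseteq> A \<times> A"
    and iff: "\<And>x y. x \<in> A \<Longrightarrow> y \<in> A \<Longrightarrow> (x, y) \<in> r \<longleftrightarrow> (F x, F y) \<in> s"
  shows "partial_order_on A r"
proof -
  have s': "refl_on B s" "trans s" "antisym s" using s by (auto simp: partial_order_on_def preorder_on_def)
  have "refl_on A r"
    unfolding refl_on_def using iff F(2) s'(1) r by (auto simp: refl_on_def)
  moreover have "trans r"
  proof (rule transI)
    fix x y z assume xyz: "(x, y) \<in> r" "(y, z) \<in> r"
    then have A: "x \<in> A" "y \<in> A" "z \<in> A" using r by auto
    have "(F x, F z) \<in> s" using xyz iff A transD[OF s'(2)] by blast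
    then show "(x, z) \<in> r" using iff A by blast
  qed
  moreover have "antisym r"
  proof (rule antisymI)
    fix x y assume xy: "(x, y) \<in> r" "(y, x) \<in> r"
    then have A: "x \<in> A" "y \<in> A" using r by auto
    have "F x = F y" using xy iff A antisymD[OF s'(3)] by blast
    then show "x = y" using F(1) A by (simp add: inj_on_eq_iff)
  qed
  ultimately show ?thesis using r by (simp add: partial_order_on_def preorder_on_def)
qed

text \<open>Windows and residues degenerate for \<open>n = 0\<close>: as \<open>x mod 0 = x\<close>,
  the map \<open>periodic_ext 0 g\<close> is \<open>g\<close> itself, and \<open>Sym 0\<close>,
  \<open>Q 0 0\<close> and \<open>Bound 0 0\<close> are singletons.\<close>

lemma theorem3p16_zero:
  "(\<forall>(u, w) \<in> k_intervals 0 0. class_map 0 0 (k_class 0 0 u w) = f_perm 0 0 u w)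
    \<and> poset_iso (Q 0 0) (Q_order 0 0) (Bound 0 0) (Bound_order 0 0) (class_map 0 0)
    \<and> (\<forall>(u, w) \<in> k_intervals 0 0.
          int (affine_length 0 (f_perm 0 0 u w)) =
            int 0 * (int 0 - int 0) - int (perm_length 0 w) + int (perm_length 0 u))"
proof -
  have S: "Sym 0 = {id}" by (simp add: Sym_def permutes_empty)
  have K: "k_intervals 0 0 = {(id, id)}" by (auto simp: k_intervals_def k_bruhat_def S)
  have E: "k_equiv 0 0 = {((id, id), (id, id))}" by (auto simp: k_equiv_def K)
  have Q: "Q 0 0 = {{(id, id)}}" by (auto simp: Q_def quotient_def K E)
  have f: "f_perm 0 0 id id = id"
    by (auto simp: f_perm_def t_omega_def periodic_ext_def inv_id)
  have B: "Bound 0 0 = {id}"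
  proof (intro equalityI subsetI)
    fix f assume "f \<in> Bound 0 0"
    then have "f i = id i" for i using order_antisym[of "f i" i] by (simp add: Bound_def)
    then show "f \<in> {id}" by (simp add: fun_eq_iff)
  next
    fix f :: "int \<Rightarrow> int" assume "f \<in> {id}"
    then show "f \<in> Bound 0 0" by (simp add: Bound_def id_affine_perms)
  qed
  have BO: "Bound_order 0 0 = {(id, id)}"
  proof -
    have i: "id \<in> affine_perms 0 0" by (rule id_affine_perms)
    have "id \<circ> (\<lambda>i. i - int 0) = id" by auto
    then have "affine_bruhat 0 0 id id"
      using i by (simp add: affine_bruhat_def affine_bruhat0_def bruhat_le_def)
    then show ?thesis by (auto simp: Bound_order_def B)
  qed
  have QO: "Q_order 0 0 = {({(id, id)}, {(id, id)})}" by (auto simp: Q_order_def Q)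
  have C: "class_map 0 0 {(id, id)} = id" by (simp add: class_map_def f)
  have kc: "k_class 0 0 id id = {(id, id)}" by (auto simp: k_class_def E)
  have "affine_length 0 id = 0"
  proof -
    have "{(i, j). i < j \<and> id i > (id j :: int)} = {}" by auto
    then show ?thesis by (simp only: affine_length_def quotient_empty card.empty)
  qed
  then show ?thesis
    unfolding K poset_iso_def Q QO B BO
    by (simp add: kc C f partial_order_on_def preorder_on_def refl_on_def trans_def antisym_def bij_betw_def)
qed

theorem theorem3p16:
  fixes k n :: nat
  assumes "k \<le> n"
  shows "(\<forall>(u, w) \<in> k_intervals k n. class_map k n (k_class k n u w) = f_perm k n u w)
    \<and> poset_iso (Q k n) (Q_order k n) (Bound k n) (Bound_order k n) (class_map k n)
    \<and> (\<forall>(u, w) \<in> k_intervals k n.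
          int (affine_length n (f_perm k n u w)) =
            int k * (int n - int k) - int (perm_length n w) + int (perm_length n u))"
proof (cases "n = 0")
  case True
  then show ?thesis using theorem3p16_zero assms by simp
next
  case False
  then have n: "1 \<le> n" by simp
  note bij = class_map_bij[OF n assms] and iff = Q_order_iff[OF n assms]
    and po = Bound_order_partial_order[OF n assms]
  have "partial_order_on (Q k n) (Q_order k n)"
    by (rule partial_order_on_pullback[OF po _ _ _ iff])
      (use bij in \<open>auto simp: bij_betw_def Q_order_def\<close>)
  then have "poset_iso (Q k n) (Q_order k n) (Bound k n) (Bound_order k n) (class_map k n)"
    unfolding poset_iso_def using po bij iff by blast
  then show ?thesis
    using class_map_k_class[OF n assms] affine_length_f_perm[OF n assms] k_intervals_iff[OF n assms]
    by auto
qed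

end
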